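(* For every $s\ge \frac32$, the periodic initial value problem $$u_t+u_x+uu_x+\mathcal{H}u_{xt}=0,\quad x\in\mathbb{R},\ t\in\mathbb{R},\qquad u(x,0)=u_0(x),$$ is globally well-posed in $H^s_{per}([-\pi,\pi])$.
   Context: Functions are $2\pi$-periodic in $x$ and solutions $u$ are real-valued. For a $2\pi$-periodic distribution $f$, $\widehat f(k)=\frac1{2\pi}\int_{-\pi}^{\pi}f(x)e^{-ikx}dx$, $k\in\mathbb{Z}$. $H^s_{per}([-\pi,\pi])$ is the Sobolev space of $2\pi$-periodic distributions with norm $\|f\|_{H^s_{per}}^2=2\pi\sum_{k\in\mathbb{Z}}(1+|k|^2)^s|\widehat f(k)|^2$. $\mathcal{H}$ is the Hilbert transform, $\widehat{\mathcal{H}f}(k)=-i\,\mathrm{sgn}(k)\widehat f(k)$ (so $\mathcal{H}\partial_x$ has Fourier symbol $|k|$). The equation is understood in its integrated form $u(t)=u_0+\int_0^tK(u+\frac12u^2)(\tau)\,d\tau$, where $\widehat{Kv}(n)=\frac{-in}{1+|n|}\widehat v(n)$. Globally well-posed in $H^s_{per}$ means: for every $u_0\in H^s_{per}$ there is a unique solution $u$ that lies in $C([-T,T];H^s_{per})$ for every $T>0$, and the solution depends continuously on the initial datum, as a map from $H^s_{per}$ to $C([-T,T];H^s_{per})$ for every $T>0$. *)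

theory Defs
  imports "HOL-Analysis.Analysis"
begin

definition iter_deriv :: "nat \<Rightarrow> (real \<Rightarrow> complex) \<Rightarrow> real \<Rightarrow> complex" where
  "iter_deriv n = ((\<lambda>\<phi> x. vector_derivative \<phi> (at x)) ^^ n)"

definition per_test :: "(real \<Rightarrow> complex) set" where
  "per_test = {\<phi>. (\<forall>x. \<phi> (x + 2 * pi) = \<phi> x) \<and>
                   (\<forall>n x. iter_deriv n \<phi> differentiable (at x))}"

type_synonym functional = "(real \<Rightarrow> complex) \<Rightarrow> complex"

(* Continuity is with respect to the Frechet topology of the smooth periodic functions.
   A distribution takes the value 0 off the test functions, so that equality of
   functionals is equality of distributions. *)
definition per_distr :: "functional set" where
  "per_distr = {F.
     (\<forall>\<phi>\<in>per_test. \<forall>\<psi>\<in>per_test. F (\<lambda>x. \<phi> x + \<psi> x) = F \<phi> + F \<psi>) \<and>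
     (\<forall>c. \<forall>\<phi>\<in>per_test. F (\<lambda>x. c * \<phi> x) = c * F \<phi>) \<and>
     (\<exists>N C. \<forall>\<phi>\<in>per_test. norm (F \<phi>) \<le> C * (\<Sum>j\<le>N. SUP x. norm (iter_deriv j \<phi> x))) \<and>
     (\<forall>\<phi>. \<phi> \<notin> per_test \<longrightarrow> F \<phi> = 0)}"

definition real_distr :: "functional \<Rightarrow> bool" where
  "real_distr F \<longleftrightarrow> (\<forall>\<phi>\<in>per_test. F (\<lambda>x. cnj (\<phi> x)) = cnj (F \<phi>))"

definition distr_of :: "(real \<Rightarrow> real) \<Rightarrow> functional" where
  "distr_of g = (\<lambda>\<phi>. if \<phi> \<in> per_test
                       then integral {-pi..pi} (\<lambda>x. complex_of_real (g x) * \<phi> x) else 0)"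

definition fourier_coeff :: "functional \<Rightarrow> int \<Rightarrow> complex" where
  "fourier_coeff F k = F (\<lambda>x. cis (- (of_int k * x))) / complex_of_real (2 * pi)"

definition Hper :: "real \<Rightarrow> functional set" where
  "Hper s = {F \<in> per_distr. real_distr F \<and>
     (\<lambda>k::int. (1 + \<bar>real_of_int k\<bar>\<^sup>2) powr s * (norm (fourier_coeff F k))\<^sup>2) summable_on UNIV}"

definition Hnorm :: "real \<Rightarrow> functional \<Rightarrow> real" where
  "Hnorm s F = sqrt (2 * pi *
     (\<Sum>\<^sub>\<infinity>k::int. (1 + \<bar>real_of_int k\<bar>\<^sup>2) powr s * (norm (fourier_coeff F k))\<^sup>2))"

definition distr_diff :: "functional \<Rightarrow> functional \<Rightarrow> functional" where
  "distr_diff F G = (\<lambda>\<phi>. F \<phi> - G \<phi>)"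

definition CHper :: "real \<Rightarrow> real \<Rightarrow> (real \<Rightarrow> functional) \<Rightarrow> bool" where
  "CHper s T u \<longleftrightarrow> (\<forall>t\<in>{-T..T}. u t \<in> Hper s \<and>
     ((\<lambda>\<tau>. Hnorm s (distr_diff (u \<tau>) (u t))) \<longlongrightarrow> 0) (at t within {-T..T}))"

definition CHnorm :: "real \<Rightarrow> real \<Rightarrow> (real \<Rightarrow> functional) \<Rightarrow> real" where
  "CHnorm s T u = (SUP t\<in>{-T..T}. Hnorm s (u t))"

(* By Sobolev embedding an element of H^s with s > 1/2 is a continuous periodic function,
   through which the pointwise square is taken. *)
definition cont_rep :: "functional \<Rightarrow> real \<Rightarrow> real" where
  "cont_rep F = (THE g. continuous_on UNIV g \<and> (\<forall>x. g (x + 2 * pi) = g x) \<and> F = distr_of g)"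

definition distr_square :: "functional \<Rightarrow> functional" where
  "distr_square F = distr_of (\<lambda>x. (cont_rep F x)\<^sup>2)"

(* H d/dx has symbol |n|, so u_t + u_x + u u_x + H u_xt = 0 reads
   (1 + |n|) d/dt u^(n) = - i n (u + u^2/2)^(n), that is u_t = K (u + u^2/2). *)
definition K_op :: "functional \<Rightarrow> functional" where
  "K_op F = (THE G. G \<in> per_distr \<and>
     (\<forall>n. fourier_coeff G n = - \<i> * of_int n / (1 + of_int \<bar>n\<bar>) * fourier_coeff F n))"

definition rBO_rhs :: "functional \<Rightarrow> functional" where
  "rBO_rhs F = K_op (\<lambda>\<phi>. F \<phi> + distr_square F \<phi> / 2)"

(* The analogue of has_integral for curves in H^s, with convergence in the H^s norm;
   for continuous curves this is the Riemann (equivalently Bochner) integral.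
   The memberships in H^s are needed because Hnorm is meaningless elsewhere. *)
definition has_Hper_integral ::
    "real \<Rightarrow> (real \<Rightarrow> functional) \<Rightarrow> functional \<Rightarrow> real \<Rightarrow> real \<Rightarrow> bool" where
  "has_Hper_integral s f I a b \<longleftrightarrow> I \<in> Hper s \<and> (\<forall>x\<in>{a..b}. f x \<in> Hper s) \<and>
     (\<forall>e>0. \<exists>\<gamma>. gauge \<gamma> \<and> (\<forall>D. D tagged_division_of {a..b} \<and> \<gamma> fine D \<longrightarrow>
        Hnorm s (distr_diff (\<lambda>\<phi>. \<Sum>(x, k)\<in>D. measure lborel k *\<^sub>R f x \<phi>) I) < e))"

(* The second clause is the integrated equation at negative times, where the integral
   from 0 to t is minus the integral from t to 0. *)
definition rBO_solution :: "real \<Rightarrow> functional \<Rightarrow> (real \<Rightarrow> functional) \<Rightarrow> bool" where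
  "rBO_solution s u0 u \<longleftrightarrow>
     (\<forall>T>0. CHper s T u) \<and>
     (\<forall>t\<ge>0. has_Hper_integral s (\<lambda>\<tau>. rBO_rhs (u \<tau>)) (distr_diff (u t) u0) 0 t) \<and>
     (\<forall>t\<le>0. has_Hper_integral s (\<lambda>\<tau>. rBO_rhs (u \<tau>)) (distr_diff u0 (u t)) t 0)"

definition rBO_globally_well_posed :: "real \<Rightarrow> bool" where
  "rBO_globally_well_posed s \<longleftrightarrow>
     (\<forall>u0\<in>Hper s. \<exists>!u. rBO_solution s u0 u) \<and>
     (\<forall>T>0. \<forall>u0\<in>Hper s. \<forall>u. rBO_solution s u0 u \<longrightarrow>
        (\<forall>\<epsilon>>0. \<exists>\<delta>>0. \<forall>v0\<in>Hper s. \<forall>v. rBO_solution s v0 v \<longrightarrow>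
           Hnorm s (distr_diff v0 u0) < \<delta> \<longrightarrow>
           CHnorm s T (\<lambda>t. distr_diff (v t) (u t)) < \<epsilon>))"

end

theory Submission
  imports Defs
begin

text \<open>On the Fourier side the equation is an ordinary differential equation u' = K(u + u^2/2) in a
  Hilbert space, with a field that is Lipschitz on balls because K has order zero and H^s is an
  algebra. What has to be shown is that solutions do not blow up. The energy, the sum of
  (1 + |n|) |u^(n)|^2, is conserved. As H^s is tame with respect to the Wiener norm (the sum of
  |u^(n)|), the square y of the H^s norm satisfies y' \<le> C (1 + W) y for the Wiener norm W, and
  the bound W \<le> C (1 + E + ln (3 + y)) in terms of the energy E closes the estimate.\<close>

section \<open>Square-summable Hermitian sequences\<close>

text \<open>The energy controls the H^(1/2) norm, which just fails to control the Wiener norm. The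
  failure is only logarithmic in a higher norm, so the differential inequality still closes, with a
  bound doubly exponential in time. The exponent 3/2 enters in the high frequencies of
  \<open>wiener_le_log\<close>. As a type cannot depend on s, one Hilbert space \<open>hl2\<close>
  carries every H^s: its elements are Fourier coefficients multiplied by (1 + k^2)^(s/2), and
  Hermitian symmetry says that the function is real. Blow-up is excluded without maximal intervals
  of existence. The field is truncated to a ball, the truncated equation is solved for all positive
  times, and an a priori bound that also holds for truncated fields shows the truncation to be
  inactive. The truncation only multiplies the argument by a scalar, which preserves the
  conservation law because the linear and the quadratic part of the field are separately orthogonal
  to the gradient of the energy. Negative times are reached by reversing the sign of the
  field.\<close>

typedef hl2 = "{b :: int \<Rightarrow> complex. (\<forall>k. b (- k) = cnj (b k)) \<and> (\<lambda>k. (norm (b k))\<^sup>2) summable_on UNIV}"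
  morphisms coef Abs_hl2
  by (rule exI[of _ "\<lambda>_. 0"]) simp

setup_lifting type_definition_hl2

lemma coef_minus_index: "coef b (- k) = cnj (coef b k)"
  using coef[of b] by simp

lemma coef_square_summable: "(\<lambda>k. (norm (coef b k))\<^sup>2) summable_on UNIV"
  using coef[of b] by simp

lemma hl2_eqI: "(\<And>k. coef a k = coef b k) \<Longrightarrow> a = b"
  by (metis coef_inject ext)

lemma norm_square_add_le: "(norm (x + y))\<^sup>2 \<le> 2 * (norm x)\<^sup>2 + 2 * (norm y)\<^sup>2" for x y :: "'a::real_normed_vector"
proof -
  have "(norm (x + y))\<^sup>2 \<le> (norm x + norm y)\<^sup>2"
    by (intro power_mono norm_triangle_ineq) auto
  also have "\<dots> \<le> 2 * (norm x)\<^sup>2 + 2 * (norm y)\<^sup>2"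
    using zero_le_power2[of "norm x - norm y"] by (simp add: power2_eq_square algebra_simps)
  finally show ?thesis .
qed

lemma square_summable_add:
  fixes a b :: "'i \<Rightarrow> 'a::real_normed_vector"
  assumes "(\<lambda>k. (norm (a k))\<^sup>2) summable_on A" "(\<lambda>k. (norm (b k))\<^sup>2) summable_on A"
  shows "(\<lambda>k. (norm (a k + b k))\<^sup>2) summable_on A"
proof (rule summable_on_comparison_test)
  show "(\<lambda>k. 2 * (norm (a k))\<^sup>2 + 2 * (norm (b k))\<^sup>2) summable_on A"
    by (intro summable_on_add summable_on_cmult_right assms)
qed (auto intro: norm_square_add_le)

lemma inner_summable:
  fixes a b :: "'i \<Rightarrow> 'a::real_inner"
  assumes "(\<lambda>k. (norm (a k))\<^sup>2) summable_on A" "(\<lambda>k. (norm (b k))\<^sup>2) summable_on A"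
  shows "(\<lambda>k. a k \<bullet> b k) summable_on A"
proof -
  have "(\<lambda>k. norm (a k \<bullet> b k)) summable_on A"
  proof (rule summable_on_comparison_test)
    show "(\<lambda>k. (norm (a k))\<^sup>2 + (norm (b k))\<^sup>2) summable_on A"
      by (intro summable_on_add assms)
    fix k
    have "norm (a k \<bullet> b k) \<le> norm (a k) * norm (b k)"
      by (simp add: Cauchy_Schwarz_ineq2)
    also have "\<dots> \<le> (norm (a k))\<^sup>2 + (norm (b k))\<^sup>2"
      using zero_le_power2[of "norm (a k) - norm (b k)"]
        mult_nonneg_nonneg[OF norm_ge_zero[of "a k"] norm_ge_zero[of "b k"]]
      unfolding power2_diff by linarith
    finally show "norm (a k \<bullet> b k) \<le> (norm (a k))\<^sup>2 + (norm (b k))\<^sup>2" .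
  qed auto
  then show ?thesis
    by (rule abs_summable_summable)
qed

instantiation hl2 :: real_inner
begin

lift_definition zero_hl2 :: hl2 is "\<lambda>_. 0"
  by simp

lift_definition plus_hl2 :: "hl2 \<Rightarrow> hl2 \<Rightarrow> hl2" is "\<lambda>a b k. a k + b k"
  by (auto intro: square_summable_add)

lift_definition uminus_hl2 :: "hl2 \<Rightarrow> hl2" is "\<lambda>a k. - a k"
  by simp

lift_definition minus_hl2 :: "hl2 \<Rightarrow> hl2 \<Rightarrow> hl2" is "\<lambda>a b k. a k - b k"
proof -
  fix a b :: "int \<Rightarrow> complex"
  assume "(\<forall>k. a (- k) = cnj (a k)) \<and> (\<lambda>k. (norm (a k))\<^sup>2) summable_on UNIV"
    "(\<forall>k. b (- k) = cnj (b k)) \<and> (\<lambda>k. (norm (b k))\<^sup>2) summable_on UNIV"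
  then show "(\<forall>k. a (- k) - b (- k) = cnj (a k - b k)) \<and> (\<lambda>k. (norm (a k - b k))\<^sup>2) summable_on UNIV"
    using square_summable_add[of a UNIV "\<lambda>k. - b k"] by simp
qed

lift_definition scaleR_hl2 :: "real \<Rightarrow> hl2 \<Rightarrow> hl2" is "\<lambda>r a k. r *\<^sub>R a k"
  by (auto simp: power_mult_distrib intro: summable_on_cmult_right)

definition inner_hl2 :: "hl2 \<Rightarrow> hl2 \<Rightarrow> real" where
  "inner_hl2 a b = (\<Sum>\<^sub>\<infinity>k. coef a k \<bullet> coef b k)"

definition norm_hl2 :: "hl2 \<Rightarrow> real" where
  "norm_hl2 a = sqrt (inner a a)"

definition dist_hl2 :: "hl2 \<Rightarrow> hl2 \<Rightarrow> real" where
  "dist_hl2 a b = norm (a - b)"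

definition sgn_hl2 :: "hl2 \<Rightarrow> hl2" where
  "sgn_hl2 a = inverse (norm a) *\<^sub>R a"

definition uniformity_hl2 :: "(hl2 \<times> hl2) filter" where
  "uniformity_hl2 = (INF e\<in>{0<..}. principal {(x, y). dist x y < e})"

definition open_hl2 :: "hl2 set \<Rightarrow> bool" where
  "open_hl2 U = (\<forall>x\<in>U. eventually (\<lambda>(x', y). x' = x \<longrightarrow> y \<in> U) uniformity)"

instance
proof
  fix a b c :: hl2 and r q :: real
  note sm = inner_summable[OF coef_square_summable coef_square_summable]
  show "a + b + c = a + (b + c)" "a + b = b + a" "0 + a = a" "- a + a = 0" "a - b = a + - b"
    "r *\<^sub>R (a + b) = r *\<^sub>R a + r *\<^sub>R b" "(r + q) *\<^sub>R a = r *\<^sub>R a + q *\<^sub>R a"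
    "r *\<^sub>R q *\<^sub>R a = (r * q) *\<^sub>R a" "1 *\<^sub>R a = a"
    by (transfer, simp add: algebra_simps)+
  show "dist a b = norm (a - b)" by (fact dist_hl2_def)
  show "sgn a = inverse (norm a) *\<^sub>R a" by (fact sgn_hl2_def)
  show "uniformity = (INF e\<in>{0<..}. principal {(x :: hl2, y). dist x y < e})" by (fact uniformity_hl2_def)
  show "norm a = sqrt (a \<bullet> a)" by (fact norm_hl2_def)
  show "open U = (\<forall>x\<in>U. eventually (\<lambda>(x', y). x' = x \<longrightarrow> y \<in> U) uniformity)" for U :: "hl2 set"
    by (fact open_hl2_def)
  show "a \<bullet> b = b \<bullet> a" by (simp add: inner_hl2_def inner_commute)
  show "(a + b) \<bullet> c = a \<bullet> c + b \<bullet> c"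
    by (simp add: inner_hl2_def plus_hl2.rep_eq inner_add_left infsum_add sm)
  show "(r *\<^sub>R a) \<bullet> b = r * (a \<bullet> b)"
    by (simp add: inner_hl2_def scaleR_hl2.rep_eq infsum_cmult_right')
  show "0 \<le> a \<bullet> a"
    by (simp add: inner_hl2_def infsum_nonneg)
  show "a \<bullet> a = 0 \<longleftrightarrow> a = 0"
  proof
    assume "a \<bullet> a = 0"
    then have "coef a k \<bullet> coef a k = 0" for k
      by (intro nonneg_infsum_le_0D[of "\<lambda>k. coef a k \<bullet> coef a k" UNIV]) (auto simp: inner_hl2_def sm)
    then show "a = 0"
      by (intro hl2_eqI) (simp add: zero_hl2.rep_eq)
  qed (simp add: inner_hl2_def zero_hl2.rep_eq)
qed

end

lemmas coef_simps [simp] =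
  zero_hl2.rep_eq plus_hl2.rep_eq minus_hl2.rep_eq uminus_hl2.rep_eq scaleR_hl2.rep_eq

lemma norm_hl2_square: "(norm b)\<^sup>2 = (\<Sum>\<^sub>\<infinity>k. (norm (coef b k))\<^sup>2)" for b :: hl2
  by (simp add: power2_norm_eq_inner inner_hl2_def)

lemma sum_coef_square_le: "finite S \<Longrightarrow> (\<Sum>k\<in>S. (norm (coef b k))\<^sup>2) \<le> (norm b)\<^sup>2"
  unfolding norm_hl2_square by (rule finite_sum_le_infsum) (auto simp: coef_square_summable)

lemma norm_coef_le: "norm (coef b k) \<le> norm b"
  using sum_coef_square_le[of "{k}" b] by (simp add: power2_le_iff_abs_le)

lemma norm_hl2_leI:
  assumes "\<And>S. finite S \<Longrightarrow> (\<Sum>k\<in>S. (norm (coef b k))\<^sup>2) \<le> C\<^sup>2" "0 \<le> C"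
  shows "norm b \<le> C"
proof -
  have "(norm b)\<^sup>2 \<le> C\<^sup>2"
    unfolding norm_hl2_square by (rule infsum_le_finite_sums) (auto simp: coef_square_summable assms)
  then show ?thesis
    using assms(2) by (simp add: power2_le_iff_abs_le)
qed

text \<open>Elements of the type are built from bounds on finite partial sums: one estimate yields
  both membership and the norm bound.\<close>

lemma hl2_obtain:
  assumes "\<And>k. b (- k) = cnj (b k)"
    and "\<And>S. finite S \<Longrightarrow> (\<Sum>k\<in>S. (norm (b k))\<^sup>2) \<le> C\<^sup>2" "0 \<le> C"
  obtains a where "coef a = b" "norm a \<le> C"
proof -
  have "(\<lambda>k. (norm (b k))\<^sup>2) summable_on UNIV"
    by (rule nonneg_bdd_above_summable_on) (auto simp: bdd_above_def intro!: exI[of _ "C\<^sup>2"] assms)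
  then have c: "coef (Abs_hl2 b) = b"
    using assms(1) by (simp add: Abs_hl2_inverse)
  show ?thesis
    by (rule that[OF c]) (rule norm_hl2_leI, simp_all add: c assms)
qed

instance hl2 :: banach
proof
  fix X :: "nat \<Rightarrow> hl2"
  assume X: "Cauchy X"
  have "Cauchy (\<lambda>n. coef (X n) k)" for k
  proof (rule CauchyI)
    fix e :: real assume "0 < e"
    then obtain M where "\<forall>m\<ge>M. \<forall>n\<ge>M. norm (X m - X n) < e"
      using X by (auto dest: CauchyD)
    then show "\<exists>M. \<forall>m\<ge>M. \<forall>n\<ge>M. norm (coef (X m) k - coef (X n) k) < e"
      using norm_coef_le[of "X m - X n" k for m n] by (intro exI[of _ M]) (metis coef_simps(3) le_less_trans)
  qed
  then have "\<exists>l. (\<lambda>n. coef (X n) k) \<longlonglongrightarrow> l" for k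
    by (simp add: Cauchy_convergent_iff convergent_def)
  then obtain b where b: "\<And>k. (\<lambda>n. coef (X n) k) \<longlonglongrightarrow> b k"
    by metis
  have tail: "(\<Sum>k\<in>S. (norm (coef (X m) k - b k))\<^sup>2) \<le> e\<^sup>2"
    if "finite S" and M: "\<forall>n\<ge>M. norm (X m - X n) \<le> e" for m S e M
  proof (rule tendsto_upperbound)
    show "(\<lambda>n. \<Sum>k\<in>S. (norm (coef (X m) k - coef (X n) k))\<^sup>2) \<longlonglongrightarrow> (\<Sum>k\<in>S. (norm (coef (X m) k - b k))\<^sup>2)"
      by (intro tendsto_intros b)
    show "\<forall>\<^sub>F n in sequentially. (\<Sum>k\<in>S. (norm (coef (X m) k - coef (X n) k))\<^sup>2) \<le> e\<^sup>2"
      unfolding eventually_sequentially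
    proof (intro exI[of _ M] allI impI)
      fix n assume "M \<le> n"
      then have "(norm (X m - X n))\<^sup>2 \<le> e\<^sup>2"
        using M by (intro power_mono) auto
      then show "(\<Sum>k\<in>S. (norm (coef (X m) k - coef (X n) k))\<^sup>2) \<le> e\<^sup>2"
        using sum_coef_square_le[OF \<open>finite S\<close>, of "X m - X n"] by simp
    qed
  qed simp
  have sym: "b (- k) = cnj (b k)" for k
  proof (rule LIMSEQ_unique[OF b])
    show "(\<lambda>n. coef (X n) (- k)) \<longlonglongrightarrow> cnj (b k)"
      unfolding coef_minus_index by (intro tendsto_intros b)
  qed
  obtain M where M: "\<forall>m\<ge>M. \<forall>n\<ge>M. norm (X m - X n) < 1"
    using CauchyD[OF X zero_less_one] by blast
  \<comment> \<open>\<open>tail\<close> bounds differences only, so \<open>X M - b\<close> is the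
    sequence first shown to lie in the space; the limit is then \<open>X M\<close> minus it.\<close>
  obtain c where c: "coef c = (\<lambda>k. coef (X M) k - b k)"
  proof (rule hl2_obtain[where b = "\<lambda>k. coef (X M) k - b k" and C = 1])
    show "(\<Sum>k\<in>S. (norm (coef (X M) k - b k))\<^sup>2) \<le> 1\<^sup>2" if "finite S" for S
      using tail[OF that, of M M 1] M by (auto intro: less_imp_le)
  qed (auto simp: sym coef_minus_index)
  define L where "L = X M - c"
  have L: "coef L k = b k" for k
    by (simp add: L_def c)
  have "X \<longlonglongrightarrow> L"
  proof (rule LIMSEQ_I)
    fix e :: real assume "0 < e"
    then obtain N where N: "\<forall>m\<ge>N. \<forall>n\<ge>N. norm (X m - X n) < e / 2"
      using CauchyD[OF X, of "e / 2"] by auto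
    have "norm (X m - L) \<le> e / 2" if "m \<ge> N" for m
    proof (rule norm_hl2_leI)
      show "(\<Sum>k\<in>S. (norm (coef (X m - L) k))\<^sup>2) \<le> (e / 2)\<^sup>2" if "finite S" for S
        using tail[OF that, of N m "e / 2"] N \<open>m \<ge> N\<close> by (auto simp: L intro: less_imp_le)
    qed (use \<open>0 < e\<close> in simp)
    then show "\<exists>N. \<forall>m\<ge>N. norm (X m - L) < e"
      using \<open>0 < e\<close> by (intro exI[of _ N]) (smt (verit, ccfv_SIG) field_sum_of_halves)
  qed
  then show "convergent X"
    by (rule convergentI)
qed

lemma inner_hl2_has_sum: "((\<lambda>k. coef a k \<bullet> coef b k) has_sum (a \<bullet> b)) UNIV"
  unfolding inner_hl2_def by (intro has_sum_infsum inner_summable coef_square_summable)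

section \<open>Ordinary differential equations in Hilbert space\<close>

text \<open>The integrating factor \<open>exp (- C * t)\<close> gives a nonincreasing function
  whatever the signs of y and C.\<close>

lemma gronwall:
  fixes y :: "real \<Rightarrow> real"
  assumes "0 \<le> T"
    and der: "\<And>t. t \<in> {0..T} \<Longrightarrow> (y has_vector_derivative y' t) (at t within {0..T})"
    and le: "\<And>t. t \<in> {0..T} \<Longrightarrow> y' t \<le> C * y t"
  shows "y T \<le> exp (C * T) * y 0"
proof -
  define h where "h t = exp (- C * t) * y t" for t
  have h: "(h has_real_derivative exp (- C * t) * (y' t - C * y t)) (at t within {0..T})" if "t \<in> {0..T}" for t
    unfolding h_def using der[OF that, folded has_real_derivative_iff_has_vector_derivative]
    by (auto intro!: derivative_eq_intros simp: algebra_simps)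
  have "h T \<le> h 0"
  proof (rule DERIV_nonpos_imp_decreasing_open[OF \<open>0 \<le> T\<close>])
    show "continuous_on {0..T} h"
      by (rule DERIV_continuous_on[OF h])
    fix t assume t: "0 < t" "t < T"
    then have "(h has_real_derivative exp (- C * t) * (y' t - C * y t)) (at t)"
      using h[of t] at_within_Icc_at[of 0 t T] by simp
    moreover have "exp (- C * t) * (y' t - C * y t) \<le> 0"
      using le[of t] t by (intro mult_nonneg_nonpos) auto
    ultimately show "\<exists>d. (h has_real_derivative d) (at t) \<and> d \<le> 0"
      by blast
  qed
  then have "exp (- C * T) * y T \<le> y 0"
    by (simp add: h_def)
  then have "exp (C * T) * (exp (- C * T) * y T) \<le> exp (C * T) * y 0"
    by (intro mult_left_mono) auto
  then show ?thesis
    by (simp add: mult.assoc[symmetric] exp_add[symmetric])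
qed

lemma has_vector_derivative_inner:
  fixes x y :: "real \<Rightarrow> 'a::real_inner"
  assumes "(x has_vector_derivative x') (at t within S)" "(y has_vector_derivative y') (at t within S)"
  shows "((\<lambda>t. x t \<bullet> y t) has_vector_derivative (x t \<bullet> y' + x' \<bullet> y t)) (at t within S)"
  by (rule bounded_bilinear.has_vector_derivative[OF bounded_bilinear_inner assms])

text \<open>Forward time only, with one-sided derivatives at the ends. Backward solutions become
  forward ones for the negated field after the reflection of t.\<close>

definition ode_sol :: "('a::real_normed_vector \<Rightarrow> 'a) \<Rightarrow> real \<Rightarrow> (real \<Rightarrow> 'a) \<Rightarrow> bool" where
  "ode_sol f T x \<longleftrightarrow> (\<forall>t\<in>{0..T}. (x has_vector_derivative f (x t)) (at t within {0..T}))"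

lemma ode_sol_mono: "ode_sol f T x \<Longrightarrow> S \<le> T \<Longrightarrow> ode_sol f S x"
  unfolding ode_sol_def by (auto intro!: has_vector_derivative_within_subset[where T = "{0..S}" and S = "{0..T}"])

definition lipschitz_on_balls :: "('a::real_normed_vector \<Rightarrow> 'a) \<Rightarrow> bool" where
  "lipschitz_on_balls f \<longleftrightarrow>
     (\<forall>R. \<exists>L. \<forall>x y. norm x \<le> R \<longrightarrow> norm y \<le> R \<longrightarrow> norm (f x - f y) \<le> L * norm (x - y))"

text \<open>The factor l covers the truncations of the field to balls along with the field itself, so that
  solutions of the truncated equations obey a bound that does not depend on the truncation.\<close>

definition apriori_bounded :: "('a::real_normed_vector \<Rightarrow> 'a) \<Rightarrow> bool" where
  "apriori_bounded f \<longleftrightarrow> (\<forall>r T. \<exists>M. \<forall>x l. norm (x 0) \<le> r \<longrightarrow>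
     (\<forall>t\<in>{0..T}. 0 \<le> l t \<and> l t \<le> 1 \<and>
        (x has_vector_derivative f (l t *\<^sub>R x t)) (at t within {0..T})) \<longrightarrow>
     (\<forall>t\<in>{0..T}. norm (x t) \<le> M))"

text \<open>The a priori bound puts all solutions starting in the ball of radius r into one larger
  ball, where the field is Lipschitz. The constant then depends only on r and T, as continuous
  dependence requires.\<close>

lemma ode_stability:
  fixes f :: "'a::real_inner \<Rightarrow> 'a"
  assumes lip: "lipschitz_on_balls f" and ap: "apriori_bounded f"
  obtains L where "0 \<le> L"
    "\<And>x y t. ode_sol f T x \<Longrightarrow> ode_sol f T y \<Longrightarrow> norm (x 0) \<le> r \<Longrightarrow> norm (y 0) \<le> r \<Longrightarrow> t \<in> {0..T} \<Longrightarrow>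
       norm (x t - y t) \<le> L * norm (x 0 - y 0)"
proof -
  obtain M where M: "\<And>x l t. norm (x 0) \<le> r \<Longrightarrow>
     (\<forall>t\<in>{0..T}. 0 \<le> l t \<and> l t \<le> 1 \<and>
        (x has_vector_derivative f (l t *\<^sub>R x t)) (at t within {0..T})) \<Longrightarrow> t \<in> {0..T} \<Longrightarrow> norm (x t) \<le> M"
    using ap unfolding apriori_bounded_def by metis
  obtain L where L: "\<And>x y. norm x \<le> M \<Longrightarrow> norm y \<le> M \<Longrightarrow> norm (f x - f y) \<le> L * norm (x - y)"
    using lip unfolding lipschitz_on_balls_def by metis
  show ?thesis
  proof (rule that[of "exp (\<bar>L\<bar> * \<bar>T\<bar>)"])
    fix x y t
    assume sol: "ode_sol f T x" "ode_sol f T y" and n: "norm (x 0) \<le> r" "norm (y 0) \<le> r" and t: "t \<in> {0..T}"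
    \<comment> \<open>The untruncated equation is the case l = 1 of the a priori bound.\<close>
    have bx: "norm (x s) \<le> M" and b_y: "norm (y s) \<le> M" if "s \<in> {0..T}" for s
      using M[of x "\<lambda>_. 1"] M[of y "\<lambda>_. 1"] sol n that by (auto simp: ode_sol_def)
    have sol': "ode_sol f t x" "ode_sol f t y"
      using sol t by (auto intro: ode_sol_mono)
    define d where "d s = x s - y s" for s
    \<comment> \<open>Gronwall is applied to the squared distance, which is differentiable also
      where the distance vanishes; the rate doubles.\<close>
    have "d t \<bullet> d t \<le> exp (2 * L * t) * (d 0 \<bullet> d 0)"
    proof (rule gronwall)
      fix s assume s: "s \<in> {0..t}"
      have "(d has_vector_derivative (f (x s) - f (y s))) (at s within {0..t})"
        unfolding d_def using sol' s by (auto simp: ode_sol_def intro!: has_vector_derivative_diff)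
      from has_vector_derivative_inner[OF this this]
      show "((\<lambda>s. d s \<bullet> d s) has_vector_derivative (2 * (d s \<bullet> (f (x s) - f (y s))))) (at s within {0..t})"
        by (simp add: inner_commute)
      have "d s \<bullet> (f (x s) - f (y s)) \<le> norm (d s) * norm (f (x s) - f (y s))"
        by (rule norm_cauchy_schwarz)
      also have "\<dots> \<le> norm (d s) * (L * norm (d s))"
        unfolding d_def using s t by (intro mult_left_mono L bx b_y) auto
      also have "\<dots> = L * (d s \<bullet> d s)"
        by (simp add: power2_norm_eq_inner[symmetric] power2_eq_square)
      finally show "2 * (d s \<bullet> (f (x s) - f (y s))) \<le> 2 * L * (d s \<bullet> d s)"
        by simp
    qed (use t in auto)
    then have "(norm (d t))\<^sup>2 \<le> (exp (L * t) * norm (d 0))\<^sup>2"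
      by (simp add: power2_norm_eq_inner power_mult_distrib exp_double mult.assoc)
    then have "norm (d t) \<le> exp (L * t) * norm (d 0)"
      by (rule power2_le_imp_le) simp
    also have "\<dots> \<le> exp (\<bar>L\<bar> * \<bar>T\<bar>) * norm (d 0)"
      using t mult_mono[of L "\<bar>L\<bar>" t "\<bar>T\<bar>"] by (intro mult_right_mono) auto
    finally show "norm (x t - y t) \<le> exp (\<bar>L\<bar> * \<bar>T\<bar>) * norm (x 0 - y 0)"
      by (simp add: d_def)
  qed simp
qed

corollary ode_unique:
  fixes f :: "'a::real_inner \<Rightarrow> 'a"
  assumes "lipschitz_on_balls f" "apriori_bounded f" "ode_sol f T x" "ode_sol f T y" "x 0 = y 0" "t \<in> {0..T}"
  shows "x t = y t"
proof (rule ode_stability[OF assms(1,2), where r = "norm (y 0)" and T = T])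
  fix L
  assume "\<And>x z t. ode_sol f T x \<Longrightarrow> ode_sol f T z \<Longrightarrow> norm (x 0) \<le> norm (y 0) \<Longrightarrow>
    norm (z 0) \<le> norm (y 0) \<Longrightarrow> t \<in> {0..T} \<Longrightarrow> norm (x t - z t) \<le> L * norm (x 0 - z 0)"
  from this[OF assms(3,4) _ _ assms(6)] have "norm (x t - y t) \<le> L * norm (x 0 - y 0)"
    by (simp add: assms(5))
  then show ?thesis
    by (simp add: assms(5))
qed

section \<open>Picard iteration on the half-line in an exponentially weighted norm\<close>

lemma exp_weighted_integral_bound:
  fixes h :: "real \<Rightarrow> 'a::banach"
  assumes "0 < c" "0 \<le> p" "continuous_on {0..p} h"
    and le: "\<And>s. s \<in> {0..p} \<Longrightarrow> norm (h s) \<le> K * exp (c * s)" and "0 \<le> K"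
  shows "exp (- c * p) * norm (integral {0..p} h) \<le> K / c"
proof -
  have "((\<lambda>s. K * exp (c * s)) has_integral (K * exp (c * p) / c - K * exp (c * 0) / c)) {0..p}"
    using \<open>0 < c\<close> \<open>0 \<le> p\<close>
    by (intro fundamental_theorem_of_calculus)
      (auto intro!: derivative_eq_intros simp: has_real_derivative_iff_has_vector_derivative[symmetric])
  then have "norm (integral {0..p} h) \<le> K * exp (c * p) / c - K * exp (c * 0) / c"
    using integral_norm_bound_integral[of h "{0..p}" "\<lambda>s. K * exp (c * s)"] assms
    by (auto simp: has_integral_iff intro: integrable_continuous_interval)
  also have "\<dots> \<le> K * exp (c * p) / c"
    using \<open>0 \<le> K\<close> \<open>0 < c\<close> by simp
  finally have "exp (- c * p) * norm (integral {0..p} h) \<le> exp (- c * p) * (K * exp (c * p) / c)"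
    by (intro mult_left_mono) auto
  also have "\<dots> = K / c"
    by (simp add: exp_minus)
  finally show ?thesis .
qed

lemma continuous_on_integral_max:
  fixes h :: "real \<Rightarrow> 'a::banach"
  assumes "continuous_on UNIV h"
  shows "continuous_on UNIV (\<lambda>t. integral {0..max 0 t} h)"
proof -
  have "continuous_on (\<Union>n::nat. {..<real n}) (\<lambda>t. integral {0..max 0 t} h)"
  proof (rule continuous_on_open_UN)
    fix n :: nat
    have "continuous_on {0..real n} (\<lambda>p. integral {0..p} h)"
      by (intro indefinite_integral_continuous_1 integrable_continuous_interval continuous_on_subset[OF assms]) auto
    then show "continuous_on {..<real n} (\<lambda>t. integral {0..max 0 t} h)"
      by (rule continuous_on_compose2) (auto intro!: continuous_intros)
  qed auto
  moreover have "(\<Union>n::nat. {..<real n}) = UNIV"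
    using reals_Archimedean2 by auto
  ultimately show ?thesis
    by simp
qed

text \<open>The unknown is w(t) = e^(-2Lt) x(t) in the space of bounded continuous functions. With
  this weight (Bielecki's norm) the Picard map contracts by L / (2 L) = 1 / 2 on the whole half-line
  at once, so that no short intervals have to be pasted together.\<close>

lemma lipschitz_ode_exists:
  fixes g :: "'a::banach \<Rightarrow> 'a"
  assumes "0 < L" and lip: "\<And>x y. norm (g x - g y) \<le> L * norm (x - y)"
  obtains x where "x 0 = x0" "\<And>T. ode_sol g T x"
proof -
  have g_cont: "continuous_on UNIV g"
  proof (rule lipschitz_on_continuous_on)
    show "L-lipschitz_on UNIV g"
      using assms by (auto simp: lipschitz_on_def dist_norm)
  qed
  \<comment> \<open>The type of bounded continuous functions used here has the whole real line as
    domain; \<open>max 0 t\<close> continues the image to negative t by the constant x0.\<close>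
  define \<Phi> where "\<Phi> w t = exp (- (2 * L) * max 0 t) *\<^sub>R
      (x0 + integral {0..max 0 t} (\<lambda>s. g (exp (2 * L * s) *\<^sub>R apply_bcontfun w s)))"
    for w :: "real \<Rightarrow>\<^sub>C 'a" and t
  have cont: "continuous_on A (\<lambda>s. g (exp (2 * L * s) *\<^sub>R apply_bcontfun w s))" for w :: "real \<Rightarrow>\<^sub>C 'a" and A
    by (intro continuous_on_compose2[OF g_cont] continuous_intros) auto
  have mem: "\<Phi> w \<in> bcontfun" for w
  proof (rule bcontfun_normI)
    show "continuous_on UNIV (\<Phi> w)"
      unfolding \<Phi>_def by (intro continuous_intros continuous_on_integral_max cont)
    fix t
    let ?I = "integral {0..max 0 t} (\<lambda>s. g (exp (2 * L * s) *\<^sub>R apply_bcontfun w s))"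
    \<comment> \<open>g grows at most linearly, so the integrand grows no faster than the weight,
      and the weighted integral stays bounded.\<close>
    have "exp (- (2 * L) * max 0 t) * norm ?I \<le> (norm (g 0) + L * norm w) / (2 * L)"
    proof (rule exp_weighted_integral_bound)
      fix s assume "s \<in> {0..max 0 t}"
      have "norm (g (exp (2 * L * s) *\<^sub>R apply_bcontfun w s))
            \<le> norm (g 0) + norm (g (exp (2 * L * s) *\<^sub>R apply_bcontfun w s) - g 0)"
        using norm_triangle_ineq[of "g 0" "g (exp (2 * L * s) *\<^sub>R apply_bcontfun w s) - g 0"] by simp
      also have "\<dots> \<le> norm (g 0) + L * (exp (2 * L * s) * norm (apply_bcontfun w s))"
        using lip[of "exp (2 * L * s) *\<^sub>R apply_bcontfun w s" 0] by simp
      also have "\<dots> \<le> norm (g 0) * exp (2 * L * s) + L * (exp (2 * L * s) * norm w)"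
        using \<open>0 < L\<close> \<open>s \<in> _\<close> norm_bounded[of w s]
        by (intro add_mono mult_left_mono) (auto simp: mult_le_cancel_left1)
      finally show "norm (g (exp (2 * L * s) *\<^sub>R apply_bcontfun w s)) \<le> (norm (g 0) + L * norm w) * exp (2 * L * s)"
        by (simp add: algebra_simps)
    qed (use \<open>0 < L\<close> cont in auto)
    moreover have "norm (\<Phi> w t) \<le> exp (- (2 * L) * max 0 t) * (norm x0 + norm ?I)"
      unfolding \<Phi>_def norm_scaleR by (auto intro: norm_triangle_ineq)
    moreover have "exp (- (2 * L) * max 0 t) * norm x0 \<le> norm x0"
      using \<open>0 < L\<close> by (intro mult_left_le_one_le) auto
    ultimately show "norm (\<Phi> w t) \<le> norm x0 + (norm (g 0) + L * norm w) / (2 * L)"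
      by (simp add: algebra_simps)
  qed
  define F where "F w = Bcontfun (\<Phi> w)" for w
  have F: "apply_bcontfun (F w) = \<Phi> w" for w
    unfolding F_def by (rule Bcontfun_inverse[OF mem])
  have "\<exists>!w. F w = w"
  proof (rule banach_fix_type[of "1 / 2"]; (intro allI)?)
    fix v w
    have "norm (apply_bcontfun (F v - F w) t) \<le> 1 / 2 * norm (v - w)" for t
    proof -
      let ?h = "\<lambda>w s. g (exp (2 * L * s) *\<^sub>R apply_bcontfun w s)"
      have "exp (- (2 * L) * max 0 t) * norm (integral {0..max 0 t} (\<lambda>s. ?h v s - ?h w s)) \<le> (L * norm (v - w)) / (2 * L)"
      proof (rule exp_weighted_integral_bound)
        fix s assume "s \<in> {0..max 0 t}"
        have "norm (?h v s - ?h w s) \<le> L * norm (exp (2 * L * s) *\<^sub>R apply_bcontfun v s - exp (2 * L * s) *\<^sub>R apply_bcontfun w s)"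
          by (rule lip)
        also have "\<dots> = L * (exp (2 * L * s) * norm (apply_bcontfun (v - w) s))"
          by (simp add: scaleR_diff_right[symmetric])
        also have "\<dots> \<le> L * (exp (2 * L * s) * norm (v - w))"
          using \<open>0 < L\<close> norm_bounded[of "v - w" s] by (intro mult_left_mono) auto
        finally show "norm (?h v s - ?h w s) \<le> L * norm (v - w) * exp (2 * L * s)"
          by (simp add: mult_ac)
      qed (use \<open>0 < L\<close> in \<open>auto intro!: continuous_intros cont\<close>)
      moreover have "integral {0..max 0 t} (\<lambda>s. ?h v s - ?h w s)
          = integral {0..max 0 t} (?h v) - integral {0..max 0 t} (?h w)"
        by (intro integral_diff integrable_continuous_interval cont)
      moreover have "apply_bcontfun (F v - F w) t = exp (- (2 * L) * max 0 t) *\<^sub>R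
          (integral {0..max 0 t} (?h v) - integral {0..max 0 t} (?h w))"
        by (simp add: F \<Phi>_def scaleR_diff_right[symmetric])
      ultimately show ?thesis
        using \<open>0 < L\<close> by simp
    qed
    then show "dist (F v) (F w) \<le> 1 / 2 * dist v w"
      unfolding dist_norm by (rule norm_bound)
  qed auto
  then obtain w where w: "F w = w"
    by blast
  define x where "x t = exp (2 * L * t) *\<^sub>R apply_bcontfun w t" for t
  have x_cont: "continuous_on A (\<lambda>s. g (x s))" for A
    unfolding x_def by (rule cont)
  have x: "x t = x0 + integral {0..t} (\<lambda>s. g (x s))" if "0 \<le> t" for t
  proof -
    have "apply_bcontfun w t = \<Phi> w t"
      by (metis F w)
    also have "\<Phi> w t = exp (- (2 * L) * t) *\<^sub>R (x0 + integral {0..t} (\<lambda>s. g (x s)))"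
      using that by (simp add: \<Phi>_def x_def max_absorb2)
    finally have "apply_bcontfun w t = exp (- (2 * L) * t) *\<^sub>R (x0 + integral {0..t} (\<lambda>s. g (x s)))" .
    then show ?thesis
      unfolding x_def[of t] by (simp add: exp_add[symmetric])
  qed
  show ?thesis
  proof (rule that)
    show "x 0 = x0"
      using x[of 0] by simp
    show "ode_sol g T x" for T
      unfolding ode_sol_def
    proof
      fix t assume t: "t \<in> {0..T}"
      have "((\<lambda>t. x0 + integral {0..t} (\<lambda>s. g (x s))) has_vector_derivative (0 + g (x t))) (at t within {0..T})"
        by (intro has_vector_derivative_add integral_has_vector_derivative x_cont t) auto
      then have "((\<lambda>t. x0 + integral {0..t} (\<lambda>s. g (x s))) has_vector_derivative g (x t)) (at t within {0..T})"
        by simp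
      then show "(x has_vector_derivative g (x t)) (at t within {0..T})"
        by (rule has_vector_derivative_transform[OF t, rotated]) (use x in auto)
    qed
  qed
qed

section \<open>Truncation to balls and global existence\<close>

definition cutoff :: "real \<Rightarrow> 'a::real_normed_vector \<Rightarrow> real" where
  "cutoff R x = (if norm x \<le> R then 1 else R / norm x)"

lemma cutoff_bounds: "0 \<le> R \<Longrightarrow> 0 \<le> cutoff R x" "cutoff R x \<le> 1"
  by (auto simp: cutoff_def divide_simps)

lemma norm_cutoff: "0 \<le> R \<Longrightarrow> norm (cutoff R x *\<^sub>R x) \<le> R"
  by (auto simp: cutoff_def)

text \<open>The constant 2 comes from an argument valid in every normed space. For |y| <= |x| and c
  the cutoff, the difference is c(x) (x - y) + (c(x) - c(y)) y, and each of the two terms is at most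
  |x - y|.\<close>

lemma cutoff_lipschitz:
  assumes "0 \<le> R"
  shows "norm (cutoff R x *\<^sub>R x - cutoff R y *\<^sub>R y) \<le> 2 * norm (x - y)"
proof -
  have *: "norm (cutoff R x *\<^sub>R x - cutoff R y *\<^sub>R y) \<le> 2 * norm (x - y)" if "norm y \<le> norm x" for x y :: 'a
  proof -
    have "(cutoff R y - cutoff R x) * norm y \<le> norm x - norm y"
    proof (cases "norm x \<le> R")
      case False
      then have pos: "0 < norm x"
        using \<open>0 \<le> R\<close> by linarith
      show ?thesis
      proof (cases "norm y \<le> R")
        case True
        have "(cutoff R y - cutoff R x) * norm y = (norm x - R) * (norm y / norm x)"
          using True False pos by (simp add: cutoff_def field_simps)
        also have "\<dots> \<le> (norm x - R) * 1"
          using False that pos by (intro mult_left_mono) auto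
        finally show ?thesis
          using True by simp
      next
        case nle: False
        then have "0 < norm y"
          using \<open>0 \<le> R\<close> by linarith
        then have "(cutoff R y - cutoff R x) * norm y = (R / norm x) * (norm x - norm y)"
          using nle False pos by (simp add: cutoff_def field_simps)
        also have "\<dots> \<le> 1 * (norm x - norm y)"
          using False that pos by (intro mult_right_mono) auto
        finally show ?thesis
          by simp
      qed
    qed (use that in \<open>auto simp: cutoff_def\<close>)
    moreover have "cutoff R x \<le> cutoff R y"
      using that \<open>0 \<le> R\<close> by (auto simp: cutoff_def divide_simps intro: mult_left_mono)
    ultimately have 1: "norm ((cutoff R x - cutoff R y) *\<^sub>R y) \<le> norm (x - y)"
      using norm_triangle_ineq2[of x y] by simp
    have 2: "norm (cutoff R x *\<^sub>R (x - y)) \<le> norm (x - y)"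
      using cutoff_bounds(1)[OF \<open>0 \<le> R\<close>, of x] cutoff_bounds(2)[of R x] by (simp add: mult_left_le_one_le)
    have "cutoff R x *\<^sub>R x - cutoff R y *\<^sub>R y = cutoff R x *\<^sub>R (x - y) + (cutoff R x - cutoff R y) *\<^sub>R y"
      by (simp add: algebra_simps)
    then show ?thesis
      using norm_triangle_le[of "cutoff R x *\<^sub>R (x - y)" "(cutoff R x - cutoff R y) *\<^sub>R y" "2 * norm (x - y)"] 1 2 by simp
  qed
  show ?thesis
    using *[of x y] *[of y x] by (cases "norm y \<le> norm x") (auto simp: norm_minus_commute)
qed

text \<open>The field is truncated at the radius given by the a priori bound itself. The truncated
  solution obeys that bound, hence never leaves the ball and solves the original equation. Solutions
  on different intervals agree by uniqueness and are glued along the diagonal.\<close>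

theorem ode_global_exists:
  fixes f :: "'a::{real_inner,banach} \<Rightarrow> 'a"
  assumes lip: "lipschitz_on_balls f" and ap: "apriori_bounded f"
  obtains x where "x 0 = x0" "\<And>T. ode_sol f T x"
proof -
  have "\<exists>x. x 0 = x0 \<and> ode_sol f T x" for T
  proof -
    obtain M where M: "\<And>x l t. norm (x 0) \<le> norm x0 \<Longrightarrow>
       (\<forall>t\<in>{0..T}. 0 \<le> l t \<and> l t \<le> 1 \<and>
          (x has_vector_derivative f (l t *\<^sub>R x t)) (at t within {0..T})) \<Longrightarrow> t \<in> {0..T} \<Longrightarrow> norm (x t) \<le> M"
      using ap unfolding apriori_bounded_def by metis
    \<comment> \<open>\<open>apriori_bounded\<close> does not say that M is nonnegative, hence the
      absolute value.\<close>
    define R where "R = \<bar>M\<bar>"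
    have "0 \<le> R" by (simp add: R_def)
    obtain L where L: "\<And>x y. norm x \<le> R \<Longrightarrow> norm y \<le> R \<Longrightarrow> norm (f x - f y) \<le> L * norm (x - y)"
      using lip unfolding lipschitz_on_balls_def by metis
    define g where "g x = f (cutoff R x *\<^sub>R x)" for x
    have lip_g: "norm (g x - g y) \<le> (2 * \<bar>L\<bar> + 1) * norm (x - y)" for x y
    proof -
      have "norm (g x - g y) \<le> L * norm (cutoff R x *\<^sub>R x - cutoff R y *\<^sub>R y)"
        unfolding g_def by (intro L norm_cutoff \<open>0 \<le> R\<close>)
      also have "\<dots> \<le> \<bar>L\<bar> * (2 * norm (x - y))"
        by (intro mult_mono cutoff_lipschitz \<open>0 \<le> R\<close>) auto
      also have "\<dots> \<le> (2 * \<bar>L\<bar> + 1) * norm (x - y)"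
        by (simp add: algebra_simps)
      finally show ?thesis .
    qed
    have "0 < 2 * \<bar>L\<bar> + 1"
      by simp
    then obtain x where x: "x 0 = x0" "\<And>T. ode_sol g T x"
      by (rule lipschitz_ode_exists[OF _ lip_g, where ?x0.0 = x0]) blast
    have "norm (x t) \<le> M" if "t \<in> {0..T}" for t
    proof (rule M[of x "\<lambda>t. cutoff R (x t)"])
      show "\<forall>t\<in>{0..T}. 0 \<le> cutoff R (x t) \<and> cutoff R (x t) \<le> 1 \<and>
          (x has_vector_derivative f (cutoff R (x t) *\<^sub>R x t)) (at t within {0..T})"
        using x(2)[of T] \<open>0 \<le> R\<close> cutoff_bounds by (auto simp: ode_sol_def g_def)
    qed (use x that in auto)
    then have "cutoff R (x t) = 1" if "t \<in> {0..T}" for t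
      using that by (fastforce simp: cutoff_def R_def)
    then have "ode_sol f T x"
      using x(2)[of T] by (auto simp: ode_sol_def g_def)
    then show ?thesis
      using x(1) by blast
  qed
  then obtain X where X: "\<And>T. X T 0 = x0" "\<And>T. ode_sol f T (X T)"
    by metis
  define x where "x t = X t t" for t
  have x: "x t = X T t" if "0 \<le> t" "t \<le> T" for t T
    unfolding x_def
    by (rule ode_unique[OF lip ap, of t]) (use X that in \<open>auto intro: ode_sol_mono\<close>)
  show ?thesis
  proof (rule that)
    show "x 0 = x0"
      using X by (simp add: x_def)
    show "ode_sol f T x" for T
      unfolding ode_sol_def
    proof
      fix t assume t: "t \<in> {0..T}"
      have "(X T has_vector_derivative f (x t)) (at t within {0..T})"
        using X(2)[of T] t x[of t T] by (simp add: ode_sol_def)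
      then show "(x has_vector_derivative f (x t)) (at t within {0..T})"
        by (rule has_vector_derivative_transform[OF t, rotated]) (use x in auto)
    qed
  qed
qed

section \<open>The nonlinearity on the Fourier side\<close>

definition wt :: "real \<Rightarrow> int \<Rightarrow> real" where
  "wt s k = (1 + (real_of_int k)\<^sup>2) powr (s / 2)"

lemma one_plus_square_pos [simp]: "0 < 1 + (real_of_int k)\<^sup>2" "1 + (real_of_int k)\<^sup>2 \<noteq> 0"
  using zero_le_power2[of "real_of_int k"] by linarith+

lemma wt_pos [simp]: "0 < wt s k" "wt s k \<noteq> 0" "0 \<le> wt s k"
  unfolding wt_def by simp_all

lemma wt_uminus [simp]: "wt s (- k) = wt s k"
  by (simp add: wt_def)

lemma wt_square: "(wt s k)\<^sup>2 = (1 + (real_of_int k)\<^sup>2) powr s"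
  unfolding wt_def by (subst powr_power) simp_all

lemma one_plus_square_le_wt_square: "1 \<le> s \<Longrightarrow> 1 + (real_of_int k)\<^sup>2 \<le> (wt s k)\<^sup>2"
  unfolding wt_square using powr_mono[of 1 s "1 + (real_of_int k)\<^sup>2"] by simp

lemma abs_le_wt: "1 \<le> s \<Longrightarrow> \<bar>real_of_int k\<bar> \<le> wt s k"
  using one_plus_square_le_wt_square[of s k] by (intro abs_le_square_iff[THEN iffD2, of _ "wt s k", simplified]) simp

lemma wt_ge_1: "0 \<le> s \<Longrightarrow> 1 \<le> wt s k"
  unfolding wt_def by (rule ge_one_powr_ge_zero) auto

text \<open>The larger of |k| and |l| dominates: |k + l| <= 2 |k| costs the factor 4^(s/2) = 2^s.
  The sum on the right places the whole weight on one factor of a product, which is what makes the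
  product estimate tame.\<close>

lemma wt_add_le:
  assumes "0 \<le> s"
  shows "wt s (k + l) \<le> 2 powr s * (wt s k + wt s l)"
proof -
  have *: "wt s (k + l) \<le> 2 powr s * wt s k" if "\<bar>l\<bar> \<le> \<bar>k\<bar>" for k l
  proof -
    have "\<bar>real_of_int (k + l)\<bar> \<le> 2 * \<bar>real_of_int k\<bar>"
      using that by linarith
    then have "(real_of_int (k + l))\<^sup>2 \<le> (2 * real_of_int k)\<^sup>2"
      by (subst abs_le_square_iff[symmetric]) simp
    then have "wt s (k + l) \<le> (4 * (1 + (real_of_int k)\<^sup>2)) powr (s / 2)"
      unfolding wt_def using assms by (intro powr_mono2) (auto simp: power_mult_distrib)
    also have "\<dots> = (2 powr 2) powr (s / 2) * wt s k"
      unfolding wt_def by (subst powr_mult) auto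
    also have "(2 powr 2) powr (s / 2) = (2::real) powr s"
      unfolding powr_powr by simp
    finally show ?thesis .
  qed
  have "0 \<le> 2 powr s * wt s k" "0 \<le> 2 powr s * wt s l"
    by simp_all
  moreover have "wt s (k + l) \<le> 2 powr s * wt s k \<or> wt s (k + l) \<le> 2 powr s * wt s l"
    using *[of l k] *[of k l] by (metis add.commute linear)
  ultimately show ?thesis
    unfolding distrib_left by linarith
qed

text \<open>The actual Fourier coefficients of the function that b encodes. The weight removed here
  has half the Sobolev exponent, so the l2 norm of \<open>coef b\<close> is the H^s norm up to the
  factor sqrt (2 pi).\<close>

definition amp :: "real \<Rightarrow> hl2 \<Rightarrow> int \<Rightarrow> complex" where
  "amp s b k = coef b k / of_real (wt s k)"

lemma coef_eq_amp: "coef b k = of_real (wt s k) * amp s b k"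
  by (simp add: amp_def)

lemma norm_coef_eq_amp: "norm (coef b k) = wt s k * norm (amp s b k)"
  by (subst coef_eq_amp[of b k s]) (simp add: norm_mult)

lemma amp_minus_index: "amp s b (- k) = cnj (amp s b k)"
  by (simp add: amp_def coef_minus_index)

lemma amp_simps [simp]: "amp s (a + b) k = amp s a k + amp s b k" "amp s (r *\<^sub>R a) k = r *\<^sub>R amp s a k"
  by (simp_all add: amp_def add_divide_distrib scaleR_conv_of_real)

lemma norm_amp_le_norm_coef: "0 \<le> s \<Longrightarrow> norm (amp s b k) \<le> norm (coef b k)"
  using wt_ge_1[of s k] mult_right_mono[of 1 "wt s k" "norm (amp s b k)"]
  by (simp add: norm_coef_eq_amp[of b k s])

lemma norm_amp_le: "0 \<le> s \<Longrightarrow> norm (amp s b k) \<le> norm b"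
  using norm_amp_le_norm_coef norm_coef_le order_trans by blast

lemma summable_on_intI:
  fixes f :: "int \<Rightarrow> real"
  assumes "(\<lambda>n::nat. f (int n)) summable_on UNIV" "(\<lambda>n::nat. f (- int n)) summable_on UNIV"
  shows "f summable_on UNIV"
proof -
  have "f summable_on range int"
    using assms(1) by (subst summable_on_reindex) (auto simp: o_def)
  moreover have "f summable_on range (\<lambda>n. - int n)"
    using assms(2) by (subst summable_on_reindex) (auto simp: o_def inj_on_def)
  ultimately have "f summable_on (range int \<union> range (\<lambda>n. - int n))"
    by (rule summable_on_union)
  also have "range int \<union> range (\<lambda>n. - int n) = UNIV"
    by (auto intro: int_cases2)
  finally show ?thesis .
qed

lemma inverse_square_summable: "(\<lambda>k::int. 1 / (1 + (real_of_int k)\<^sup>2)) summable_on UNIV"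
proof -
  have "summable (\<lambda>n. 1 / (1 + (real n)\<^sup>2))"
  proof (rule summable_comparison_test_ev)
    show "summable (\<lambda>n. inverse (real n ^ 2))"
      by (rule inverse_power_summable) simp
    show "\<forall>\<^sub>F n in sequentially. norm (1 / (1 + (real n)\<^sup>2)) \<le> inverse (real n ^ 2)"
      using eventually_gt_at_top[of 0] by eventually_elim (auto simp: inverse_eq_divide intro!: frac_le)
  qed
  then have "(\<lambda>n. 1 / (1 + (real n)\<^sup>2)) summable_on UNIV"
    by (rule summable_nonneg_imp_summable_on) auto
  then show ?thesis
    by (intro summable_on_intI) auto
qed

text \<open>The squared Cauchy-Schwarz constant in the embedding of H^1 into the Wiener algebra; its
  value is pi coth pi.\<close>

definition zeta_int :: real where
  "zeta_int = (\<Sum>\<^sub>\<infinity>k::int. 1 / (1 + (real_of_int k)\<^sup>2))"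

lemma zeta_int_nonneg: "0 \<le> zeta_int"
  unfolding zeta_int_def by (intro infsum_nonneg) (auto intro: less_imp_le)

lemma sum_inverse_square_le: "finite S \<Longrightarrow> (\<Sum>k\<in>S. 1 / (1 + (real_of_int k)\<^sup>2)) \<le> zeta_int"
  unfolding zeta_int_def
  by (rule finite_sum_le_infsum[OF inverse_square_summable]) (auto intro: less_imp_le)

text \<open>Cauchy-Schwarz against the reciprocal weights, whose squares are dominated by 1 / (1 +
  k^2) as soon as 1 \<le> s.\<close>

lemma sum_norm_amp_le:
  assumes "1 \<le> s" "finite S"
  shows "(\<Sum>k\<in>S. norm (amp s b k)) \<le> sqrt zeta_int * norm b"
proof -
  have "(\<Sum>k\<in>S. norm (amp s b k)) = (\<Sum>k\<in>S. \<bar>1 / wt s k\<bar> * \<bar>norm (coef b k)\<bar>)"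
    by (intro sum.cong) (auto simp: norm_coef_eq_amp[of b _ s])
  also have "\<dots> \<le> L2_set (\<lambda>k. 1 / wt s k) S * L2_set (\<lambda>k. norm (coef b k)) S"
    by (rule L2_set_mult_ineq)
  also have "\<dots> \<le> sqrt zeta_int * norm b"
  proof (rule mult_mono)
    have "(\<Sum>k\<in>S. (1 / wt s k)\<^sup>2) \<le> (\<Sum>k\<in>S. 1 / (1 + (real_of_int k)\<^sup>2))"
      unfolding power_divide power_one
      by (intro sum_mono divide_left_mono one_plus_square_le_wt_square assms) (auto intro!: mult_pos_pos)
    also note sum_inverse_square_le[OF assms(2)]
    finally show "L2_set (\<lambda>k. 1 / wt s k) S \<le> sqrt zeta_int"
      by (simp add: L2_set_def)
    show "L2_set (\<lambda>k. norm (coef b k)) S \<le> norm b"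
      using sum_coef_square_le[OF assms(2), of b] by (auto simp: L2_set_def intro!: real_le_lsqrt)
  qed (auto simp: zeta_int_nonneg)
  finally show ?thesis .
qed

lemma amp_abs_summable: "1 \<le> s \<Longrightarrow> (\<lambda>k. norm (amp s b k)) summable_on UNIV"
  by (rule nonneg_bdd_above_summable_on)
    (auto simp: bdd_above_def intro!: exI[of _ "sqrt zeta_int * norm b"] sum_norm_amp_le)

text \<open>The norm of the algebra of absolutely convergent Fourier series. It takes the place of
  the sup norm in the tame estimate, because products are handled as convolutions.\<close>

definition wiener :: "real \<Rightarrow> hl2 \<Rightarrow> real" where
  "wiener s b = (\<Sum>\<^sub>\<infinity>k. norm (amp s b k))"

lemma wiener_nonneg: "0 \<le> wiener s b"
  unfolding wiener_def by (rule infsum_nonneg) simp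

lemma wiener_leI:
  assumes "1 \<le> s" "\<And>S. finite S \<Longrightarrow> (\<Sum>k\<in>S. norm (amp s b k)) \<le> C"
  shows "wiener s b \<le> C"
  unfolding wiener_def by (rule infsum_le_finite_sums) (auto simp: amp_abs_summable assms)

lemma wiener_le_norm: "1 \<le> s \<Longrightarrow> wiener s b \<le> sqrt zeta_int * norm b"
  by (intro wiener_leI sum_norm_amp_le)

section \<open>Convolution and Young's inequality\<close>

definition conv :: "(int \<Rightarrow> 'a::real_normed_field) \<Rightarrow> (int \<Rightarrow> 'a) \<Rightarrow> int \<Rightarrow> 'a" where
  "conv p q n = (\<Sum>\<^sub>\<infinity>k. p (n - k) * q k)"

lemma conv_abs_summable:
  fixes p q :: "int \<Rightarrow> 'a::real_normed_field"
  assumes "\<And>k. norm (p k) \<le> P" "(\<lambda>k. norm (q k)) summable_on UNIV"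
  shows "(\<lambda>k. norm (p (n - k) * q k)) summable_on UNIV"
proof (rule summable_on_comparison_test)
  show "(\<lambda>k. P * norm (q k)) summable_on UNIV"
    by (intro summable_on_cmult_right assms)
qed (auto simp: norm_mult intro!: mult_right_mono assms)

lemma conv_commute: "conv p q n = conv q p n"
proof -
  have "bij_betw (\<lambda>k. n - k) UNIV (UNIV :: int set)"
    by (rule bij_betwI[of _ _ _ "\<lambda>k. n - k"]) auto
  from infsum_reindex_bij_betw[OF this, of "\<lambda>k. p (n - k) * q k"] show ?thesis
    by (simp add: conv_def mult.commute)
qed

lemma conv_cnj:
  assumes "\<And>k. p (- k) = cnj (p k)" "\<And>k. q (- k) = cnj (q k)"
  shows "conv p q (- n) = cnj (conv p q n)"
proof -
  have "bij_betw uminus UNIV (UNIV :: int set)"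
    by (rule bij_betwI[of _ _ _ uminus]) auto
  then have "conv p q (- n) = (\<Sum>\<^sub>\<infinity>k. p (- n - - k) * q (- k))"
    unfolding conv_def by (rule infsum_reindex_bij_betw[symmetric])
  also have "\<dots> = (\<Sum>\<^sub>\<infinity>k. cnj (p (n - k) * q k))"
  proof (rule infsum_cong)
    fix k
    have "- n - - k = - (n - k)"
      by simp
    then show "p (- n - - k) * q (- k) = cnj (p (n - k) * q k)"
      by (simp only: assms complex_cnj_mult)
  qed
  finally show ?thesis
    by (simp only: conv_def infsum_cnj)
qed

lemma L2_set_sum_le: "L2_set (\<lambda>n. \<Sum>k\<in>K. f k n) S \<le> (\<Sum>k\<in>K. L2_set (f k) S)"
proof (induction K rule: infinite_finite_induct)
  case (insert k K)
  then show ?case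
    using L2_set_triangle_ineq[of "f k" "\<lambda>n. \<Sum>k\<in>K. f k n" S] by simp
qed (auto simp: L2_set_def)

text \<open>Young's inequality for an l2 and an l1 sequence. For finitely many k, Minkowski's
  inequality adds up translates of p with weights q(k); the window S stays fixed while k exhausts
  the integers.\<close>

lemma young_l2:
  fixes p q :: "int \<Rightarrow> real"
  assumes p: "\<And>k. 0 \<le> p k" "\<And>S. finite S \<Longrightarrow> L2_set p S \<le> P"
    and q: "\<And>k. 0 \<le> q k" "q summable_on UNIV" and "finite S"
  shows "L2_set (conv p q) S \<le> P * (\<Sum>\<^sub>\<infinity>k. q k)"
proof -
  have "p k \<le> P" for k
    using p(2)[of "{k}"] p(1)[of k] by (simp add: L2_set_def)
  then have "(\<lambda>k. norm (p (n - k) * q k)) summable_on UNIV" for n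
    by (intro conv_abs_summable[of p P q]) (use p q in auto)
  then have "(\<lambda>k. p (n - k) * q k) summable_on UNIV" for n
    by (rule abs_summable_summable)
  then have lim: "(sum (\<lambda>k. p (n - k) * q k) \<longlongrightarrow> conv p q n) (finite_subsets_at_top UNIV)" for n
    unfolding conv_def by (rule infsum_tendsto)
  show ?thesis
  proof (rule tendsto_upperbound)
    show "((\<lambda>K. L2_set (\<lambda>n. \<Sum>k\<in>K. p (n - k) * q k) S) \<longlongrightarrow> L2_set (conv p q) S) (finite_subsets_at_top UNIV)"
      unfolding L2_set_def by (intro tendsto_intros lim)
    have "L2_set (\<lambda>n. \<Sum>k\<in>K. p (n - k) * q k) S \<le> P * (\<Sum>\<^sub>\<infinity>k. q k)" if "finite K" for K
    proof -
      have "L2_set (\<lambda>n. \<Sum>k\<in>K. p (n - k) * q k) S \<le> (\<Sum>k\<in>K. L2_set (\<lambda>n. p (n - k) * q k) S)"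
        by (rule L2_set_sum_le)
      also have "\<dots> \<le> (\<Sum>k\<in>K. P * q k)"
      proof (rule sum_mono)
        fix k
        \<comment> \<open>A translate of p seen on S is p seen on a translated finite set, so the
          bound P applies again.\<close>
        have "L2_set (\<lambda>n. p (n - k) * q k) S = L2_set p ((\<lambda>n. n - k) ` S) * q k"
          by (simp add: q L2_set_def sum.reindex power_mult_distrib real_sqrt_mult flip: sum_distrib_right)
        also have "\<dots> \<le> P * q k"
          using p(2) \<open>finite S\<close> q by (intro mult_right_mono) auto
        finally show "L2_set (\<lambda>n. p (n - k) * q k) S \<le> P * q k" .
      qed
      also have "\<dots> = P * sum q K"
        by (simp add: sum_distrib_left)
      also have "\<dots> \<le> P * (\<Sum>\<^sub>\<infinity>k. q k)"
        using p(2)[of "{}"] q that by (intro mult_left_mono finite_sum_le_infsum) (auto simp: L2_set_def)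
      finally show ?thesis .
    qed
    then show "\<forall>\<^sub>F K in finite_subsets_at_top UNIV. L2_set (\<lambda>n. \<Sum>k\<in>K. p (n - k) * q k) S \<le> P * (\<Sum>\<^sub>\<infinity>k. q k)"
      by (intro eventually_finite_subsets_at_top_weakI) auto
  qed simp
qed

lemma L2_set_coef_le: "finite S \<Longrightarrow> L2_set (\<lambda>k. norm (coef b k)) S \<le> norm b"
  unfolding L2_set_def by (rule real_le_lsqrt) (auto simp: sum_coef_square_le)

section \<open>Fourier multipliers and the symbol of K\<close>

definition multiplier :: "(int \<Rightarrow> complex) \<Rightarrow> hl2 \<Rightarrow> hl2" where
  "multiplier m b = Abs_hl2 (\<lambda>k. m k * coef b k)"

text \<open>The symmetry says that the multiplier maps real functions to real functions, that is,
  Hermitian sequences to Hermitian ones.\<close>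

definition bounded_symbol :: "real \<Rightarrow> (int \<Rightarrow> complex) \<Rightarrow> bool" where
  "bounded_symbol C m \<longleftrightarrow> (\<forall>k. m (- k) = cnj (m k) \<and> norm (m k) \<le> C)"

context
  fixes m :: "int \<Rightarrow> complex" and C :: real
  assumes m: "bounded_symbol C m"
begin

text \<open>Coefficients and bound are obtained together, since \<open>Abs_hl2\<close> can be
  inverted only once the bound has shown square-summability.\<close>

lemma multiplier_aux: "coef (multiplier m b) = (\<lambda>k. m k * coef b k) \<and> norm (multiplier m b) \<le> C * norm b"
proof (rule hl2_obtain[of "\<lambda>k. m k * coef b k" "C * norm b"])
  have bd: "norm (m k) \<le> C" for k
    using m by (simp add: bounded_symbol_def)
  show C: "0 \<le> C * norm b"
    using order_trans[OF norm_ge_zero bd] by simp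
  fix S :: "int set" assume "finite S"
  have "(\<Sum>k\<in>S. (norm (m k * coef b k))\<^sup>2) \<le> (\<Sum>k\<in>S. C\<^sup>2 * (norm (coef b k))\<^sup>2)"
    unfolding norm_mult power_mult_distrib by (intro sum_mono mult_right_mono power_mono bd) auto
  also have "\<dots> \<le> (C * norm b)\<^sup>2"
    using sum_coef_square_le[OF \<open>finite S\<close>, of b]
    by (simp add: sum_distrib_left[symmetric] power_mult_distrib mult_left_mono)
  finally show "(\<Sum>k\<in>S. (norm (m k * coef b k))\<^sup>2) \<le> (C * norm b)\<^sup>2" .
next
  fix a assume "coef a = (\<lambda>k. m k * coef b k)" "norm a \<le> C * norm b"
  moreover from this(1) have "multiplier m b = a"
    unfolding multiplier_def by (metis coef_inverse)
  ultimately show ?thesis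
    by simp
qed (use m in \<open>simp add: bounded_symbol_def coef_minus_index\<close>)

lemma coef_multiplier: "coef (multiplier m b) k = m k * coef b k"
  using multiplier_aux[of b] by simp

lemma norm_multiplier_le: "norm (multiplier m b) \<le> C * norm b"
  using multiplier_aux[of b] by simp

lemma bounded_linear_multiplier: "bounded_linear (multiplier m)"
proof (rule bounded_linear_intro)
  show "norm (multiplier m b) \<le> norm b * C" for b
    using norm_multiplier_le[of b] by (simp add: mult.commute)
qed (auto intro!: hl2_eqI simp: coef_multiplier algebra_simps)

end

definition rbo_symbol :: "int \<Rightarrow> complex" where
  "rbo_symbol n = - \<i> * of_int n / (1 + of_int \<bar>n\<bar>)"

lemma rbo_symbol_minus: "rbo_symbol (- n) = cnj (rbo_symbol n)"
  by (simp add: rbo_symbol_def)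

text \<open>The weight of the energy cancels the denominator of K and leaves the plain derivative;
  this is the origin of the conservation law.\<close>

lemma one_plus_abs_symbol: "(1 + of_int \<bar>n\<bar>) * rbo_symbol n = - \<i> * of_int n"
proof -
  have "(1 + of_int \<bar>n\<bar> :: complex) = of_real (1 + \<bar>real_of_int n\<bar>)"
    by (simp flip: of_int_abs)
  also have "\<dots> \<noteq> 0"
    by (subst of_real_eq_0_iff) linarith
  finally show ?thesis
    by (simp add: rbo_symbol_def)
qed

lemma norm_rbo_symbol_le: "norm (rbo_symbol n) \<le> 1"
proof -
  have "(1 + of_int \<bar>n\<bar> :: complex) = of_real (1 + \<bar>real_of_int n\<bar>)"
    by (simp flip: of_int_abs)
  then have "norm (1 + of_int \<bar>n\<bar> :: complex) = 1 + \<bar>real_of_int n\<bar>"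
    by (metis abs_ge_zero add_nonneg_nonneg norm_of_real abs_of_nonneg zero_le_one)
  then show ?thesis
    by (simp add: rbo_symbol_def norm_divide norm_mult)
qed

lemma bounded_symbol_rbo: "bounded_symbol 1 rbo_symbol"
  by (simp add: bounded_symbol_def rbo_symbol_minus norm_rbo_symbol_le)

section \<open>The tame bilinear estimate\<close>

definition bilin :: "real \<Rightarrow> hl2 \<Rightarrow> hl2 \<Rightarrow> hl2" where
  "bilin s b c = Abs_hl2 (\<lambda>n. of_real (wt s n) * rbo_symbol n * conv (amp s b) (amp s c) n)"

lemma amp_conv_abs_summable:
  "1 \<le> s \<Longrightarrow> (\<lambda>k. norm (amp s b (n - k) * amp s c k)) summable_on UNIV"
  by (rule conv_abs_summable[where P = "norm b"]) (auto simp: amp_abs_summable norm_amp_le)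

text \<open>By \<open>wt_add_le\<close> the weight falls on one factor and turns its amplitude into
  a \<open>coef\<close>; the other factor keeps its amplitude, which Young's inequality later
  measures in the Wiener norm.\<close>

lemma wt_norm_conv_le:
  assumes "1 \<le> s"
  shows "wt s n * norm (conv (amp s b) (amp s c) n)
    \<le> 2 powr s * (conv (\<lambda>k. norm (coef b k)) (\<lambda>k. norm (amp s c k)) n
                  + conv (\<lambda>k. norm (coef c k)) (\<lambda>k. norm (amp s b k)) n)"
proof -
  have sb: "(\<lambda>k. norm (coef b (n - k)) * norm (amp s c k)) summable_on UNIV"
    using conv_abs_summable[of "coef b" "norm b" "amp s c" n] norm_coef_le[of b] amp_abs_summable[OF assms, of c]
    by (simp add: norm_mult)
  \<comment> \<open>Here the absolutely summable factor carries the index n - k, so k is reflected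
    before \<open>conv_abs_summable\<close> applies.\<close>
  have "(\<lambda>k. norm (amp s b (n - k)) * norm (coef c k)) summable_on UNIV"
  proof -
    have "bij_betw (\<lambda>k. n - k) UNIV (UNIV :: int set)"
      by (rule bij_betwI[of _ _ _ "\<lambda>k. n - k"]) auto
    from summable_on_reindex_bij_betw[OF this, of "\<lambda>k. norm (amp s b (n - k)) * norm (coef c k)"]
    show ?thesis
      using conv_abs_summable[of "coef c" "norm c" "amp s b" n] norm_coef_le[of c] amp_abs_summable[OF assms, of b]
      by (simp add: norm_mult mult.commute)
  qed
  note sc = this
  have "wt s n * norm (conv (amp s b) (amp s c) n) \<le> wt s n * (\<Sum>\<^sub>\<infinity>k. norm (amp s b (n - k) * amp s c k))"
    unfolding conv_def by (intro mult_left_mono norm_infsum_bound amp_conv_abs_summable assms) auto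
  also have "\<dots> = (\<Sum>\<^sub>\<infinity>k. wt s n * norm (amp s b (n - k) * amp s c k))"
    by (simp add: infsum_cmult_right')
  also have "\<dots> \<le> (\<Sum>\<^sub>\<infinity>k. 2 powr s * (norm (coef b (n - k)) * norm (amp s c k) + norm (amp s b (n - k)) * norm (coef c k)))"
  proof (rule infsum_mono)
    show "(\<lambda>k. wt s n * norm (amp s b (n - k) * amp s c k)) summable_on UNIV"
      by (intro summable_on_cmult_right amp_conv_abs_summable assms)
    show "(\<lambda>k. 2 powr s * (norm (coef b (n - k)) * norm (amp s c k) + norm (amp s b (n - k)) * norm (coef c k))) summable_on UNIV"
      by (intro summable_on_cmult_right summable_on_add sb sc)
    fix k
    have "wt s n * norm (amp s b (n - k) * amp s c k)
        \<le> 2 powr s * (wt s (n - k) + wt s k) * norm (amp s b (n - k) * amp s c k)"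
      using wt_add_le[of s "n - k" k] assms by (intro mult_right_mono) auto
    then show "wt s n * norm (amp s b (n - k) * amp s c k)
        \<le> 2 powr s * (norm (coef b (n - k)) * norm (amp s c k) + norm (amp s b (n - k)) * norm (coef c k))"
      by (simp add: norm_coef_eq_amp[of _ _ s] norm_mult algebra_simps)
  qed
  also have "\<dots> = 2 powr s * (conv (\<lambda>k. norm (coef b k)) (\<lambda>k. norm (amp s c k)) n
      + conv (\<lambda>k. norm (amp s b k)) (\<lambda>k. norm (coef c k)) n)"
    by (simp add: infsum_cmult_right' infsum_add[OF sb sc] conv_def)
  finally show ?thesis
    by (simp add: conv_commute[of "\<lambda>k. norm (amp s b k)"])
qed

context
  fixes s :: real
  assumes s: "1 \<le> s"
begin

lemma L2_set_conv_coef_amp_le: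
  "finite S \<Longrightarrow> L2_set (conv (\<lambda>k. norm (coef b k)) (\<lambda>k. norm (amp s c k))) S \<le> norm b * wiener s c"
  unfolding wiener_def by (rule young_l2) (auto simp: L2_set_coef_le amp_abs_summable s)

text \<open>\<open>bilin s b c\<close> encodes K(uv), the product being a convolution of amplitudes.
  The symbol of K has modulus at most 1, and Young's inequality bounds each term of
  \<open>wt_norm_conv_le\<close> by an H^s norm times a Wiener norm. Thus no product of two H^s
  norms appears.\<close>

lemma bilin_aux:
  "coef (bilin s b c) = (\<lambda>n. of_real (wt s n) * rbo_symbol n * conv (amp s b) (amp s c) n) \<and>
   norm (bilin s b c) \<le> 2 powr s * (norm b * wiener s c + norm c * wiener s b)"
    (is "_ = ?f \<and> _ \<le> ?C")
proof (rule hl2_obtain[of ?f ?C])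
  show "?f (- n) = cnj (?f n)" for n
    by (simp add: rbo_symbol_minus conv_cnj amp_minus_index)
  show C: "0 \<le> ?C"
    by (auto intro!: mult_nonneg_nonneg add_nonneg_nonneg wiener_nonneg)
  fix S :: "int set" assume S: "finite S"
  let ?p = "conv (\<lambda>k. norm (coef b k)) (\<lambda>k. norm (amp s c k))"
  let ?q = "conv (\<lambda>k. norm (coef c k)) (\<lambda>k. norm (amp s b k))"
  have "norm (?f n) \<le> 2 powr s * (?p n + ?q n)" for n
  proof -
    have "norm (?f n) = norm (rbo_symbol n) * (wt s n * norm (conv (amp s b) (amp s c) n))"
      by (simp add: norm_mult)
    also have "\<dots> \<le> wt s n * norm (conv (amp s b) (amp s c) n)"
      using norm_rbo_symbol_le[of n] by (intro mult_left_le_one_le) auto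
    also note wt_norm_conv_le[OF s]
    finally show ?thesis .
  qed
  then have "L2_set (\<lambda>n. norm (?f n)) S \<le> L2_set (\<lambda>n. 2 powr s * (?p n + ?q n)) S"
    by (intro L2_set_mono) auto
  also have "\<dots> = 2 powr s * L2_set (\<lambda>n. ?p n + ?q n) S"
    by (simp add: L2_set_right_distrib)
  also have "\<dots> \<le> 2 powr s * (L2_set ?p S + L2_set ?q S)"
    by (intro mult_left_mono L2_set_triangle_ineq) auto
  also have "\<dots> \<le> ?C"
    by (intro mult_left_mono add_mono L2_set_conv_coef_amp_le S) auto
  finally have "sqrt (\<Sum>n\<in>S. (norm (?f n))\<^sup>2) \<le> ?C"
    by (simp add: L2_set_def)
  then show "(\<Sum>n\<in>S. (norm (?f n))\<^sup>2) \<le> ?C\<^sup>2"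
    by (rule sqrt_le_D)
next
  fix a assume "coef a = ?f" "norm a \<le> ?C"
  moreover from this(1) have "bilin s b c = a"
    unfolding bilin_def by (metis coef_inverse)
  ultimately show ?thesis
    by simp
qed

lemma coef_bilin: "coef (bilin s b c) n = of_real (wt s n) * rbo_symbol n * conv (amp s b) (amp s c) n"
  using bilin_aux[of b c] by simp

lemma amp_bilin: "amp s (bilin s b c) n = rbo_symbol n * conv (amp s b) (amp s c) n"
  by (simp add: amp_def[of s "bilin s b c"] coef_bilin)

lemma norm_bilin_le: "norm (bilin s b c) \<le> 2 powr s * (norm b * wiener s c + norm c * wiener s b)"
  using bilin_aux[of b c] by simp

lemma bilin_commute: "bilin s b c = bilin s c b"
  by (rule hl2_eqI) (simp add: coef_bilin conv_commute)

lemma bounded_bilinear_bilin: "bounded_bilinear (bilin s)"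
proof
  have sm: "(\<lambda>k. amp s b (n - k) * amp s c k) summable_on UNIV" for b c n
    by (rule abs_summable_summable[OF amp_conv_abs_summable[OF s]])
  show add: "bilin s (a + a') b = bilin s a b + bilin s a' b" for a a' b
  proof (rule hl2_eqI)
    fix n
    have "conv (amp s (a + a')) (amp s b) n = conv (amp s a) (amp s b) n + conv (amp s a') (amp s b) n"
      by (simp add: conv_def distrib_right infsum_add sm)
    then show "coef (bilin s (a + a') b) n = coef (bilin s a b + bilin s a' b) n"
      by (simp add: coef_bilin distrib_left)
  qed
  show scale: "bilin s (r *\<^sub>R a) b = r *\<^sub>R bilin s a b" for r a b
    by (rule hl2_eqI) (simp add: coef_bilin conv_def infsum_scaleR_right)
  show "bilin s b (a + a') = bilin s b a + bilin s b a'" for a a' b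
    by (simp add: add bilin_commute[of b])
  show "bilin s b (r *\<^sub>R a) = r *\<^sub>R bilin s b a" for r a b
    by (simp add: scale bilin_commute[of b])
  show "\<exists>C. \<forall>a b. norm (bilin s a b) \<le> norm a * norm b * C"
  proof (intro exI allI)
    fix a b
    have "norm (bilin s a b) \<le> 2 powr s * (norm a * wiener s b + norm b * wiener s a)"
      by (rule norm_bilin_le)
    also have "\<dots> \<le> 2 powr s * (norm a * (sqrt zeta_int * norm b) + norm b * (sqrt zeta_int * norm a))"
      by (intro mult_left_mono add_mono wiener_le_norm s) auto
    finally show "norm (bilin s a b) \<le> norm a * norm b * (2 * 2 powr s * sqrt zeta_int)"
      by (simp add: algebra_simps)
  qed
qed

end

section \<open>A priori bounds\<close>

text \<open>The source of the logarithm in \<open>wiener_le_log\<close>. The nonnegative and the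
  nonpositive k each contribute a harmonic sum of length N + 1, with the index 0 counted
  twice.\<close>

lemma sum_real_of_int_interval_le:
  "(\<Sum>k\<in>{- int N..int N}. 1 / (1 + \<bar>real_of_int k\<bar>)) \<le> 2 + 2 * ln (real N + 1)"
proof -
  have "(\<Sum>k\<in>{- int N..int N}. 1 / (1 + \<bar>real_of_int k\<bar>))
      \<le> (\<Sum>k\<in>int ` {..N} \<union> (\<lambda>n. - int n) ` {..N}. 1 / (1 + \<bar>real_of_int k\<bar>))"
  proof (intro sum_mono2 subsetI)
    fix k assume k: "k \<in> {- int N..int N}"
    show "k \<in> int ` {..N} \<union> (\<lambda>n. - int n) ` {..N}"
    proof (cases "0 \<le> k")
      case True
      then show ?thesis
        using k by (intro UnI1 image_eqI[of _ _ "nat k"]) auto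
    next
      case False
      then show ?thesis
        using k by (intro UnI2 image_eqI[of _ _ "nat (- k)"]) auto
    qed
  qed auto
  also have "\<dots> \<le> (\<Sum>k\<in>int ` {..N}. 1 / (1 + \<bar>real_of_int k\<bar>)) + (\<Sum>k\<in>(\<lambda>n. - int n) ` {..N}. 1 / (1 + \<bar>real_of_int k\<bar>))"
    by (subst sum.union_inter[symmetric]) (auto intro!: sum_nonneg)
  also have "\<dots> = 2 * (\<Sum>n\<le>N. 1 / (1 + real n))"
    by (subst (1 2) sum.reindex) (auto simp: inj_on_def)
  also have "(\<Sum>n\<le>N. 1 / (1 + real n)) = harm (Suc N)"
    unfolding harm_def by (rule sum.reindex_bij_witness[of _ "\<lambda>n. n - 1" Suc]) (auto simp: inverse_eq_divide)
  \<comment> \<open>The difference of the harmonic sum and the logarithm decreases from its value 1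
    at length 1.\<close>
  also have "harm (Suc N) - ln (real (Suc N)) \<le> harm (Suc 0) - ln (real (Suc 0))"
    by (rule decseqD[OF decseq_harm_diff_ln]) simp
  then have "harm (Suc N) \<le> 1 + ln (real N + 1)"
    by (simp add: harm_def add.commute)
  finally show ?thesis
    by simp
qed

text \<open>Represents the quadratic form with weights 1 + |k| in the inner product of H^s; dividing
  by the squared weight undoes the weights hidden in \<open>coef\<close>. Being bounded and
  self-adjoint, it allows the energy to be differentiated along curves.\<close>

definition energy_op :: "real \<Rightarrow> hl2 \<Rightarrow> hl2" where
  "energy_op s = multiplier (\<lambda>k. of_real ((1 + \<bar>real_of_int k\<bar>) / (wt s k)\<^sup>2))"

text \<open>Up to the factor 1 / (2 pi), the integral of u^2 + u H u_x.\<close>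

definition energy :: "real \<Rightarrow> hl2 \<Rightarrow> real" where
  "energy s b = energy_op s b \<bullet> b"

definition linear_part :: "hl2 \<Rightarrow> hl2" where
  "linear_part = multiplier rbo_symbol"

text \<open>The right-hand side K(u + u^2/2) in weighted coefficients, as \<open>rBO_rhs_Psi\<close>
  confirms.\<close>

definition rbo_field :: "real \<Rightarrow> hl2 \<Rightarrow> hl2" where
  "rbo_field s b = linear_part b + (1 / 2) *\<^sub>R bilin s b b"

lemma coef_linear_part: "coef (linear_part b) n = rbo_symbol n * coef b n"
  unfolding linear_part_def by (rule coef_multiplier[OF bounded_symbol_rbo])

lemma norm_linear_part_le: "norm (linear_part b) \<le> norm b"
  using norm_multiplier_le[OF bounded_symbol_rbo, of b] by (simp add: linear_part_def)

lemma bounded_linear_linear_part: "bounded_linear linear_part"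
  unfolding linear_part_def by (rule bounded_linear_multiplier[OF bounded_symbol_rbo])

context
  fixes s :: real
  assumes s: "1 \<le> s"
begin

lemma energy_weight_le: "(1 + \<bar>real_of_int k\<bar>) / (wt s k)\<^sup>2 \<le> 2"
proof -
  have "0 \<le> (\<bar>real_of_int k\<bar> - 1)\<^sup>2"
    by simp
  then have "1 + \<bar>real_of_int k\<bar> \<le> 2 * (1 + (real_of_int k)\<^sup>2)"
    by (simp add: power2_diff) (smt (verit) zero_le_power2)
  also have "\<dots> \<le> 2 * (wt s k)\<^sup>2"
    using one_plus_square_le_wt_square[OF s, of k] by simp
  finally show ?thesis
    by (simp add: divide_le_eq)
qed

lemma bounded_symbol_energy: "bounded_symbol 2 (\<lambda>k. of_real ((1 + \<bar>real_of_int k\<bar>) / (wt s k)\<^sup>2))"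
  using energy_weight_le unfolding bounded_symbol_def by (auto simp: norm_of_real simp del: of_real_divide)

lemma coef_energy_op: "coef (energy_op s b) k = of_real ((1 + \<bar>real_of_int k\<bar>) / (wt s k)\<^sup>2) * coef b k"
  unfolding energy_op_def by (rule coef_multiplier[OF bounded_symbol_energy])

lemma bounded_linear_energy_op: "bounded_linear (energy_op s)"
  unfolding energy_op_def by (rule bounded_linear_multiplier[OF bounded_symbol_energy])

lemma inner_energy_op: "coef (energy_op s b) k \<bullet> coef c k = (1 + \<bar>real_of_int k\<bar>) * (amp s b k \<bullet> amp s c k)"
proof -
  have "coef (energy_op s b) k \<bullet> coef c k = (1 + \<bar>real_of_int k\<bar>) / (wt s k)\<^sup>2 * (coef b k \<bullet> coef c k)"
    by (simp only: coef_energy_op inner_scaleR_left flip: scaleR_conv_of_real)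
  also have "coef b k \<bullet> coef c k = (wt s k)\<^sup>2 * (amp s b k \<bullet> amp s c k)"
    unfolding coef_eq_amp[of _ _ s]
    by (simp only: inner_scaleR_left inner_scaleR_right power2_eq_square mult.assoc flip: scaleR_conv_of_real)
  finally show ?thesis
    by simp
qed

lemma energy_op_commute: "energy_op s b \<bullet> c = energy_op s c \<bullet> b"
  unfolding inner_hl2_def inner_energy_op by (simp add: inner_commute)

lemma energy_le: "energy s b \<le> 2 * (norm b)\<^sup>2"
proof -
  have "energy s b \<le> norm (energy_op s b) * norm b"
    unfolding energy_def by (rule norm_cauchy_schwarz)
  also have "\<dots> \<le> (2 * norm b) * norm b"
    unfolding energy_op_def by (intro mult_right_mono norm_multiplier_le[OF bounded_symbol_energy]) auto
  finally show ?thesis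
    by (simp add: power2_eq_square)
qed

lemma sum_energy_le:
  assumes "finite S"
  shows "(\<Sum>k\<in>S. (1 + \<bar>real_of_int k\<bar>) * (norm (amp s b k))\<^sup>2) \<le> energy s b"
proof -
  have "((\<lambda>k. (1 + \<bar>real_of_int k\<bar>) * (norm (amp s b k))\<^sup>2) has_sum energy s b) UNIV"
    using inner_hl2_has_sum[of "energy_op s b" b] unfolding inner_energy_op energy_def power2_norm_eq_inner .
  then show ?thesis
    by (rule finite_sum_le_has_sum) (use assms in auto)
qed

text \<open>Supplies one of the two square-summable factors behind the absolute convergence of the
  cubic sum in \<open>cubic_has_sum_zero\<close>.\<close>

lemma conv_norm_square_summable:
  "(\<lambda>n. (conv (\<lambda>k. norm (amp s b k)) (\<lambda>k. norm (amp s b k)) n)\<^sup>2) summable_on UNIV"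
    (is "(\<lambda>n. (?q n)\<^sup>2) summable_on UNIV")
proof (rule nonneg_bdd_above_summable_on)
  have "(\<Sum>n\<in>S. (?q n)\<^sup>2) \<le> (norm b * wiener s b)\<^sup>2" if "finite S" for S
  proof (rule sqrt_le_D)
    have "L2_set (\<lambda>k. norm (amp s b k)) S \<le> norm b" if "finite S" for S
      using s that
      by (intro order_trans[OF L2_set_mono[OF norm_amp_le_norm_coef] L2_set_coef_le]) auto
    then have "L2_set ?q S \<le> norm b * wiener s b"
      unfolding wiener_def by (intro young_l2 that) (auto simp: amp_abs_summable s)
    then show "sqrt (\<Sum>n\<in>S. (?q n)\<^sup>2) \<le> norm b * wiener s b"
      by (simp add: L2_set_def)
  qed
  then show "bdd_above (sum (\<lambda>n. (?q n)\<^sup>2) ` {F. F \<subseteq> UNIV \<and> finite F})"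
    by (auto simp: bdd_above_def)
qed auto

lemma conv_norm_nonneg: "0 \<le> conv (\<lambda>k. norm (p k)) (\<lambda>k. norm (q k)) n"
  unfolding conv_def by (rule infsum_nonneg) simp

text \<open>The sum over j + k + l = 0 of j a(j) a(k) a(l) vanishes, because symmetrising the summand
  over the three indices produces the factor (j + k + l) / 3.\<close>

lemma cubic_has_sum_zero: "((\<lambda>n. of_int n * cnj (amp s b n) * conv (amp s b) (amp s b) n) has_sum 0) UNIV"
proof -
  define a where "a = amp s b"
  define g where "g = (\<lambda>(j, k). of_int j * a j * a k * a (- j - k))"
  let ?D = "\<lambda>n. conv (\<lambda>k. norm (a k)) (\<lambda>k. norm (a k)) n"
  have a_summable: "(\<lambda>k. norm (a (- j - k) * a k)) summable_on UNIV" for j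
    unfolding a_def by (rule amp_conv_abs_summable[OF s])
  have inv: "bij_betw uminus UNIV (UNIV :: int set)"
    by (rule bij_betwI[of _ _ _ uminus]) auto
  have "(\<lambda>p. norm (g p)) summable_on (UNIV \<times> UNIV)"
  proof (rule Infinite_Sum.abs_summable_on_Sigma_iff[THEN iffD2, OF conjI])
    show "\<forall>j\<in>UNIV. (\<lambda>k. norm (g (j, k))) summable_on UNIV"
    proof
      fix j
      have "(\<lambda>k. norm (of_int j * a j) * norm (a (- j - k) * a k)) summable_on UNIV"
        by (intro summable_on_cmult_right a_summable)
      then show "(\<lambda>k. norm (g (j, k))) summable_on UNIV"
        by (simp add: g_def norm_mult mult_ac)
    qed
    have row: "(\<Sum>\<^sub>\<infinity>k. norm (g (j, k))) = norm (of_int j * a j) * ?D (- j)" for j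
      unfolding conv_def by (simp add: g_def norm_mult mult_ac flip: infsum_cmult_right')
    \<comment> \<open>The rearrangements rest on absolute convergence, which Cauchy-Schwarz
      provides: since |j| \<le> \<open>wt s j\<close>, the factor j a(j) is dominated by
      \<open>coef b j\<close>, and the convolution of the moduli is square-summable too.\<close>
    have "(\<lambda>j. (norm (coef b j)) \<bullet> ?D (- j)) summable_on UNIV"
    proof (rule inner_summable)
      show "(\<lambda>j. (norm (norm (coef b j)))\<^sup>2) summable_on UNIV"
        by (simp add: coef_square_summable)
      show "(\<lambda>j. (norm (?D (- j)))\<^sup>2) summable_on UNIV"
        using conv_norm_square_summable[of b]
          summable_on_reindex_bij_betw[OF inv, of "\<lambda>j. (?D j)\<^sup>2"] by (simp add: a_def)
    qed
    then have "(\<lambda>j. norm (of_int j * a j) * ?D (- j)) summable_on UNIV"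
    proof (rule summable_on_comparison_test)
      fix j
      have "norm (of_int j * a j) \<le> norm (coef b j)"
        using mult_right_mono[OF abs_le_wt[OF s, of j] norm_ge_zero[of "a j"]]
        by (simp add: norm_mult norm_coef_eq_amp[of b j s] a_def)
      then show "norm (of_int j * a j) * ?D (- j) \<le> norm (coef b j) \<bullet> ?D (- j)"
        by (simp add: mult_right_mono conv_norm_nonneg)
      show "0 \<le> norm (of_int j * a j) * ?D (- j)"
        by (simp add: conv_norm_nonneg)
    qed
    then show "(\<lambda>j. norm (\<Sum>\<^sub>\<infinity>k. norm (g (j, k)))) summable_on UNIV"
      unfolding row by (simp add: abs_mult conv_norm_nonneg norm_mult)
  qed
  then have g: "g summable_on UNIV"
    using abs_summable_summable by (auto simp: UNIV_Times_UNIV)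
  \<comment> \<open>Exchanging j with k, or j with - j - k, permutes the index plane, so three
    copies of one and the same sum may be added termwise.\<close>
  have bij1: "bij_betw (\<lambda>(j, k). (k, j)) UNIV (UNIV :: (int \<times> int) set)"
    by (rule bij_betwI[of _ _ _ "\<lambda>(j, k). (k, j)"]) auto
  have bij2: "bij_betw (\<lambda>(j, k). (- j - k, k)) UNIV (UNIV :: (int \<times> int) set)"
    by (rule bij_betwI[of _ _ _ "\<lambda>(j, k). (- j - k, k)"]) auto
  have g1: "(\<lambda>(j, k). g (k, j)) summable_on UNIV" and e1: "(\<Sum>\<^sub>\<infinity>(j, k). g (k, j)) = infsum g UNIV"
    using summable_on_reindex_bij_betw[OF bij1, of g] infsum_reindex_bij_betw[OF bij1, of g] g
    by (simp_all add: case_prod_unfold)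
  have g2: "(\<lambda>(j, k). g (- j - k, k)) summable_on UNIV" and e2: "(\<Sum>\<^sub>\<infinity>(j, k). g (- j - k, k)) = infsum g UNIV"
    using summable_on_reindex_bij_betw[OF bij2, of g] infsum_reindex_bij_betw[OF bij2, of g] g
    by (simp_all add: case_prod_unfold)
  have "infsum g UNIV + infsum g UNIV + infsum g UNIV
      = (\<Sum>\<^sub>\<infinity>p. g p + (case p of (j, k) \<Rightarrow> g (k, j)) + (case p of (j, k) \<Rightarrow> g (- j - k, k)))"
    using infsum_add[OF summable_on_add[OF g g1] g2] infsum_add[OF g g1] by (simp add: e1 e2)
  also have "(\<lambda>p. g p + (case p of (j, k) \<Rightarrow> g (k, j)) + (case p of (j, k) \<Rightarrow> g (- j - k, k))) = (\<lambda>_. 0)"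
  proof
    fix p :: "int \<times> int"
    obtain j k where p: "p = (j, k)"
      by fastforce
    have e: "- k - j = - j - k" "- (- j - k) - k = j"
      by simp_all
    have "g (k, j) = of_int k * a k * a j * a (- j - k)"
      "g (- j - k, k) = of_int (- j - k) * a (- j - k) * a k * a j"
      by (simp_all only: g_def prod.case e)
    then show "g p + (case p of (j, k) \<Rightarrow> g (k, j)) + (case p of (j, k) \<Rightarrow> g (- j - k, k)) = 0"
      unfolding p by (simp add: g_def algebra_simps)
  qed
  finally have zero: "infsum g UNIV = 0"
    by simp
  \<comment> \<open>With n = - j the inner sum over k is a convolution at n, and a(j) is the
    conjugate of a(n).\<close>
  have row: "of_int (- j) * cnj (a (- j)) * conv a a (- j) = - (\<Sum>\<^sub>\<infinity>k. g (j, k))" for j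
  proof -
    have "(\<Sum>\<^sub>\<infinity>k. g (j, k)) = (\<Sum>\<^sub>\<infinity>k. (of_int j * a j) * (a (- j - k) * a k))"
      by (intro infsum_cong) (simp add: g_def mult_ac)
    also have "\<dots> = (of_int j * a j) * conv a a (- j)"
      unfolding conv_def by (rule infsum_cmult_right')
    finally show ?thesis
      by (simp add: a_def amp_minus_index)
  qed
  have "((\<lambda>j. \<Sum>\<^sub>\<infinity>k. g (j, k)) has_sum 0) UNIV"
    using summable_on_Sigma_banach[of "\<lambda>j k. g (j, k)" UNIV "\<lambda>_. UNIV"]
      infsum_Sigma'_banach[of "\<lambda>j k. g (j, k)" UNIV "\<lambda>_. UNIV"] g zero
    by (simp add: has_sum_iff)
  then have "((\<lambda>j. of_int (- j) * cnj (a (- j)) * conv a a (- j)) has_sum 0) UNIV"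
    unfolding row by (simp add: has_sum_uminus)
  then have "((\<lambda>n. of_int n * cnj (a n) * conv a a n) has_sum 0) UNIV"
    by (subst (asm) has_sum_reindex_bij_betw[OF inv])
  then show ?thesis
    unfolding a_def .
qed

text \<open>The linear part contributes nothing because its symbol is purely imaginary, the
  quadratic part because of the cubic sum, which is the integral of u^2 u_x on the Fourier side. As
  both vanish separately, the argument may be scaled by any r; truncated fields require
  this.\<close>

lemma energy_orthogonal: "energy_op s b \<bullet> rbo_field s (r *\<^sub>R b) = 0"
proof -
  interpret bounded_bilinear "bilin s"
    by (rule bounded_bilinear_bilin[OF s])
  have "energy_op s b \<bullet> linear_part b = 0"
  proof -
    have "z \<bullet> (rbo_symbol k * z) = 0" for k z
    proof -
      have "rbo_symbol k = \<i> * of_real (- of_int k / (1 + \<bar>real_of_int k\<bar>))"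
        by (simp add: rbo_symbol_def flip: of_int_abs)
      then have "Re (rbo_symbol k) = 0"
        by (simp only: Re_i_times Im_complex_of_real)
      then show ?thesis
        by (simp add: inner_complex_def algebra_simps)
    qed
    moreover have "amp s (linear_part b) k = rbo_symbol k * amp s b k" for k
      by (simp add: amp_def coef_linear_part)
    ultimately show ?thesis
      unfolding inner_hl2_def inner_energy_op by simp
  qed
  moreover have "energy_op s b \<bullet> bilin s b b = 0"
  proof -
    \<comment> \<open>The inner product takes a real part, which the factor -i of the symbol turns
      into an imaginary part.\<close>
    have "energy_op s b \<bullet> bilin s b b
        = (\<Sum>\<^sub>\<infinity>n. Im (of_int n * cnj (amp s b n) * conv (amp s b) (amp s b) n))"
      unfolding inner_hl2_def
    proof (rule infsum_cong)
      fix n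
      have "coef (energy_op s b) n \<bullet> coef (bilin s b b) n
          = amp s b n \<bullet> (of_real (1 + \<bar>real_of_int n\<bar>) * rbo_symbol n * conv (amp s b) (amp s b) n)"
        unfolding inner_energy_op amp_bilin[OF s] mult.assoc
        by (simp only: inner_scaleR_right flip: scaleR_conv_of_real)
      also have "complex_of_real (1 + \<bar>real_of_int n\<bar>) * rbo_symbol n = - \<i> * of_int n"
        using one_plus_abs_symbol[of n] by (simp flip: of_int_abs)
      finally show "coef (energy_op s b) n \<bullet> coef (bilin s b b) n
          = Im (of_int n * cnj (amp s b n) * conv (amp s b) (amp s b) n)"
        by (simp add: inner_complex_def algebra_simps)
    qed
    also have "\<dots> = 0"
      using has_sum_Im[OF cubic_has_sum_zero[of b]] by (simp add: infsumI)
    finally show ?thesis .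
  qed
  moreover have "linear_part (r *\<^sub>R b) = r *\<^sub>R linear_part b"
    by (rule linear_scale[OF bounded_linear.linear[OF bounded_linear_linear_part]])
  ultimately show ?thesis
    unfolding rbo_field_def by (simp add: inner_add_right scaleR_left scaleR_right)
qed

text \<open>The growth rate involves only the Wiener norm. Scaling the argument by r multiplies the
  linear part by r and the quadratic part by r^2, and neither factor exceeds 1 in modulus.\<close>

lemma norm_field_le: "\<bar>r\<bar> \<le> 1 \<Longrightarrow> norm (rbo_field s (r *\<^sub>R b)) \<le> (1 + 2 powr s * wiener s b) * norm b"
proof -
  assume r: "\<bar>r\<bar> \<le> 1"
  interpret bounded_bilinear "bilin s"
    by (rule bounded_bilinear_bilin[OF s])
  have "linear_part (r *\<^sub>R b) = r *\<^sub>R linear_part b"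
    by (rule linear_scale[OF bounded_linear.linear[OF bounded_linear_linear_part]])
  then have "rbo_field s (r *\<^sub>R b) = r *\<^sub>R (linear_part b + (r / 2) *\<^sub>R bilin s b b)"
    unfolding rbo_field_def by (simp add: scaleR_left scaleR_right scaleR_add_right)
  then have "norm (rbo_field s (r *\<^sub>R b)) \<le> norm (linear_part b + (r / 2) *\<^sub>R bilin s b b)"
    using r by (simp add: mult_left_le_one_le)
  also have "\<dots> \<le> norm (linear_part b) + norm ((r / 2) *\<^sub>R bilin s b b)"
    by (rule norm_triangle_ineq)
  also have "\<dots> \<le> norm b + 1 / 2 * norm (bilin s b b)"
    using r unfolding norm_scaleR by (intro add_mono norm_linear_part_le mult_right_mono) auto
  also have "\<dots> \<le> norm b + 1 / 2 * (2 powr s * (norm b * wiener s b + norm b * wiener s b))"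
    by (intro add_left_mono mult_left_mono norm_bilin_le s) auto
  finally show ?thesis
    by (simp add: algebra_simps)
qed

lemma rbo_field_lipschitz: "lipschitz_on_balls (rbo_field s)"
  unfolding lipschitz_on_balls_def
proof
  fix R
  interpret bounded_bilinear "bilin s"
    by (rule bounded_bilinear_bilin[OF s])
  obtain K where K: "0 < K" "\<And>a b. norm (bilin s a b) \<le> norm a * norm b * K"
    using pos_bounded by blast
  have "norm (rbo_field s x - rbo_field s y) \<le> (1 + R * K) * norm (x - y)" if "norm x \<le> R" "norm y \<le> R" for x y
  proof -
    have "rbo_field s x - rbo_field s y = linear_part (x - y) + (1 / 2) *\<^sub>R (bilin s (x - y) x + bilin s y (x - y))"
      unfolding rbo_field_def
      by (simp add: diff_left diff_right linear_diff[OF bounded_linear.linear[OF bounded_linear_linear_part]] algebra_simps)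
    also have "norm \<dots> \<le> norm (linear_part (x - y)) + 1 / 2 * (norm (bilin s (x - y) x) + norm (bilin s y (x - y)))"
      by (rule norm_triangle_le, rule add_left_mono, simp, rule norm_triangle_ineq)
    also have "\<dots> \<le> norm (x - y) + 1 / 2 * (norm (x - y) * norm x * K + norm y * norm (x - y) * K)"
      by (intro add_mono mult_left_mono norm_linear_part_le K) auto
    also have "\<dots> \<le> norm (x - y) + 1 / 2 * (norm (x - y) * R * K + R * norm (x - y) * K)"
      using K(1) that by (intro add_left_mono mult_left_mono add_mono mult_right_mono) auto
    finally show ?thesis
      by (simp add: algebra_simps)
  qed
  then show "\<exists>L. \<forall>x y. norm x \<le> R \<longrightarrow> norm y \<le> R \<longrightarrow> norm (rbo_field s x - rbo_field s y) \<le> L * norm (x - y)"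
    by blast
qed

end

text \<open>An inequality of Brezis-Gallouet type. Every amplitude x is estimated by x <= c x^2 / 2
  + 1 / (2 c), with c = 1 + |k| for |k| <= N and c = \<open>(wt s k)\<^sup>2 / real N\<close>
  beyond. The low range costs half the energy and a harmonic sum of order ln N. The high range costs
  half of |b|^2 / N and half of a convergent series, so N is taken near |b|^2.\<close>

lemma wiener_le_log:
  assumes s: "3 / 2 \<le> s"
  shows "wiener s b \<le> 2 + zeta_int / 2 + energy s b / 2 + ln (3 + (norm b)\<^sup>2)"
proof (rule wiener_leI)
  show s1: "1 \<le> s"
    using s by simp
  \<comment> \<open>Adding 1 makes N positive, and N + 1 is still at most 3 + |b|^2, the argument of
    the logarithm.\<close>
  define N where "N = nat \<lceil>(norm b)\<^sup>2\<rceil> + 1"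
  have N: "(norm b)\<^sup>2 \<le> real N" "real N \<le> (norm b)\<^sup>2 + 2" "1 \<le> N"
  proof -
    have "real N = real_of_int \<lceil>(norm b)\<^sup>2\<rceil> + 1"
      by (simp add: N_def of_nat_nat)
    then show "(norm b)\<^sup>2 \<le> real N" "real N \<le> (norm b)\<^sup>2 + 2"
      using ceiling_correct[of "(norm b)\<^sup>2"] by linarith+
  qed (simp add: N_def)
  \<comment> \<open>One bound valid for all k permits a single summation; h restricts the harmonic
    terms to the low range.\<close>
  define h where "h k = (if \<bar>k\<bar> \<le> int N then 1 / (1 + \<bar>real_of_int k\<bar>) else 0)" for k
  have bound: "norm (amp s b k) \<le> (1 + \<bar>real_of_int k\<bar>) * (norm (amp s b k))\<^sup>2 / 2 + (norm (coef b k))\<^sup>2 / real N / 2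
      + 1 / (1 + (real_of_int k)\<^sup>2) / 2 + h k / 2" for k
  proof -
    have amgm: "x \<le> c * x\<^sup>2 / 2 + 1 / c / 2" if "0 < c" for x c :: real
    proof -
      have "0 \<le> (c * x - 1)\<^sup>2 / c"
        using that by (intro divide_nonneg_pos) auto
      then show ?thesis
        using that by (simp add: power2_diff power_mult_distrib field_simps power2_eq_square)
    qed
    show ?thesis
    proof (cases "\<bar>k\<bar> \<le> int N")
      case True
      have "norm (amp s b k) \<le> (1 + \<bar>real_of_int k\<bar>) * (norm (amp s b k))\<^sup>2 / 2 + 1 / (1 + \<bar>real_of_int k\<bar>) / 2"
        by (rule amgm) simp
      moreover have "0 \<le> (norm (coef b k))\<^sup>2 / real N / 2" "0 \<le> 1 / (1 + (real_of_int k)\<^sup>2) / 2"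
        by (simp_all add: less_imp_le)
      ultimately show ?thesis
        using True unfolding h_def by (simp only: if_True)
    next
      case False
      \<comment> \<open>For |k| > N the squared weight is at least N (1 + k^2), so that 1 / c stays
        below the summable 1 / (1 + k^2). This is where 3/2 \<le> s enters.\<close>
      have "real N * (1 + (real_of_int k)\<^sup>2) \<le> \<bar>real_of_int k\<bar> * (1 + (real_of_int k)\<^sup>2)"
        using False by (intro mult_right_mono) auto
      also have "\<dots> \<le> (1 + (real_of_int k)\<^sup>2) powr (1 / 2) * (1 + (real_of_int k)\<^sup>2)"
        by (intro mult_right_mono) (simp_all add: powr_half_sqrt real_le_rsqrt)
      also have "\<dots> = (1 + (real_of_int k)\<^sup>2) powr (3 / 2)"
        using powr_add[of "1 + (real_of_int k)\<^sup>2" "1 / 2" 1] by simp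
      also have "\<dots> \<le> (wt s k)\<^sup>2"
        unfolding wt_square using s by (intro powr_mono) auto
      finally have "1 / ((wt s k)\<^sup>2 / real N) \<le> 1 / (1 + (real_of_int k)\<^sup>2)"
        using N(3) by (intro frac_le) (auto simp: field_simps)
      moreover have "norm (amp s b k) \<le> (wt s k)\<^sup>2 / real N * (norm (amp s b k))\<^sup>2 / 2 + 1 / ((wt s k)\<^sup>2 / real N) / 2"
        using N(3) by (intro amgm) auto
      then have "norm (amp s b k) \<le> (norm (coef b k))\<^sup>2 / real N / 2 + 1 / ((wt s k)\<^sup>2 / real N) / 2"
        by (simp only: norm_coef_eq_amp[of b k s] power_mult_distrib times_divide_eq_left)
      moreover have "0 \<le> (1 + \<bar>real_of_int k\<bar>) * (norm (amp s b k))\<^sup>2"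
        by simp
      moreover have "X \<le> P / 2 + Y / 2 + Z / 2 + 0 / 2" if "u \<le> Z" "X \<le> Y / 2 + u / 2" "0 \<le> P" for X P Y Z u :: real
        using that by linarith
      ultimately show ?thesis
        unfolding h_def if_not_P[OF False] by blast
    qed
  qed
  fix S :: "int set" assume S: "finite S"
  have "(\<Sum>k\<in>S. norm (amp s b k)) \<le> (\<Sum>k\<in>S. (1 + \<bar>real_of_int k\<bar>) * (norm (amp s b k))\<^sup>2 / 2 + (norm (coef b k))\<^sup>2 / real N / 2
      + 1 / (1 + (real_of_int k)\<^sup>2) / 2 + h k / 2)"
    by (intro sum_mono bound)
  also have "\<dots> = (\<Sum>k\<in>S. (1 + \<bar>real_of_int k\<bar>) * (norm (amp s b k))\<^sup>2) / 2 + (\<Sum>k\<in>S. (norm (coef b k))\<^sup>2) / real N / 2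
      + (\<Sum>k\<in>S. 1 / (1 + (real_of_int k)\<^sup>2)) / 2 + sum h S / 2"
    by (simp only: sum.distrib sum_divide_distrib)
  also have "\<dots> \<le> energy s b / 2 + 1 / 2 + zeta_int / 2 + (2 + 2 * ln (real N + 1)) / 2"
  proof (intro add_mono divide_right_mono)
    show "(\<Sum>k\<in>S. (norm (coef b k))\<^sup>2) / real N \<le> 1"
      using N sum_coef_square_le[OF S, of b] by (simp add: divide_le_eq)
    have "sum h S \<le> sum h (S \<union> {- int N..int N})"
      using S by (intro sum_mono2) (auto simp: h_def)
    also have "\<dots> = sum h {- int N..int N}"
      using S by (intro sum.mono_neutral_right) (auto simp: h_def)
    also have "\<dots> = (\<Sum>k\<in>{- int N..int N}. 1 / (1 + \<bar>real_of_int k\<bar>))"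
      by (intro sum.cong) (auto simp: h_def)
    finally show "sum h S \<le> 2 + 2 * ln (real N + 1)"
      using sum_real_of_int_interval_le[of N] by linarith
  qed (auto intro!: sum_energy_le sum_inverse_square_le S s1)
  finally have "(\<Sum>k\<in>S. norm (amp s b k)) \<le> energy s b / 2 + 1 / 2 + zeta_int / 2 + (2 + 2 * ln (real N + 1)) / 2" .
  moreover have "ln (real N + 1) \<le> ln (3 + (norm b)\<^sup>2)"
    using N by (subst ln_le_cancel_iff) auto
  moreover have "x \<le> 2 + z / 2 + y / 2 + v" if "x \<le> y / 2 + 1 / 2 + z / 2 + (2 + 2 * u) / 2" "u \<le> v" for x y z u v :: real
    using that by argo
  ultimately show "(\<Sum>k\<in>S. norm (amp s b k)) \<le> 2 + zeta_int / 2 + energy s b / 2 + ln (3 + (norm b)\<^sup>2)"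
    by blast
qed

text \<open>With y the square of the norm, ln (3 + y) satisfies a linear differential inequality.\<close>

lemma rbo_field_apriori:
  assumes s: "3 / 2 \<le> s" and sg: "\<bar>\<sigma>\<bar> \<le> 1"
  shows "apriori_bounded (\<lambda>b. \<sigma> *\<^sub>R rbo_field s b)"
  unfolding apriori_bounded_def
proof (intro allI)
  fix r T :: real
  have s1: "1 \<le> s" using s by simp
  \<comment> \<open>The constants of \<open>wiener_le_log\<close>, with the energy replaced by its
    bound 2 r^2.\<close>
  define A where "A = 2 + zeta_int / 2 + r\<^sup>2"
  define D where "D = 2 * 2 powr s"
  \<comment> \<open>M will bound ln (3 + |x|^2), which explains the witness
    \<open>sqrt (exp M)\<close>.\<close>
  define M where "M = exp (D * \<bar>T\<bar>) * (A + 1 + ln (3 + r\<^sup>2))"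
  \<comment> \<open>Lets the 1 coming from the linear part be absorbed: 1 + 2^s W <= 2^s (1 +
    W).\<close>
  have p1: "1 \<le> 2 powr s"
    using s by (intro ge_one_powr_ge_zero) auto
  have "0 \<le> A"
    by (simp add: A_def zeta_int_nonneg)
  show "\<exists>M. \<forall>x l. norm (x 0) \<le> r \<longrightarrow>
     (\<forall>t\<in>{0..T}. 0 \<le> l t \<and> l t \<le> 1 \<and>
        (x has_vector_derivative \<sigma> *\<^sub>R rbo_field s (l t *\<^sub>R x t)) (at t within {0..T})) \<longrightarrow>
     (\<forall>t\<in>{0..T}. norm (x t) \<le> M)"
  proof (intro exI[of _ "sqrt (exp M)"] allI impI ballI)
    fix x :: "real \<Rightarrow> hl2" and l t
    assume x0: "norm (x 0) \<le> r" and t: "t \<in> {0..T}"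
      and sol: "\<forall>t\<in>{0..T}. 0 \<le> l t \<and> l t \<le> 1 \<and>
        (x has_vector_derivative \<sigma> *\<^sub>R rbo_field s (l t *\<^sub>R x t)) (at t within {0..T})"
    define x' where "x' u = \<sigma> *\<^sub>R rbo_field s (l u *\<^sub>R x u)" for u
    have l: "\<bar>l u\<bar> \<le> 1" if "u \<in> {0..T}" for u
      using sol that by auto
    have der: "(x has_vector_derivative x' u) (at u within {0..S})" if "u \<in> {0..S}" "S \<le> T" for u S
      using sol that unfolding x'_def
      by (auto intro!: has_vector_derivative_within_subset[where T = "{0..S}" and S = "{0..T}"])
    have r2: "(norm (x 0))\<^sup>2 \<le> r\<^sup>2"
      using x0 by (intro power_mono) auto
    \<comment> \<open>By \<open>energy_orthogonal\<close> with r = \<open>l v\<close> the derivative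
      of the energy is 0 for the truncated field as well; Gronwall is used with rate 0.\<close>
    have energy: "energy s (x u) \<le> 2 * r\<^sup>2" if u: "u \<in> {0..T}" for u
    proof -
      have "energy s (x u) \<le> exp (0 * u) * energy s (x 0)"
      proof (rule gronwall[where y' = "\<lambda>_. 0"])
        fix v assume v: "v \<in> {0..u}"
        have "((\<lambda>v. energy_op s (x v)) has_vector_derivative energy_op s (x' v)) (at v within {0..u})"
          using der v u by (intro bounded_linear.has_vector_derivative[OF bounded_linear_energy_op[OF s1]]) auto
        then have "((\<lambda>v. energy_op s (x v) \<bullet> x v) has_vector_derivative
            (energy_op s (x v) \<bullet> x' v + energy_op s (x' v) \<bullet> x v)) (at v within {0..u})"
          using der v u by (intro has_vector_derivative_inner) auto
        then show "((\<lambda>v. energy s (x v)) has_vector_derivative 0) (at v within {0..u})"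
          unfolding energy_op_commute[OF s1, of "x' v"] energy_def
          by (simp add: x'_def energy_orthogonal[OF s1])
      qed (use u in auto)
      also have "\<dots> \<le> 2 * r\<^sup>2"
        using energy_le[OF s1, of "x 0"] r2 by simp
      finally show ?thesis .
    qed
    define y where "y u = x u \<bullet> x u" for u
    \<comment> \<open>z dominates 1 + W, and y' <= D z y gives z' = y' / (3 + y) <= D z.\<close>
    define z where "z u = A + 1 + ln (3 + y u)" for u
    have y_pos: "0 < 3 + y u" "0 \<le> y u" for u
      using inner_ge_zero[of "x u"] unfolding y_def by linarith+
    have "z t \<le> exp (D * t) * z 0"
    proof (rule gronwall)
      fix u assume u: "u \<in> {0..t}"
      have "(y has_vector_derivative 2 * (x u \<bullet> x' u)) (at u within {0..t})"
        unfolding y_def using has_vector_derivative_inner[OF der[of u t] der[of u t]] u t by (simp add: inner_commute)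
      then have "(y has_real_derivative 2 * (x u \<bullet> x' u)) (at u within {0..t})"
        by (simp add: has_real_derivative_iff_has_vector_derivative)
      then have "(z has_real_derivative 2 * (x u \<bullet> x' u) / (3 + y u)) (at u within {0..t})"
        unfolding z_def using y_pos[of u] by (auto intro!: derivative_eq_intros simp: field_simps)
      then show "(z has_vector_derivative 2 * (x u \<bullet> x' u) / (3 + y u)) (at u within {0..t})"
        by (simp add: has_real_derivative_iff_has_vector_derivative)
      have "wiener s (x u) \<le> A + ln (3 + y u)"
        using wiener_le_log[OF s, of "x u"] energy[of u] u t
        by (simp add: A_def y_def power2_norm_eq_inner)
      then have "2 powr s * wiener s (x u) \<le> 2 powr s * (A + ln (3 + y u))"
        by (intro mult_left_mono) auto
      then have W: "1 + 2 powr s * wiener s (x u) \<le> 2 powr s * z u"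
        using p1 by (simp add: z_def algebra_simps)
      have "x u \<bullet> x' u \<le> norm (x u) * norm (x' u)"
        by (rule norm_cauchy_schwarz)
      also have "norm (x' u) \<le> norm (rbo_field s (l u *\<^sub>R x u))"
        unfolding x'_def using sg by (simp add: mult_left_le_one_le)
      also have "\<dots> \<le> (1 + 2 powr s * wiener s (x u)) * norm (x u)"
        using u t by (intro norm_field_le[OF s1] l) auto
      also have "\<dots> \<le> (2 powr s * z u) * norm (x u)"
        by (intro mult_right_mono W) auto
      finally have "x u \<bullet> x' u \<le> norm (x u) * ((2 powr s * z u) * norm (x u))"
        by (simp add: mult_left_mono)
      also have "\<dots> = 2 powr s * z u * y u"
        by (simp add: y_def power2_norm_eq_inner[symmetric] power2_eq_square)
      also have "\<dots> \<le> 2 powr s * z u * (3 + y u)"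
        using y_pos[of u] \<open>0 \<le> A\<close> by (intro mult_left_mono) (auto simp: z_def)
      finally show "2 * (x u \<bullet> x' u) / (3 + y u) \<le> D * z u"
        using y_pos[of u] by (simp add: divide_le_eq D_def mult_ac)
    qed (use t in auto)
    also have "\<dots> \<le> exp (D * \<bar>T\<bar>) * z 0"
      using t y_pos[of 0] \<open>0 \<le> A\<close> by (intro mult_right_mono) (auto simp: D_def z_def)
    also have "\<dots> \<le> M"
      unfolding M_def z_def using r2 y_pos[of 0]
      by (intro mult_left_mono add_left_mono) (auto simp: y_def power2_norm_eq_inner)
    finally have "ln (3 + y t) \<le> M"
      using \<open>0 \<le> A\<close> by (simp add: z_def)
    then have "3 + y t \<le> exp M"
      using y_pos(1)[of t] by (metis exp_le_cancel_iff exp_ln)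
    then have "(norm (x t))\<^sup>2 \<le> exp M"
      by (simp add: y_def power2_norm_eq_inner)
    then show "norm (x t) \<le> sqrt (exp M)"
      by (rule real_le_rsqrt)
  qed
qed

lemma rbo_field_scaled_lipschitz:
  assumes "1 \<le> s" "\<bar>\<sigma>\<bar> \<le> 1"
  shows "lipschitz_on_balls (\<lambda>b. \<sigma> *\<^sub>R rbo_field s b)"
  unfolding lipschitz_on_balls_def
proof
  fix R
  obtain L where L: "\<And>x y. norm x \<le> R \<Longrightarrow> norm y \<le> R \<Longrightarrow> norm (rbo_field s x - rbo_field s y) \<le> L * norm (x - y)"
    using rbo_field_lipschitz[OF assms(1)] unfolding lipschitz_on_balls_def by metis
  have "norm (\<sigma> *\<^sub>R rbo_field s x - \<sigma> *\<^sub>R rbo_field s y) \<le> norm (rbo_field s x - rbo_field s y)" for x y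
    using assms(2) by (simp add: mult_left_le_one_le flip: scaleR_diff_right)
  then show "\<exists>L. \<forall>x y. norm x \<le> R \<longrightarrow> norm y \<le> R \<longrightarrow>
      norm (\<sigma> *\<^sub>R rbo_field s x - \<sigma> *\<^sub>R rbo_field s y) \<le> L * norm (x - y)"
    using L order_trans by blast
qed

section \<open>Fourier coefficients determine continuous functions\<close>

definition fc :: "(real \<Rightarrow> complex) \<Rightarrow> int \<Rightarrow> complex" where
  "fc f k = integral {-pi..pi} (\<lambda>x. f x * cis (- (of_int k * x))) / of_real (2 * pi)"

lemma has_vector_derivative_cis_mult:
  "((\<lambda>x. cis (c * x)) has_vector_derivative c *\<^sub>R (\<i> * cis (c * x))) (at x within S)"
proof -
  have "((\<lambda>z. exp (\<i> * (of_real c * z))) has_field_derivative of_real c * (\<i> * exp (\<i> * (of_real c * of_real x)))) (at (of_real x))"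
    by (auto intro!: derivative_eq_intros)
  from has_vector_derivative_real_field[OF this] show ?thesis
    by (simp add: cis_conv_exp scaleR_conv_of_real)
qed

lemma has_integral_cis:
  "((\<lambda>x. cis (of_int n * x)) has_integral (if n = 0 then of_real (2 * pi) else 0)) {-pi..pi}"
proof (cases "n = 0")
  case True
  have "((\<lambda>x. 1 :: complex) has_integral of_real (2 * pi)) {-pi..pi}"
    using has_integral_const_real[of "1 :: complex" "-pi" pi] pi_ge_zero by (simp add: scaleR_conv_of_real)
  then show ?thesis
    using True by simp
next
  case False
  have "((\<lambda>x. cis (of_int n * x)) has_integral
      (cis (of_int n * pi) / (\<i> * of_int n) - cis (of_int n * (- pi)) / (\<i> * of_int n))) {-pi..pi}"
  proof (rule fundamental_theorem_of_calculus)
    fix x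
    have "((\<lambda>x. 1 / (\<i> * of_int n) * cis (of_int n * x)) has_vector_derivative
        1 / (\<i> * of_int n) * (of_int n *\<^sub>R (\<i> * cis (of_int n * x)))) (at x within {-pi..pi})"
      by (intro has_vector_derivative_mult_right has_vector_derivative_cis_mult)
    then show "((\<lambda>x. cis (of_int n * x) / (\<i> * of_int n)) has_vector_derivative cis (of_int n * x)) (at x within {-pi..pi})"
      using False by (simp add: scaleR_conv_of_real)
  qed (use pi_ge_zero in linarith)
  moreover have "cis (of_int n * (- pi)) = cis (of_int n * pi)"
    using sin_zero_iff_int2[of "of_int n * pi"] by (simp add: complex_eq_iff)
  ultimately show ?thesis
    using False by simp
qed

lemma cis_mult_index: "cis (of_int j * x) * cis (of_int k * x) = cis (of_int (j + k) * x)"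
  by (simp add: cis_mult distrib_right)

lemma fc_integrable: "continuous_on {-pi..pi} f \<Longrightarrow> (\<lambda>x. f x * cis (- (of_int k * x))) integrable_on {-pi..pi}"
  by (intro integrable_continuous_interval continuous_intros)

lemma fc_has_integral:
  "continuous_on {-pi..pi} f \<Longrightarrow>
   ((\<lambda>x. f x * cis (- (of_int k * x))) has_integral (of_real (2 * pi) * fc f k)) {-pi..pi}"
  using fc_integrable[of f k] by (simp add: fc_def has_integral_integral)

lemma fc_eqI:
  "((\<lambda>x. f x * cis (- (of_int k * x))) has_integral (of_real (2 * pi) * c)) {-pi..pi} \<Longrightarrow> fc f k = c"
  by (simp add: fc_def integral_unique)

lemma fc_cmult: "continuous_on {-pi..pi} f \<Longrightarrow> fc (\<lambda>x. c * f x) k = c * fc f k"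
  using has_integral_mult_right[OF fc_has_integral[of f k], of c] by (intro fc_eqI) (simp add: mult_ac)

lemma fc_diff:
  "continuous_on {-pi..pi} f \<Longrightarrow> continuous_on {-pi..pi} g \<Longrightarrow> fc (\<lambda>x. f x - g x) k = fc f k - fc g k"
  by (rule fc_eqI) (simp only: left_diff_distrib right_diff_distrib has_integral_diff fc_has_integral)

lemma fc_cis: "fc (\<lambda>x. cis (of_int n * x)) k = (if k = n then 1 else 0)"
proof (rule fc_eqI)
  have "cis (of_int n * x) * cis (- (of_int k * x)) = cis (of_int (n - k) * x)" for x
    by (simp add: cis_mult algebra_simps)
  then show "((\<lambda>x. cis (of_int n * x) * cis (- (of_int k * x))) has_integral of_real (2 * pi) * (if k = n then 1 else 0)) {-pi..pi}"
    using has_integral_cis[of "n - k"] by (auto split: if_splits)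
qed

lemma fc_cis_shift: "fc (\<lambda>x. f x * cis (of_int n * x)) k = fc f (k - n)"
  unfolding fc_def by (simp add: mult.assoc cis_mult algebra_simps)

lemma fc_const: "fc (\<lambda>x. c) k = (if k = 0 then c else 0)"
  using fc_cmult[of "\<lambda>x. cis (of_int 0 * x)" c k] fc_cis[of 0 k] by (auto simp: continuous_intros)

lemma norm_fc_le:
  assumes "\<And>x. x \<in> {-pi..pi} \<Longrightarrow> norm (f x) \<le> C" "continuous_on {-pi..pi} f"
  shows "norm (fc f k) \<le> C"
proof -
  have "norm (integral {-pi..pi} (\<lambda>x. f x * cis (- (of_int k * x)))) \<le> C * (pi - - pi)"
    by (rule integral_bound) (use assms pi_ge_zero in \<open>auto simp: norm_mult intro!: continuous_intros\<close>)
  then show ?thesis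
    by (simp add: fc_def norm_divide divide_le_eq norm_mult)
qed

text \<open>With S the partial sum over K, the integral of |g - S|^2 is nonnegative, and g cnj S, S
  cnj g and S cnj S all have the same integral.\<close>

lemma bessel_inequality:
  assumes g: "continuous_on {-pi..pi} g" and "finite K"
  shows "2 * pi * (\<Sum>k\<in>K. (norm (fc g k))\<^sup>2) \<le> integral {-pi..pi} (\<lambda>x. (norm (g x))\<^sup>2)"
proof -
  define S where "S x = (\<Sum>k\<in>K. fc g k * cis (of_int k * x))" for x
  have S: "continuous_on {-pi..pi} S"
    unfolding S_def by (intro continuous_intros)
  let ?q = "complex_of_real (2 * pi * (\<Sum>k\<in>K. (norm (fc g k))\<^sup>2))"
  have q: "?q = (\<Sum>k\<in>K. cnj (fc g k) * (of_real (2 * pi) * fc g k))"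
    unfolding sum_distrib_left of_real_sum by (intro sum.cong refl) (simp only: of_real_mult complex_norm_square mult_ac)
  have gS: "((\<lambda>x. g x * cnj (S x)) has_integral ?q) {-pi..pi}"
  proof -
    have "((\<lambda>x. \<Sum>k\<in>K. cnj (fc g k) * (g x * cis (- (of_int k * x)))) has_integral ?q) {-pi..pi}"
      unfolding q by (intro has_integral_sum \<open>finite K\<close> has_integral_mult_right fc_has_integral g)
    then show ?thesis
      by (simp add: S_def sum_distrib_left cis_cnj mult_ac)
  qed
  have fcS: "fc S k = (if k \<in> K then fc g k else 0)" for k
  proof -
    have "((\<lambda>x. \<Sum>j\<in>K. fc g j * (cis (of_int j * x) * cis (- (of_int k * x)))) has_integral
        (\<Sum>j\<in>K. fc g j * (of_real (2 * pi) * fc (\<lambda>x. cis (of_int j * x)) k))) {-pi..pi}"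
      by (intro has_integral_sum \<open>finite K\<close> has_integral_mult_right fc_has_integral continuous_intros)
    also have "(\<Sum>j\<in>K. fc g j * (of_real (2 * pi) * fc (\<lambda>x. cis (of_int j * x)) k)) = of_real (2 * pi) * (if k \<in> K then fc g k else 0)"
      using \<open>finite K\<close> by (simp add: fc_cis if_distrib sum.delta' cong: if_cong)
    finally show ?thesis
      by (intro fc_eqI) (simp add: S_def sum_distrib_right mult.assoc)
  qed
  have SS: "((\<lambda>x. S x * cnj (S x)) has_integral ?q) {-pi..pi}"
  proof -
    have "((\<lambda>x. \<Sum>k\<in>K. cnj (fc g k) * (S x * cis (- (of_int k * x)))) has_integral
        (\<Sum>k\<in>K. cnj (fc g k) * (of_real (2 * pi) * fc S k))) {-pi..pi}"
      by (intro has_integral_sum \<open>finite K\<close> has_integral_mult_right fc_has_integral S)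
    also have "(\<Sum>k\<in>K. cnj (fc g k) * (of_real (2 * pi) * fc S k)) = ?q"
      unfolding q by (intro sum.cong) (auto simp: fcS)
    also have "(\<lambda>x. \<Sum>k\<in>K. cnj (fc g k) * (S x * cis (- (of_int k * x)))) = (\<lambda>x. S x * cnj (S x))"
      unfolding S_def by (simp add: sum_distrib_left cis_cnj mult_ac)
    finally show ?thesis .
  qed
  have Sg: "((\<lambda>x. S x * cnj (g x)) has_integral ?q) {-pi..pi}"
    using has_integral_cnj[THEN iffD2, OF gS] by (simp add: o_def mult.commute)
  have "((\<lambda>x. g x * cnj (g x)) has_integral integral {-pi..pi} (\<lambda>x. g x * cnj (g x))) {-pi..pi}"
    by (intro integrable_integral integrable_continuous_interval continuous_intros g)
  from has_integral_add[OF has_integral_diff[OF has_integral_diff[OF this gS] Sg] SS]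
  have "((\<lambda>x. (g x - S x) * cnj (g x - S x)) has_integral (integral {-pi..pi} (\<lambda>x. g x * cnj (g x)) - ?q)) {-pi..pi}"
    by (simp add: algebra_simps)
  then have "((\<lambda>x. Re ((g x - S x) * cnj (g x - S x))) has_integral Re (integral {-pi..pi} (\<lambda>x. g x * cnj (g x)) - ?q)) {-pi..pi}"
    by (rule has_integral_Re)
  then have "0 \<le> Re (integral {-pi..pi} (\<lambda>x. g x * cnj (g x)) - ?q)"
    by (rule has_integral_nonneg) (simp only: complex_norm_square[symmetric] Re_complex_of_real zero_le_power2)
  moreover have "Re (integral {-pi..pi} (\<lambda>x. g x * cnj (g x))) = integral {-pi..pi} (\<lambda>x. Re (g x * cnj (g x)))"
    by (intro integral_unique[symmetric] has_integral_Re integrable_integral integrable_continuous_interval continuous_intros g)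
  moreover have "Re (g x * cnj (g x)) = (norm (g x))\<^sup>2" for x
    by (simp only: complex_norm_square[symmetric] Re_complex_of_real)
  ultimately show ?thesis
    by simp
qed

lemma has_vector_derivative_imp_quotient_tendsto:
  fixes f :: "real \<Rightarrow> complex"
  assumes "(f has_vector_derivative f') (at x)"
  shows "((\<lambda>y. (f y - f x) / of_real (y - x)) \<longlongrightarrow> f') (at x)"
proof -
  have "((\<lambda>y. norm ((f y - f x) - (y - x) *\<^sub>R f') / norm (y - x)) \<longlongrightarrow> 0) (at x)"
    using assms unfolding has_vector_derivative_def has_derivative_iff_norm by simp
  then have "((\<lambda>y. norm ((f y - f x) / of_real (y - x) - f')) \<longlongrightarrow> 0) (at x)"
  proof (rule Lim_transform_eventually)
    show "\<forall>\<^sub>F y in at x. norm ((f y - f x) - (y - x) *\<^sub>R f') / norm (y - x) = norm ((f y - f x) / of_real (y - x) - f')"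
      using eventually_neq_at_within[of x x UNIV]
    proof eventually_elim
      case (elim y)
      have "(f y - f x) / of_real (y - x) - f' = ((f y - f x) - (y - x) *\<^sub>R f') / of_real (y - x)"
        using elim by (simp add: scaleR_conv_of_real diff_divide_distrib del: of_real_diff)
      then show ?case
        by (simp only: norm_divide norm_of_real real_norm_def)
    qed
  qed
  then show ?thesis
    by (simp add: tendsto_norm_zero_iff LIM_zero_iff)
qed

lemma cis_eq_1_iff_small:
  assumes "\<bar>t\<bar> < 2 * pi"
  shows "cis t = 1 \<longleftrightarrow> t = 0"
proof
  assume "cis t = 1"
  then have "cos t = 1"
    by (simp add: complex_eq_iff)
  then obtain n :: int where n: "t = of_int n * 2 * pi"
    by (auto simp: cos_one_2pi_int)
  then have "\<bar>of_int n\<bar> * (2 * pi) < 1 * (2 * pi)"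
    using assms by (simp add: abs_mult)
  then have "\<bar>real_of_int n\<bar> < 1"
    by (subst (asm) mult_less_cancel_right_pos) auto
  then show "t = 0"
    using n by simp
qed simp

text \<open>Chernoff's argument: g = (f - f(x)) / (cis(. - x) - 1) is continuous, and the coefficients of
  f - f(x) are differences of consecutive coefficients of g, so those of g have constant modulus on
  each side of 0, which Bessel's inequality only allows if they vanish.\<close>

lemma zero_if_fc_zero_differentiable:
  fixes f :: "real \<Rightarrow> complex"
  assumes f: "continuous_on {-pi..pi} f" and zero: "\<And>k. fc f k = 0"
    and x0: "-pi < x0" "x0 < pi" and der: "(f has_vector_derivative f') (at x0)"
  shows "f x0 = 0"
proof -
  \<comment> \<open>The value at x0 is the limit of the quotient, the derivative of the denominator
    there being i; the differentiability of f enters here.\<close>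
  define g where "g x = (if x = x0 then f' / \<i> else (f x - f x0) / (cis (x - x0) - 1))" for x
  \<comment> \<open>x0 is interior, so |x - x0| stays below a full period and x0 is the only zero of
    the denominator.\<close>
  have ne: "cis (x - x0) - 1 \<noteq> 0" if "x \<in> {-pi..pi}" "x \<noteq> x0" for x
  proof -
    have "\<bar>x - x0\<bar> < 2 * pi"
      using that x0 by (simp add: abs_less_iff)
    then show ?thesis
      using cis_eq_1_iff_small[of "x - x0"] that by simp
  qed
  have g: "continuous_on {-pi..pi} g"
    unfolding continuous_on_def
  proof
    fix x assume x: "x \<in> {-pi..pi}"
    show "(g \<longlongrightarrow> g x) (at x within {-pi..pi})"
    proof (cases "x = x0")
      case True
      have "((\<lambda>y. cis (- x0) * cis (1 * y)) has_vector_derivative cis (- x0) * (1 *\<^sub>R (\<i> * cis (1 * x0)))) (at x0)"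
        by (intro has_vector_derivative_mult_right has_vector_derivative_cis_mult)
      then have "((\<lambda>y. cis (y - x0)) has_vector_derivative \<i>) (at x0)"
        by (simp add: cis_mult mult.left_commute[of "cis (- x0)"])
      from has_vector_derivative_imp_quotient_tendsto[OF this]
      have "((\<lambda>y. ((f y - f x0) / of_real (y - x0)) / ((cis (y - x0) - 1) / of_real (y - x0))) \<longlongrightarrow> f' / \<i>) (at x0)"
        by (intro tendsto_divide has_vector_derivative_imp_quotient_tendsto[OF der]) auto
      then have "(g \<longlongrightarrow> f' / \<i>) (at x0)"
      proof (rule Lim_transform_eventually)
        show "\<forall>\<^sub>F y in at x0. ((f y - f x0) / of_real (y - x0)) / ((cis (y - x0) - 1) / of_real (y - x0)) = g y"
          using eventually_neq_at_within[of x0 x0 UNIV] by eventually_elim (simp add: g_def del: of_real_diff)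
      qed
      then show ?thesis
        using True by (auto simp: g_def intro: tendsto_within_subset)
    next
      case False
      have "continuous_on {-pi..pi} (\<lambda>x. cis (x - x0))"
        by (intro continuous_intros)
      then have "((\<lambda>x. (f x - f x0) / (cis (x - x0) - 1)) \<longlongrightarrow> (f x - f x0) / (cis (x - x0) - 1)) (at x within {-pi..pi})"
        using f x ne[OF x False] unfolding continuous_on_def
        by (intro tendsto_divide tendsto_diff tendsto_const) auto
      then have "(g \<longlongrightarrow> (f x - f x0) / (cis (x - x0) - 1)) (at x within {-pi..pi})"
      proof (rule Lim_transform_eventually)
        show "\<forall>\<^sub>F y in at x within {-pi..pi}. (f y - f x0) / (cis (y - x0) - 1) = g y"
          using tendsto_imp_eventually_ne[OF tendsto_ident_at False] by eventually_elim (simp add: g_def)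
      qed
      then show ?thesis
        using False by (simp add: g_def)
    qed
  qed
  have gc: "continuous_on {-pi..pi} (\<lambda>x. cis (- x0) * (g x * cis (of_int 1 * x)))"
    by (intro continuous_intros g)
  have "f x - f x0 = cis (- x0) * (g x * cis (of_int 1 * x)) - g x" if "x \<in> {-pi..pi}" for x
  proof (cases "x = x0")
    case True
    then show ?thesis
      by (simp add: mult.left_commute[of "cis (- x0)"] cis_mult)
  next
    case False
    then have "f x - f x0 = g x * (cis (x - x0) - 1)"
      using ne[OF that False] by (simp add: g_def)
    also have "cis (x - x0) = cis (- x0) * cis x"
      by (simp add: cis_mult)
    finally show ?thesis
      by (simp add: algebra_simps)
  qed
  then have "fc (\<lambda>x. f x - f x0) k = fc (\<lambda>x. cis (- x0) * (g x * cis (of_int 1 * x)) - g x) k" for k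
    unfolding fc_def by (intro arg_cong2[of _ _ _ _ "(/)"] integral_cong) auto
  also have "\<dots> k = cis (- x0) * fc g (k - 1) - fc g k" for k
    using fc_diff[OF gc g, of k] fc_cmult[of "\<lambda>x. g x * cis (of_int 1 * x)" "cis (- x0)" k] fc_cis_shift[of g 1 k] g
    by (auto simp: continuous_intros)
  \<comment> \<open>The recursion is homogeneous except at k = 0. Hence the moduli are constant on k
    >= 0 and on k <= -1, and the equation at k = 0 yields f x0 = 0 once both constants are known to
    vanish.\<close>
  finally have rec: "cis (- x0) * fc g (k - 1) - fc g k = (if k = 0 then - f x0 else 0)" for k
    using fc_diff[OF f, of "\<lambda>_. f x0" k] zero[of k] fc_const[of "f x0" k] by auto
  have pos: "norm (fc g (int n)) = norm (fc g 0)" for n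
  proof (induction n)
    case (Suc n)
    have "fc g (int (Suc n)) = cis (- x0) * fc g (int n)"
      using rec[of "int (Suc n)"] by simp
    then show ?case
      using Suc by (simp add: norm_mult)
  qed simp
  have neg: "norm (fc g (- 1 - int n)) = norm (fc g (- 1))" for n
  proof (induction n)
    case (Suc n)
    have "fc g (- 1 - int n) = cis (- x0) * fc g (- 1 - int (Suc n))"
      using rec[of "- 1 - int n"] by (simp add: algebra_simps)
    then show ?case
      using Suc by (simp add: norm_mult)
  qed simp
  have const: "c = 0" if "inj h" "\<And>n. norm (fc g (h n)) = norm c" for c :: complex and h :: "nat \<Rightarrow> int"
  proof (rule ccontr)
    assume "c \<noteq> 0"
    define I where "I = integral {-pi..pi} (\<lambda>x. (norm (g x))\<^sup>2)"
    have "real n * (2 * pi * (norm c)\<^sup>2) \<le> I" for n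
      using bessel_inequality[OF g, of "h ` {..<n}"] that(2)
        sum.reindex[of h "{..<n}" "\<lambda>k. (norm (fc g k))\<^sup>2"] inj_on_subset[OF that(1)]
      by (auto simp: I_def mult_ac)
    moreover obtain n where "I / (2 * pi * (norm c)\<^sup>2) < real n"
      using reals_Archimedean2 by blast
    then have "I < real n * (2 * pi * (norm c)\<^sup>2)"
      using \<open>c \<noteq> 0\<close> by (simp add: divide_less_eq)
    ultimately show False
      by (meson not_less)
  qed
  have "fc g 0 = 0"
    by (rule const[of int]) (auto simp: pos)
  moreover have "fc g (- 1) = 0"
    by (rule const[of "\<lambda>n. - 1 - int n"]) (auto simp: neg inj_on_def)
  ultimately show ?thesis
    using rec[of 0] by simp
qed

text \<open>Differentiability is gained by passing to the antiderivative H, whose coefficients off 0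
  vanish after integration by parts. Minus its mean, H falls under the differentiable case, so H is
  constant and its derivative h is 0 inside the interval; continuity covers the endpoints.\<close>

lemma zero_if_fc_zero:
  fixes h :: "real \<Rightarrow> complex"
  assumes h: "continuous_on {-pi..pi} h" and zero: "\<And>k. fc h k = 0" and x: "x \<in> {-pi..pi}"
  shows "h x = 0"
proof -
  define H where "H x = integral {-pi..x} h" for x
  have H_der: "(H has_vector_derivative h x) (at x within {-pi..pi})" if "x \<in> {-pi..pi}" for x
    unfolding H_def by (rule integral_has_vector_derivative[OF h that])
  then have H: "continuous_on {-pi..pi} H"
    by (rule continuous_on_vector_derivative)
  \<comment> \<open>The zeroth coefficient of h makes H vanish at both ends, which removes the
    boundary terms below.\<close>
  have "H pi = 0" "H (- pi) = 0"
    using zero[of 0] by (auto simp: H_def fc_def)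
  have fcH: "fc H k = 0" if "k \<noteq> 0" for k
  proof (rule fc_eqI)
    have "((\<lambda>x. H x * (- \<i> * of_int k * cis (- (of_int k * x))) + h x * cis (- (of_int k * x))) has_integral
        (H pi * cis (- (of_int k * pi)) - H (- pi) * cis (- (of_int k * (- pi))))) {-pi..pi}"
    proof (rule fundamental_theorem_of_calculus)
      fix x assume x: "x \<in> {-pi..pi}"
      have "((\<lambda>x. cis (- (of_int k * x))) has_vector_derivative (- of_int k *\<^sub>R (\<i> * cis (- (of_int k * x))))) (at x within {-pi..pi})"
        using has_vector_derivative_cis_mult[of "- of_int k" x] by simp
      from has_vector_derivative_mult[OF H_der[OF x] this]
      show "((\<lambda>x. H x * cis (- (of_int k * x))) has_vector_derivative
          (H x * (- \<i> * of_int k * cis (- (of_int k * x))) + h x * cis (- (of_int k * x)))) (at x within {-pi..pi})"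
        by (simp add: scaleR_conv_of_real mult_ac)
    qed (use pi_ge_zero in linarith)
    from has_integral_diff[OF this fc_has_integral[OF h, of k]]
    have "((\<lambda>x. (- \<i> * of_int k) * (H x * cis (- (of_int k * x)))) has_integral 0) {-pi..pi}"
      by (simp add: \<open>H pi = 0\<close> \<open>H (- pi) = 0\<close> zero mult_ac)
    from has_integral_mult_right[OF this, of "1 / (- \<i> * of_int k)"]
    show "((\<lambda>x. H x * cis (- (of_int k * x))) has_integral (of_real (2 * pi) * 0)) {-pi..pi}"
      using that by (simp add: mult_ac)
  qed
  define G where "G x = H x - fc H 0" for x
  have G: "continuous_on {-pi..pi} G"
    unfolding G_def by (intro continuous_intros H)
  have "fc G k = 0" for k
    unfolding G_def using fc_diff[OF H, of "\<lambda>_. fc H 0" k] fcH[of k] by (auto simp: fc_const)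
  moreover have "(G has_vector_derivative h x) (at x)" if "-pi < x" "x < pi" for x
    unfolding G_def using H_der[of x] that at_within_Icc_at[of "-pi" x pi]
    by (auto intro!: derivative_eq_intros)
  ultimately have "G x = 0" if "-pi < x" "x < pi" for x
    using zero_if_fc_zero_differentiable[OF G] that by blast
  then have const: "H x = fc H 0" if "x \<in> {-pi<..<pi}" for x
    using that by (simp add: G_def)
  have h0: "h x = 0" if "x \<in> {-pi<..<pi}" for x
  proof -
    have "(H has_vector_derivative h x) (at x)"
      using H_der[of x] that at_within_Icc_at[of "-pi" x pi] by auto
    moreover have "(H has_vector_derivative 0) (at x)"
      by (rule has_vector_derivative_transform_within_open[OF has_vector_derivative_const, of "{-pi<..<pi}"])
        (use that const in auto)
    ultimately show ?thesis
      by (rule vector_derivative_unique_at)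
  qed
  have "closure {-pi<..<pi} = {-pi..pi}"
    using pi_gt_zero by (intro closure_greaterThanLessThan) linarith
  then show ?thesis
    using continuous_constant_on_closure[of "{-pi<..<pi}" h 0 x] h h0 x by auto
qed

definition periodic :: "(real \<Rightarrow> 'a) \<Rightarrow> bool" where
  "periodic f \<longleftrightarrow> (\<forall>x. f (x + 2 * pi) = f x)"

text \<open>The value c has arbitrary type, even that of truth values: \<open>test_bounded\<close>
  extends a bound from one period to the line in this way.\<close>

lemma periodic_eq_zeroI:
  assumes "periodic f" and zero: "\<And>x. x \<in> {-pi..pi} \<Longrightarrow> f x = c"
  shows "f x = c"
proof -
  have nat: "f (y + of_nat n * (2 * pi)) = f y" for n y
  proof (induction n)
    case (Suc n)
    have "f (y + of_nat (Suc n) * (2 * pi)) = f ((y + of_nat n * (2 * pi)) + 2 * pi)"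
      by (simp add: algebra_simps)
    then show ?case
      using Suc assms(1) by (simp add: periodic_def)
  qed simp
  have int: "f (y + of_int m * (2 * pi)) = f y" for m y
  proof (cases m)
    case (nonneg n)
    then show ?thesis
      using nat[of y n] by simp
  next
    case (neg n)
    then have m: "real_of_int m + real (Suc n) = 0"
      by simp
    have "y + of_int m * (2 * pi) + of_nat (Suc n) * (2 * pi) = y + (real_of_int m + real (Suc n)) * (2 * pi)"
      by (simp only: distrib_right add.assoc)
    also have "\<dots> = y"
      unfolding m by simp
    finally have eq: "y + of_int m * (2 * pi) + of_nat (Suc n) * (2 * pi) = y" .
    then show ?thesis
      using nat[of "y + of_int m * (2 * pi)" "Suc n"] unfolding eq by simp
  qed
  define m where "m = \<lfloor>(x + pi) / (2 * pi)\<rfloor>"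
  have "of_int m \<le> (x + pi) / (2 * pi)" "(x + pi) / (2 * pi) < of_int m + 1"
    unfolding m_def by linarith+
  then have "of_int m * (2 * pi) \<le> x + pi" "x + pi < (of_int m + 1) * (2 * pi)"
    using pi_gt_zero by (simp_all add: pos_le_divide_eq pos_divide_less_eq)
  then have "x - of_int m * (2 * pi) \<in> {-pi..pi}"
    by (auto simp: algebra_simps)
  then show ?thesis
    using zero int[of "x - of_int m * (2 * pi)" m] by simp
qed

corollary periodic_zero_if_fc_zero:
  assumes "continuous_on UNIV h" "periodic h" "\<And>k. fc h k = 0"
  shows "h x = 0"
proof (rule periodic_eq_zeroI[OF assms(2)])
  show "h x = 0" if "x \<in> {-pi..pi}" for x
    using zero_if_fc_zero[OF continuous_on_subset[OF assms(1)] assms(3) that] by simp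
qed

section \<open>Periodic distributions\<close>

definition trig :: "(int \<Rightarrow> complex) \<Rightarrow> real \<Rightarrow> complex" where
  "trig a x = (\<Sum>\<^sub>\<infinity>k. a k * cis (of_int k * x))"

lemma trig_abs_summable:
  "(\<lambda>k. norm (a k)) summable_on UNIV \<Longrightarrow> (\<lambda>k. norm (a k * cis (of_int k * x))) summable_on UNIV"
  by (simp add: norm_mult)

lemma trig_uniform_limit:
  "(\<lambda>k. norm (a k)) summable_on UNIV \<Longrightarrow>
   uniform_limit A (\<lambda>S x. \<Sum>k\<in>S. a k * cis (of_int k * x)) (trig a) (finite_subsets_at_top UNIV)"
  unfolding trig_def by (rule Weierstrass_m_test_general) (auto simp: norm_mult)

lemma continuous_on_trig: "(\<lambda>k. norm (a k)) summable_on UNIV \<Longrightarrow> continuous_on A (trig a)"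
  by (rule uniform_limit_theorem[OF _ trig_uniform_limit]) (auto intro!: always_eventually continuous_intros)

lemma cis_periodic: "cis (of_int k * (x + 2 * pi)) = cis (of_int k * x)"
proof -
  have "cis (of_int k * (x + 2 * pi)) = cis (of_int k * x) * cis (2 * pi * of_int k)"
    by (simp add: cis_mult algebra_simps)
  also have "cis (2 * pi * of_int k) = 1"
    by (rule cis_multiple_2pi) simp
  finally show ?thesis
    by simp
qed

lemma periodic_trig: "periodic (trig a)"
  by (simp only: periodic_def trig_def cis_periodic simp_thms)

text \<open>Uniform convergence permits integration term by term, and by orthogonality the integrals
  of the partial sums are constant once the index set contains n.\<close>

lemma fc_trig:
  assumes a: "(\<lambda>k. norm (a k)) summable_on UNIV"
  shows "fc (trig a) n = a n"
proof -
  let ?F = "finite_subsets_at_top (UNIV :: int set)"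
  define f where "f S x = (\<Sum>k\<in>S. a k * cis (of_int k * x)) * cis (- (of_int n * x))" for S x
  have lim: "uniform_limit {-pi..pi} f (\<lambda>x. trig a x * cis (- (of_int n * x))) ?F"
    unfolding f_def
  proof (rule bounded_bilinear.bounded_uniform_limit[OF bounded_bilinear_mult trig_uniform_limit[OF a]])
    show "bounded (trig a ` {-pi..pi})"
      by (intro compact_imp_bounded compact_continuous_image continuous_on_trig a compact_Icc)
  qed (auto simp: bounded_iff intro!: uniform_limit_const exI[of _ 1])
  obtain I J where I: "\<And>S. (f S has_integral I S) {-pi..pi}"
    and J: "((\<lambda>x. trig a x * cis (- (of_int n * x))) has_integral J) {-pi..pi}" and IJ: "(I \<longlongrightarrow> J) ?F"
    by (rule uniform_limit_integral[OF lim]) (auto simp: f_def intro!: continuous_intros)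
  have I_eq: "I S = of_real (2 * pi) * a n" if "finite S" "n \<in> S" for S
  proof -
    have "((\<lambda>x. \<Sum>k\<in>S. a k * (cis (of_int k * x) * cis (- (of_int n * x)))) has_integral
        (\<Sum>k\<in>S. a k * (of_real (2 * pi) * fc (\<lambda>x. cis (of_int k * x)) n))) {-pi..pi}"
      by (intro has_integral_sum \<open>finite S\<close> has_integral_mult_right fc_has_integral continuous_intros)
    also have "(\<Sum>k\<in>S. a k * (of_real (2 * pi) * fc (\<lambda>x. cis (of_int k * x)) n)) = of_real (2 * pi) * a n"
      using that by (simp add: fc_cis if_distrib sum.delta' cong: if_cong)
    also have "(\<lambda>x. \<Sum>k\<in>S. a k * (cis (of_int k * x) * cis (- (of_int n * x)))) = f S"
      by (simp add: f_def fun_eq_iff sum_distrib_right mult.assoc)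
    finally show ?thesis
      using I has_integral_unique by blast
  qed
  have "\<forall>\<^sub>F S in ?F. I S = of_real (2 * pi) * a n"
    unfolding eventually_finite_subsets_at_top by (intro exI[of _ "{n}"] conjI allI impI I_eq) auto
  then have "(I \<longlongrightarrow> of_real (2 * pi) * a n) ?F"
    by (rule tendsto_eventually)
  then have "J = of_real (2 * pi) * a n"
    using tendsto_unique[OF _ IJ] by simp
  then show ?thesis
    using J by (intro fc_eqI) simp
qed

text \<open>The series and h are continuous and periodic with equal coefficients, so their
  difference vanishes.\<close>

lemma trig_fc:
  assumes "continuous_on UNIV h" "periodic h" "(\<lambda>k. norm (fc h k)) summable_on UNIV"
  shows "trig (fc h) = h"
proof
  fix x
  have c: "continuous_on {-pi..pi} h" "continuous_on {-pi..pi} (trig (fc h))"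
    using continuous_on_subset[OF assms(1)] continuous_on_trig[OF assms(3)] by auto
  have "trig (fc h) x - h x = 0"
  proof (rule periodic_zero_if_fc_zero)
    show "continuous_on UNIV (\<lambda>x. trig (fc h) x - h x)"
      by (intro continuous_intros continuous_on_trig assms)
    show "periodic (\<lambda>x. trig (fc h) x - h x)"
      using assms(2) periodic_trig[of "fc h"] by (simp add: periodic_def)
    show "fc (\<lambda>x. trig (fc h) x - h x) k = 0" for k
      by (simp add: fc_diff c fc_trig assms)
  qed
  then show "trig (fc h) x = h x"
    by simp
qed

lemma abs_summable_times:
  fixes f g :: "int \<Rightarrow> complex"
  assumes f: "(\<lambda>k. norm (f k)) summable_on UNIV" and g: "(\<lambda>k. norm (g k)) summable_on UNIV"
  shows "(\<lambda>p. norm (case p of (j, k) \<Rightarrow> f j * g k)) summable_on (UNIV \<times> UNIV)"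
proof (rule Infinite_Sum.abs_summable_on_Sigma_iff[THEN iffD2, OF conjI])
  show "\<forall>j\<in>UNIV. (\<lambda>k. norm (case (j, k) of (j, k) \<Rightarrow> f j * g k)) summable_on UNIV"
    by (simp add: norm_mult summable_on_cmult_right g)
  show "(\<lambda>j. norm (\<Sum>\<^sub>\<infinity>k. norm (case (j, k) of (j, k) \<Rightarrow> f j * g k))) summable_on UNIV"
    by (simp add: norm_mult infsum_cmult_right' abs_mult summable_on_cmult_left f)
qed

text \<open>The double series of the product converges absolutely and is regrouped along n = j + k
  by a shear of the index plane.\<close>

lemma trig_mult:
  assumes a: "(\<lambda>k. norm (a k)) summable_on UNIV"
  shows "(\<lambda>k. norm (conv a a k)) summable_on UNIV" and "trig (conv a a) x = trig a x * trig a x"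
proof -
  define g where "g = (\<lambda>(n, k). a (n - k) * a k * cis (of_int n * x))"
  define h where "h = (\<lambda>(j, k). (a j * cis (of_int j * x)) * (a k * cis (of_int k * x)))"
  note ax = trig_abs_summable[OF a, of x]
  have h_abs: "(\<lambda>p. norm (h p)) summable_on (UNIV \<times> UNIV)"
    unfolding h_def by (rule abs_summable_times[OF ax ax])
  have bij: "bij_betw (\<lambda>(n, k). (n - k, k)) UNIV (UNIV :: (int \<times> int) set)"
    by (rule bij_betwI[of _ _ _ "\<lambda>(j, k). (j + k, k)"]) auto
  have gh: "g p = h (case p of (n, k) \<Rightarrow> (n - k, k))" for p
  proof -
    obtain n k where p: "p = (n, k)"
      by fastforce
    have "cis (of_int n * x) = cis (of_int (n - k) * x) * cis (of_int k * x)"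
      unfolding cis_mult_index by simp
    then show ?thesis
      by (simp add: p g_def h_def mult_ac)
  qed
  have g_abs: "(\<lambda>p. norm (g p)) summable_on (UNIV \<times> UNIV)"
    unfolding gh UNIV_Times_UNIV using summable_on_reindex_bij_betw[OF bij, of "\<lambda>p. norm (h p)"] h_abs
    by (simp add: UNIV_Times_UNIV)
  have row: "(\<Sum>\<^sub>\<infinity>k. g (n, k)) = conv a a n * cis (of_int n * x)" for n
    unfolding g_def conv_def by (simp add: infsum_cmult_left')
  have "(\<lambda>n. norm (\<Sum>\<^sub>\<infinity>k. norm (g (n, k)))) summable_on UNIV"
    using Infinite_Sum.abs_summable_on_Sigma_iff[of g UNIV "\<lambda>_. UNIV"] g_abs by blast
  then show "(\<lambda>k. norm (conv a a k)) summable_on UNIV"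
  proof (rule summable_on_comparison_test)
    fix n
    have "(\<lambda>k. norm (g (n, k))) summable_on UNIV"
      using Infinite_Sum.abs_summable_on_Sigma_iff[of g UNIV "\<lambda>_. UNIV"] g_abs by blast
    then have "norm (\<Sum>\<^sub>\<infinity>k. g (n, k)) \<le> (\<Sum>\<^sub>\<infinity>k. norm (g (n, k)))"
      by (rule norm_infsum_bound)
    then show "norm (conv a a n) \<le> norm (\<Sum>\<^sub>\<infinity>k. norm (g (n, k)))"
      by (simp add: row norm_mult)
  qed simp
  have g: "g summable_on (UNIV \<times> UNIV)" and h: "h summable_on (UNIV \<times> UNIV)"
    using g_abs h_abs by (auto intro: abs_summable_summable)
  have "trig (conv a a) x = (\<Sum>\<^sub>\<infinity>n. \<Sum>\<^sub>\<infinity>k. g (n, k))"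
    by (simp add: trig_def row)
  also have "\<dots> = infsum g UNIV"
    using infsum_Sigma_banach[OF g] by (simp add: UNIV_Times_UNIV)
  also have "\<dots> = infsum h UNIV"
    unfolding gh using infsum_reindex_bij_betw[OF bij, of h] by (simp add: case_prod_unfold)
  also have "\<dots> = (\<Sum>\<^sub>\<infinity>j. \<Sum>\<^sub>\<infinity>k. h (j, k))"
    using infsum_Sigma_banach[OF h] by (simp add: UNIV_Times_UNIV)
  also have "\<dots> = trig a x * trig a x"
    by (simp add: h_def trig_def infsum_cmult_left' infsum_cmult_right')
  finally show "trig (conv a a) x = trig a x * trig a x" .
qed

section \<open>Smooth periodic test functions\<close>

abbreviation der :: "(real \<Rightarrow> complex) \<Rightarrow> real \<Rightarrow> complex" where
  "der \<phi> \<equiv> \<lambda>x. vector_derivative \<phi> (at x)"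

lemma iter_deriv_0 [simp]: "iter_deriv 0 \<phi> = \<phi>"
  by (simp add: iter_deriv_def)

lemma iter_deriv_Suc: "iter_deriv (Suc n) \<phi> = iter_deriv n (der \<phi>)"
  by (simp only: iter_deriv_def funpow_Suc_right o_apply)

lemma iter_deriv_Suc': "iter_deriv (Suc n) \<phi> = der (iter_deriv n \<phi>)"
  by (simp add: iter_deriv_def)

lemma per_test_periodic: "\<phi> \<in> per_test \<Longrightarrow> periodic \<phi>"
  by (simp add: per_test_def periodic_def)

lemma per_test_differentiable: "\<phi> \<in> per_test \<Longrightarrow> \<phi> differentiable (at x)"
  unfolding per_test_def by (auto dest: spec[of _ "0 :: nat"])

lemma per_test_has_vector_derivative: "\<phi> \<in> per_test \<Longrightarrow> (\<phi> has_vector_derivative der \<phi> x) (at x)"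
  using per_test_differentiable vector_derivative_works by blast

lemma per_test_continuous: "\<phi> \<in> per_test \<Longrightarrow> continuous_on A \<phi>"
  by (meson per_test_has_vector_derivative has_vector_derivative_at_within continuous_on_vector_derivative)

lemma per_test_der:
  assumes "\<phi> \<in> per_test"
  shows "der \<phi> \<in> per_test"
proof -
  have "der \<phi> (x + 2 * pi) = der \<phi> x" for x
  proof -
    have "(\<phi> \<circ> (\<lambda>x. x + 2 * pi) has_vector_derivative (1 *\<^sub>R der \<phi> (x + 2 * pi))) (at x)"
      by (rule vector_diff_chain_at)
        (auto intro!: derivative_eq_intros per_test_has_vector_derivative assms)
    also have "\<phi> \<circ> (\<lambda>x. x + 2 * pi) = \<phi>"
      using assms by (simp add: per_test_def fun_eq_iff)
    finally show ?thesis
      using vector_derivative_at by fastforce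
  qed
  moreover have "iter_deriv n (der \<phi>) differentiable (at x)" for n x
    using assms unfolding per_test_def iter_deriv_Suc[symmetric] by blast
  ultimately show ?thesis
    by (simp add: per_test_def)
qed

lemma per_test_iter_deriv: "\<phi> \<in> per_test \<Longrightarrow> iter_deriv n \<phi> \<in> per_test"
  by (induction n arbitrary: \<phi>) (auto simp: iter_deriv_Suc per_test_der)

text \<open>Smoothness by coinduction: in a class of periodic functions closed under differentiation
  every member is smooth. Closure properties then follow without formulas for higher
  derivatives.\<close>

lemma per_test_coinduct:
  assumes "\<phi> \<in> P" and "\<And>\<phi>. \<phi> \<in> P \<Longrightarrow> periodic \<phi>"
    and step: "\<And>\<phi>. \<phi> \<in> P \<Longrightarrow> \<exists>\<psi>\<in>P. \<forall>x. (\<phi> has_vector_derivative \<psi> x) (at x)"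
  shows "\<phi> \<in> per_test"
proof -
  have "iter_deriv n \<phi> \<in> P" for n
  proof (induction n)
    case (Suc n)
    obtain \<psi> where "\<psi> \<in> P" "\<And>x. (iter_deriv n \<phi> has_vector_derivative \<psi> x) (at x)"
      using step[OF Suc] by blast
    moreover from this(2) have "der (iter_deriv n \<phi>) = \<psi>"
      by (intro ext vector_derivative_at)
    ultimately show ?case
      by (simp add: iter_deriv_Suc')
  qed (use assms in simp)
  moreover have "\<psi> differentiable (at x)" if "\<psi> \<in> P" for \<psi> x
    using step[OF that] by (auto simp: differentiable_def has_vector_derivative_def)
  ultimately show ?thesis
    using assms(2)[OF assms(1)] by (auto simp: per_test_def periodic_def)
qed

lemma per_test_lincomb:
  assumes "\<phi> \<in> per_test" "\<psi> \<in> per_test"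
  shows "(\<lambda>x. c * \<phi> x + d * \<psi> x) \<in> per_test"
proof (rule per_test_coinduct)
  let ?P = "{(\<lambda>x. c * \<phi> x + d * \<psi> x) |\<phi> \<psi>. \<phi> \<in> per_test \<and> \<psi> \<in> per_test}"
  show "(\<lambda>x. c * \<phi> x + d * \<psi> x) \<in> ?P"
    using assms by blast
  fix \<eta> assume "\<eta> \<in> ?P"
  then obtain \<phi> \<psi> where \<eta>: "\<eta> = (\<lambda>x. c * \<phi> x + d * \<psi> x)" and P: "\<phi> \<in> per_test" "\<psi> \<in> per_test"
    by blast
  then show "periodic \<eta>"
    using per_test_periodic[of \<phi>] per_test_periodic[of \<psi>] by (simp add: periodic_def)
  show "\<exists>\<psi>\<in>?P. \<forall>x. (\<eta> has_vector_derivative \<psi> x) (at x)"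
  proof (intro bexI[of _ "\<lambda>x. c * der \<phi> x + d * der \<psi> x"] allI)
    show "(\<eta> has_vector_derivative (c * der \<phi> x + d * der \<psi> x)) (at x)" for x
      unfolding \<eta> by (intro has_vector_derivative_add has_vector_derivative_mult_right per_test_has_vector_derivative P)
    show "(\<lambda>x. c * der \<phi> x + d * der \<psi> x) \<in> ?P"
      by (intro CollectI exI[of _ "der \<phi>"] exI[of _ "der \<psi>"] conjI refl per_test_der P)
  qed
qed

lemma per_test_add: "\<phi> \<in> per_test \<Longrightarrow> \<psi> \<in> per_test \<Longrightarrow> (\<lambda>x. \<phi> x + \<psi> x) \<in> per_test"
  using per_test_lincomb[of \<phi> \<psi> 1 1] by simp

lemma per_test_diff: "\<phi> \<in> per_test \<Longrightarrow> \<psi> \<in> per_test \<Longrightarrow> (\<lambda>x. \<phi> x - \<psi> x) \<in> per_test"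
  using per_test_lincomb[of \<phi> \<psi> 1 "- 1"] by simp

lemma per_test_cmult: "\<phi> \<in> per_test \<Longrightarrow> (\<lambda>x. c * \<phi> x) \<in> per_test"
  using per_test_lincomb[of \<phi> \<phi> c 0] by simp

lemma per_test_cis: "(\<lambda>x. cis (of_int k * x)) \<in> per_test"
\<comment> \<open>The scalar multiples make the class closed under differentiation.\<close>
proof (rule per_test_coinduct[of _ "range (\<lambda>c x. c * cis (of_int k * x))"])
  show "(\<lambda>x. cis (of_int k * x)) \<in> range (\<lambda>c x. c * cis (of_int k * x))"
    by (rule range_eqI[of _ _ 1]) simp
  fix \<phi> assume "\<phi> \<in> range (\<lambda>c x. c * cis (of_int k * x))"
  then obtain c where \<phi>: "\<phi> = (\<lambda>x. c * cis (of_int k * x))"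
    by blast
  show "periodic \<phi>"
    by (simp only: \<phi> periodic_def cis_periodic simp_thms)
  have "(\<phi> has_vector_derivative c * (of_int k *\<^sub>R (\<i> * cis (of_int k * x)))) (at x)" for x
    unfolding \<phi> by (intro has_vector_derivative_mult_right has_vector_derivative_cis_mult)
  then have "(\<phi> has_vector_derivative (c * (\<i> * of_int k)) * cis (of_int k * x)) (at x)" for x
    by (simp add: scaleR_conv_of_real mult_ac)
  then show "\<exists>\<psi>\<in>range (\<lambda>c x. c * cis (of_int k * x)). \<forall>x. (\<phi> has_vector_derivative \<psi> x) (at x)"
    by (intro bexI[of _ "\<lambda>x. (c * (\<i> * of_int k)) * cis (of_int k * x)"]) auto
qed

lemma per_test_cis_uminus: "(\<lambda>x. cis (- (of_int k * x))) \<in> per_test"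
  using per_test_cis[of "- k"] by simp

lemma per_test_cnj:
  assumes "\<phi> \<in> per_test"
  shows "(\<lambda>x. cnj (\<phi> x)) \<in> per_test"
proof (rule per_test_coinduct[of _ "(\<lambda>\<phi> x. cnj (\<phi> x)) ` per_test"])
  fix \<eta> assume "\<eta> \<in> (\<lambda>\<phi> x. cnj (\<phi> x)) ` per_test"
  then obtain \<phi> where \<eta>: "\<eta> = (\<lambda>x. cnj (\<phi> x))" and P: "\<phi> \<in> per_test"
    by blast
  show "periodic \<eta>"
    using per_test_periodic[OF P] by (simp add: \<eta> periodic_def)
  have "(\<eta> has_vector_derivative cnj (der \<phi> x)) (at x)" for x
    unfolding \<eta> by (rule has_vector_derivative_cnj[OF per_test_has_vector_derivative[OF P]])
  then show "\<exists>\<psi>\<in>(\<lambda>\<phi> x. cnj (\<phi> x)) ` per_test. \<forall>x. (\<eta> has_vector_derivative \<psi> x) (at x)"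
    by (intro bexI[of _ "\<lambda>x. cnj (der \<phi> x)"] allI image_eqI[OF _ per_test_der[OF P]]) auto
qed (use assms in blast)

lemma per_test_sum:
  assumes "finite S" "\<And>k. k \<in> S \<Longrightarrow> \<phi> k \<in> per_test"
  shows "(\<lambda>x. \<Sum>k\<in>S. \<phi> k x) \<in> per_test"
  using assms
proof (induction S rule: finite_induct)
  case empty
  then show ?case
    using per_test_cmult[OF per_test_cis[of 0], of 0] by simp
next
  case (insert k S)
  then show ?case
    by (simp add: per_test_add)
qed

lemma iter_deriv_diff:
  "\<phi> \<in> per_test \<Longrightarrow> \<psi> \<in> per_test \<Longrightarrow>
   iter_deriv n (\<lambda>x. \<phi> x - \<psi> x) = (\<lambda>x. iter_deriv n \<phi> x - iter_deriv n \<psi> x)"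
proof (induction n arbitrary: \<phi> \<psi>)
  case (Suc n)
  have "der (\<lambda>x. \<phi> x - \<psi> x) = (\<lambda>x. der \<phi> x - der \<psi> x)"
    by (intro ext vector_derivative_at has_vector_derivative_diff per_test_has_vector_derivative Suc.prems)
  then show ?case
    by (simp add: iter_deriv_Suc Suc.IH Suc.prems per_test_der)
qed simp

lemma iter_deriv_trig_poly:
  "iter_deriv n (\<lambda>x. \<Sum>k\<in>S. c k * cis (of_int k * x)) = (\<lambda>x. \<Sum>k\<in>S. c k * (\<i> * of_int k) ^ n * cis (of_int k * x))"
proof (induction n arbitrary: c)
  case (Suc n)
  have "((\<lambda>x. \<Sum>k\<in>S. c k * cis (of_int k * x)) has_vector_derivative
      (\<Sum>k\<in>S. c k * (of_int k *\<^sub>R (\<i> * cis (of_int k * x))))) (at x)" for x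
    by (intro has_vector_derivative_sum has_vector_derivative_mult_right has_vector_derivative_cis_mult)
  then have eq: "der (\<lambda>x. \<Sum>k\<in>S. c k * cis (of_int k * x)) =
      (\<lambda>x. \<Sum>k\<in>S. (c k * (\<i> * of_int k)) * cis (of_int k * x))"
    by (intro ext vector_derivative_at) (simp add: scaleR_conv_of_real mult_ac)
  show ?case
    unfolding iter_deriv_Suc eq Suc.IH by (simp only: power_Suc mult.assoc)
qed simp

text \<open>Integration by parts, with boundary terms that cancel by periodicity.\<close>

lemma fc_der:
  assumes "\<phi> \<in> per_test"
  shows "fc (der \<phi>) k = \<i> * of_int k * fc \<phi> k"
proof -
  have "((\<lambda>x. \<phi> x * (- \<i> * of_int k * cis (- (of_int k * x))) + der \<phi> x * cis (- (of_int k * x))) has_integral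
      (\<phi> pi * cis (- (of_int k * pi)) - \<phi> (- pi) * cis (- (of_int k * (- pi))))) {-pi..pi}"
  proof (rule fundamental_theorem_of_calculus)
    fix x
    have "((\<lambda>x. cis (- (of_int k * x))) has_vector_derivative (- of_int k *\<^sub>R (\<i> * cis (- (of_int k * x))))) (at x within {-pi..pi})"
      using has_vector_derivative_cis_mult[of "- of_int k" x] by simp
    from has_vector_derivative_mult[OF has_vector_derivative_at_within[OF per_test_has_vector_derivative[OF assms]] this]
    show "((\<lambda>x. \<phi> x * cis (- (of_int k * x))) has_vector_derivative
        (\<phi> x * (- \<i> * of_int k * cis (- (of_int k * x))) + der \<phi> x * cis (- (of_int k * x)))) (at x within {-pi..pi})"
      by (simp add: scaleR_conv_of_real mult_ac)
  qed (use pi_ge_zero in linarith)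
  moreover have "\<phi> pi = \<phi> (- pi)"
    using per_test_periodic[OF assms] unfolding periodic_def by (metis add.commute add_uminus_conv_diff mult_2 add_diff_cancel)
  moreover have "cis (- (of_int k * pi)) = cis (- (of_int k * (- pi)))"
    using cis_periodic[of k "- pi"] cis_periodic[of "- k" "- pi"] by (simp add: algebra_simps)
  ultimately have "((\<lambda>x. \<phi> x * (- \<i> * of_int k * cis (- (of_int k * x))) + der \<phi> x * cis (- (of_int k * x))) has_integral 0) {-pi..pi}"
    by simp
  from has_integral_diff[OF this has_integral_mult_right[OF fc_has_integral[OF per_test_continuous[OF assms], of k], of "- \<i> * of_int k"]]
  have "((\<lambda>x. der \<phi> x * cis (- (of_int k * x))) has_integral (of_real (2 * pi) * (\<i> * of_int k * fc \<phi> k))) {-pi..pi}"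
    by (simp add: mult_ac)
  then show ?thesis
    by (rule fc_eqI)
qed

lemma fc_iter_deriv: "\<phi> \<in> per_test \<Longrightarrow> fc (iter_deriv n \<phi>) k = fc \<phi> k * (\<i> * of_int k) ^ n"
  by (induction n arbitrary: \<phi>) (auto simp: iter_deriv_Suc per_test_der fc_der)

lemma fc_bounded_if_continuous:
  assumes "continuous_on {-pi..pi} f"
  obtains C where "\<And>k. norm (fc f k) \<le> C"
proof -
  have "bounded (f ` {-pi..pi})"
    by (intro compact_imp_bounded compact_continuous_image assms compact_Icc)
  then obtain C where "\<And>x. x \<in> {-pi..pi} \<Longrightarrow> norm (f x) \<le> C"
    unfolding bounded_iff by blast
  then show ?thesis
    using norm_fc_le[OF _ assms] that by blast
qed

text \<open>Two derivatives suffice: the coefficients of the second derivative are bounded and equal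
  - k^2 times those of the function.\<close>

lemma fc_per_test_abs_summable:
  assumes "\<phi> \<in> per_test"
  shows "(\<lambda>k. norm (fc \<phi> k)) summable_on UNIV"
proof -
  obtain C where C: "\<And>k. norm (fc \<phi> k) \<le> C"
    by (rule fc_bounded_if_continuous[OF per_test_continuous[OF assms]]) blast
  obtain D where D: "\<And>k. norm (fc (der (der \<phi>)) k) \<le> D"
    by (rule fc_bounded_if_continuous[OF per_test_continuous[OF per_test_der[OF per_test_der[OF assms]]]]) blast
  have le: "norm (fc \<phi> k) \<le> (C + D) * (1 / (1 + (real_of_int k)\<^sup>2))" for k
  proof -
    have "norm (fc (der (der \<phi>)) k) = (real_of_int k)\<^sup>2 * norm (fc \<phi> k)"
      by (simp add: fc_der assms per_test_der norm_mult power2_eq_square)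
    then have "norm (fc \<phi> k) * (1 + (real_of_int k)\<^sup>2) \<le> C + D"
      using C[of k] D[of k] by (simp add: algebra_simps)
    then show ?thesis
      by (simp add: pos_le_divide_eq)
  qed
  show ?thesis
    by (rule summable_on_comparison_test[OF summable_on_cmult_right[OF inverse_square_summable, of "C + D"] le]) simp
qed

section \<open>Distributions are determined by their Fourier coefficients\<close>

lemma per_distr_add:
  "F \<in> per_distr \<Longrightarrow> \<phi> \<in> per_test \<Longrightarrow> \<psi> \<in> per_test \<Longrightarrow> F (\<lambda>x. \<phi> x + \<psi> x) = F \<phi> + F \<psi>"
  by (simp add: per_distr_def)

lemma per_distr_cmult: "F \<in> per_distr \<Longrightarrow> \<phi> \<in> per_test \<Longrightarrow> F (\<lambda>x. c * \<phi> x) = c * F \<phi>"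
  by (simp add: per_distr_def)

lemma per_distr_sum:
  assumes F: "F \<in> per_distr" and "finite S" "\<And>k. k \<in> S \<Longrightarrow> \<phi> k \<in> per_test"
  shows "F (\<lambda>x. \<Sum>k\<in>S. c k * \<phi> k x) = (\<Sum>k\<in>S. c k * F (\<phi> k))"
  using assms(2,3)
proof (induction S rule: finite_induct)
  case empty
  show ?case
    using per_distr_cmult[OF F per_test_cis[of 0], of 0] by simp
next
  case (insert k S)
  have "(\<lambda>x. \<Sum>k\<in>S. c k * \<phi> k x) \<in> per_test"
    using insert by (intro per_test_sum per_test_cmult) auto
  then show ?case
    using insert by (simp add: per_distr_add[OF F] per_distr_cmult[OF F] per_test_cmult)
qed

lemma per_distr_diff: "F \<in> per_distr \<Longrightarrow> \<phi> \<in> per_test \<Longrightarrow> \<psi> \<in> per_test \<Longrightarrow> F (\<lambda>x. \<phi> x - \<psi> x) = F \<phi> - F \<psi>"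
  using per_distr_sum[of F "{True, False}" "\<lambda>b. if b then \<phi> else \<psi>" "\<lambda>b. if b then 1 else - 1"] by simp

text \<open>Continuity in a form free of suprema, matched to the uniform estimates that
  \<open>trig_poly_dense\<close> delivers.\<close>

lemma per_distr_bound:
  assumes F: "F \<in> per_distr"
  obtains N C where "0 \<le> C" "\<And>\<phi> e. \<phi> \<in> per_test \<Longrightarrow>
    (\<And>j x. j \<le> N \<Longrightarrow> norm (iter_deriv j \<phi> x) \<le> e) \<Longrightarrow> norm (F \<phi>) \<le> C * e"
proof -
  obtain N C where bound: "\<And>\<phi>. \<phi> \<in> per_test \<Longrightarrow> norm (F \<phi>) \<le> C * (\<Sum>j\<le>N. SUP x. norm (iter_deriv j \<phi> x))"
    using F unfolding per_distr_def by blast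
  show ?thesis
  proof (rule that[of "\<bar>C\<bar> * (real N + 1)" N])
    fix \<phi> and e :: real
    assume \<phi>: "\<phi> \<in> per_test" and le: "\<And>j x. j \<le> N \<Longrightarrow> norm (iter_deriv j \<phi> x) \<le> e"
    have sup: "(SUP x. norm (iter_deriv j \<phi> x)) \<le> e" "0 \<le> (SUP x. norm (iter_deriv j \<phi> x))" if "j \<le> N" for j
      using le[OF that] by (auto intro!: cSUP_least cSUP_upper2[of _ _ 0] bdd_aboveI2[of _ _ e])
    note bound[OF \<phi>]
    also have "C * (\<Sum>j\<le>N. SUP x. norm (iter_deriv j \<phi> x)) \<le> \<bar>C\<bar> * (\<Sum>j\<le>N. SUP x. norm (iter_deriv j \<phi> x))"
      by (intro mult_right_mono sum_nonneg) (auto simp: sup)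
    also have "\<dots> \<le> \<bar>C\<bar> * (\<Sum>j\<le>N. e)"
      by (intro mult_left_mono sum_mono) (auto simp: sup)
    finally show "norm (F \<phi>) \<le> \<bar>C\<bar> * (real N + 1) * e"
      by (simp add: mult.assoc add.commute)
  qed simp
qed

text \<open>Density in the Frechet topology. The Fourier series of every derivative converges
  uniformly, and differentiating a partial sum gives the partial sum of the derivative, so one
  finite index set serves the finitely many orders up to N.\<close>

lemma trig_poly_dense:
  assumes \<phi>: "\<phi> \<in> per_test" and "0 < e"
  obtains S c where "finite S" "\<And>j x. j \<le> N \<Longrightarrow>
    norm (iter_deriv j (\<lambda>x. \<phi> x - (\<Sum>k\<in>S. c k * cis (of_int k * x))) x) \<le> e"
proof -
  define close where "close S j x \<longleftrightarrow>
    dist (\<Sum>k\<in>S. fc (iter_deriv j \<phi>) k * cis (of_int k * x)) (trig (fc (iter_deriv j \<phi>)) x) < e" for S j x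
  have "\<forall>\<^sub>F S in finite_subsets_at_top UNIV. \<forall>j\<in>{..N}. \<forall>x\<in>UNIV. close S j x"
    unfolding close_def
  proof (rule eventually_ball_finite; (intro ballI)?)
    fix j
    show "\<forall>\<^sub>F S in finite_subsets_at_top UNIV. \<forall>x\<in>UNIV.
        dist (\<Sum>k\<in>S. fc (iter_deriv j \<phi>) k * cis (of_int k * x)) (trig (fc (iter_deriv j \<phi>)) x) < e"
      by (rule uniform_limitD[OF trig_uniform_limit[OF fc_per_test_abs_summable[OF per_test_iter_deriv[OF \<phi>]]] \<open>0 < e\<close>])
  qed simp
  moreover have "\<forall>\<^sub>F S in finite_subsets_at_top (UNIV :: int set). finite S"
    by (rule eventually_finite_subsets_at_top_weakI)
  ultimately have "\<forall>\<^sub>F S in finite_subsets_at_top UNIV. finite S \<and> (\<forall>j\<in>{..N}. \<forall>x\<in>UNIV. close S j x)"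
    by eventually_elim simp
  then have "\<exists>S. finite S \<and> (\<forall>j\<in>{..N}. \<forall>x\<in>UNIV. close S j x)"
    by (rule eventually_happens'[OF finite_subsets_at_top_neq_bot])
  then obtain S where "finite S" and S: "\<And>j x. j \<le> N \<Longrightarrow> close S j x"
    by auto
  have p: "(\<lambda>x. \<Sum>k\<in>S. fc \<phi> k * cis (of_int k * x)) \<in> per_test"
    by (intro per_test_sum per_test_cmult per_test_cis \<open>finite S\<close>)
  have "norm (iter_deriv j (\<lambda>x. \<phi> x - (\<Sum>k\<in>S. fc \<phi> k * cis (of_int k * x))) x) \<le> e" if "j \<le> N" for j x
  proof -
    have "trig (fc (iter_deriv j \<phi>)) = iter_deriv j \<phi>"
      using per_test_iter_deriv[OF \<phi>, of j]
      by (intro trig_fc per_test_continuous per_test_periodic fc_per_test_abs_summable)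
    then have "norm (iter_deriv j (\<lambda>x. \<phi> x - (\<Sum>k\<in>S. fc \<phi> k * cis (of_int k * x))) x) =
        dist (\<Sum>k\<in>S. fc (iter_deriv j \<phi>) k * cis (of_int k * x)) (trig (fc (iter_deriv j \<phi>)) x)"
      unfolding iter_deriv_diff[OF \<phi> p]
      by (simp add: iter_deriv_trig_poly fc_iter_deriv[OF \<phi>] dist_norm norm_minus_commute)
    then show ?thesis
      using S[OF that, of x] by (simp add: close_def)
  qed
  then show ?thesis
    using that[OF \<open>finite S\<close>] by blast
qed

text \<open>F and G agree on trigonometric polynomials, hence by continuity and density on all test
  functions; elsewhere both are 0 by convention.\<close>

lemma per_distr_eqI:
  assumes F: "F \<in> per_distr" and G: "G \<in> per_distr" and eq: "\<And>k. fourier_coeff F k = fourier_coeff G k"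
  shows "F = G"
proof
  fix \<phi>
  show "F \<phi> = G \<phi>"
  proof (cases "\<phi> \<in> per_test")
    case True
    \<comment> \<open>\<open>fourier_coeff\<close> tests with the conjugate exponential, hence the
      index - k.\<close>
    have cis_eq: "F (\<lambda>x. cis (of_int k * x)) = G (\<lambda>x. cis (of_int k * x))" for k
      using eq[of "- k"] by (simp add: fourier_coeff_def)
    obtain N C where "0 \<le> C" and C: "\<And>\<phi> e. \<phi> \<in> per_test \<Longrightarrow>
        (\<And>j x. j \<le> N \<Longrightarrow> norm (iter_deriv j \<phi> x) \<le> e) \<Longrightarrow> norm (F \<phi>) \<le> C * e"
      using per_distr_bound[OF F] by metis
    obtain M D where "0 \<le> D" and D: "\<And>\<phi> e. \<phi> \<in> per_test \<Longrightarrow>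
        (\<And>j x. j \<le> M \<Longrightarrow> norm (iter_deriv j \<phi> x) \<le> e) \<Longrightarrow> norm (G \<phi>) \<le> D * e"
      using per_distr_bound[OF G] by metis
    have small: "norm (F \<phi> - G \<phi>) \<le> (C + D) * e" if e: "0 < e" for e
    proof -
      obtain S c where "finite S" and S: "\<And>j x. j \<le> max N M \<Longrightarrow>
          norm (iter_deriv j (\<lambda>x. \<phi> x - (\<Sum>k\<in>S. c k * cis (of_int k * x))) x) \<le> e"
        using trig_poly_dense[OF True e, where N = "max N M"] by metis
      define p where "p x = (\<Sum>k\<in>S. c k * cis (of_int k * x))" for x
      have p: "p \<in> per_test"
        unfolding p_def by (intro per_test_sum per_test_cmult per_test_cis \<open>finite S\<close>)
      have "F p = G p"
        unfolding p_def
        by (simp only: per_distr_sum[OF _ \<open>finite S\<close>, of _ "\<lambda>k x. cis (of_int k * x)" c, OF _ per_test_cis] F G cis_eq)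
      then have "norm (F \<phi> - G \<phi>) = norm (F (\<lambda>x. \<phi> x - p x) - G (\<lambda>x. \<phi> x - p x))"
        by (simp add: per_distr_diff[OF _ True p] F G)
      also have "\<dots> \<le> norm (F (\<lambda>x. \<phi> x - p x)) + norm (G (\<lambda>x. \<phi> x - p x))"
        by (rule norm_triangle_ineq4)
      also have "\<dots> \<le> C * e + D * e"
        using S by (intro add_mono C D per_test_diff True p) (auto simp: p_def[abs_def])
      finally show ?thesis
        by (simp add: distrib_right)
    qed
    have "norm (F \<phi> - G \<phi>) \<le> 0"
    proof (rule field_le_epsilon)
      fix e :: real assume "0 < e"
      \<comment> \<open>The added 1 keeps the divisor positive when C and D are 0.\<close>
      define d where "d = C + D + 1"
      have "0 < d"
        unfolding d_def using \<open>0 \<le> C\<close> \<open>0 \<le> D\<close> by linarith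
      have "norm (F \<phi> - G \<phi>) \<le> (d - 1) * (e / d)"
        using small[of "e / d"] \<open>0 < e\<close> \<open>0 < d\<close> by (simp add: d_def)
      also have "\<dots> \<le> d * (e / d)"
        using \<open>0 < e\<close> \<open>0 < d\<close> by (intro mult_right_mono) auto
      finally show "norm (F \<phi> - G \<phi>) \<le> 0 + e"
        using \<open>0 < d\<close> by simp
    qed
    then show ?thesis
      by simp
  next
    case False
    then show ?thesis
      using F G unfolding per_distr_def by auto
  qed
qed

section \<open>Transfer to distributions\<close>

lemma test_bounded:
  assumes "\<phi> \<in> per_test"
  shows "bdd_above (range (\<lambda>x. norm (\<phi> x)))"
proof -
  have "bounded (\<phi> ` {-pi..pi})"
    by (intro compact_imp_bounded compact_continuous_image per_test_continuous assms compact_Icc)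
  then obtain B where B: "\<And>x. x \<in> {-pi..pi} \<Longrightarrow> norm (\<phi> x) \<le> B"
    unfolding bounded_iff by blast
  have "periodic (\<lambda>x. norm (\<phi> x) \<le> B)"
    using per_test_periodic[OF assms] by (simp add: periodic_def)
  then have "(norm (\<phi> x) \<le> B) = True" for x
    by (rule periodic_eq_zeroI) (use B in auto)
  then show ?thesis
    by (auto simp: bdd_above_def)
qed

lemma distr_of_apply: "\<phi> \<in> per_test \<Longrightarrow> distr_of g \<phi> = integral {-pi..pi} (\<lambda>x. of_real (g x) * \<phi> x)"
  by (simp add: distr_of_def)

lemma distr_of_integrable:
  "continuous_on UNIV g \<Longrightarrow> \<phi> \<in> per_test \<Longrightarrow> (\<lambda>x. complex_of_real (g x) * \<phi> x) integrable_on {-pi..pi}"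
  by (intro integrable_continuous_interval continuous_intros per_test_continuous)
    (auto intro: continuous_on_subset)

lemma distr_of_per_distr:
  assumes g: "continuous_on UNIV g"
  shows "distr_of g \<in> per_distr"
proof -
  note int = distr_of_integrable[OF g]
  have "compact (g ` {-pi..pi})"
    by (intro compact_continuous_image compact_Icc continuous_on_subset[OF g]) auto
  then have "bounded (g ` {-pi..pi})"
    by (rule compact_imp_bounded)
  then obtain B where "\<forall>y\<in>g ` {-pi..pi}. norm y \<le> B"
    unfolding bounded_iff by blast
  then have B: "\<bar>g x\<bar> \<le> B" if "x \<in> {-pi..pi}" for x
    using that by simp
  then have "0 \<le> B"
    using abs_ge_zero[of "g 0"] order_trans pi_ge_zero by (metis atLeastAtMost_iff neg_le_0_iff_le)
  \<comment> \<open>A distribution of order 0: the sum has the single term j = 0.\<close>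
  have "norm (distr_of g \<phi>) \<le> (2 * pi * B) * (\<Sum>j\<le>0. SUP x. norm (iter_deriv j \<phi> x))" if \<phi>: "\<phi> \<in> per_test" for \<phi>
  proof -
    have "norm (integral {-pi..pi} (\<lambda>x. of_real (g x) * \<phi> x)) \<le> B * (SUP x. norm (\<phi> x)) * (pi - - pi)"
    proof (rule integral_bound)
      show "continuous_on {-pi..pi} (\<lambda>x. complex_of_real (g x) * \<phi> x)"
        by (intro continuous_intros per_test_continuous \<phi> continuous_on_subset[OF g]) auto
      fix x assume "x \<in> {-pi..pi}"
      then show "norm (of_real (g x) * \<phi> x) \<le> B * (SUP x. norm (\<phi> x))"
        unfolding norm_mult norm_of_real
        by (intro mult_mono B cSUP_upper test_bounded \<phi>) (use \<open>0 \<le> B\<close> in auto)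
    qed (use pi_ge_zero in linarith)
    then show ?thesis
      using \<phi> by (simp add: distr_of_apply mult_ac)
  qed
  then show ?thesis
    unfolding per_distr_def using int
    by (auto simp: distr_of_apply per_test_add per_test_cmult distrib_left integral_add mult.left_commute
        intro!: exI[of _ "0 :: nat"] exI[of _ "2 * pi * B"]) (simp_all add: distr_of_def)
qed

lemma real_distr_distr_of: "real_distr (distr_of g)"
  by (simp add: real_distr_def distr_of_apply per_test_cnj integral_cnj)

lemma fourier_coeff_distr_of: "fourier_coeff (distr_of g) k = fc (\<lambda>x. of_real (g x)) k"
  using per_test_cis_uminus[of k] by (simp add: fourier_coeff_def distr_of_apply fc_def)

text \<open>Makes the definite description meaningful: the Fourier coefficients leave room for only
  one continuous periodic representative.\<close>

lemma cont_rep_distr_of: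
  assumes g: "continuous_on UNIV g" "periodic g"
  shows "cont_rep (distr_of g) = g"
  unfolding cont_rep_def
proof (rule the_equality)
  fix h assume h: "continuous_on UNIV h \<and> (\<forall>x. h (x + 2 * pi) = h x) \<and> distr_of g = distr_of h"
  have c: "continuous_on A (\<lambda>x. complex_of_real (g x))" "continuous_on A (\<lambda>x. complex_of_real (h x))" for A
    using continuous_on_subset[OF g(1)] continuous_on_subset[of UNIV h] h by (auto intro!: continuous_intros)
  have "complex_of_real (h x) - of_real (g x) = 0" for x
  proof (rule periodic_zero_if_fc_zero[where h = "\<lambda>x. complex_of_real (h x) - of_real (g x)"])
    show "continuous_on UNIV (\<lambda>x. complex_of_real (h x) - of_real (g x))"
      by (intro continuous_intros c)
    show "periodic (\<lambda>x. complex_of_real (h x) - of_real (g x))"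
      using g(2) h by (simp add: periodic_def)
    show "fc (\<lambda>x. complex_of_real (h x) - of_real (g x)) k = 0" for k
      using h by (simp only: fc_diff[OF c(2) c(1)] fourier_coeff_distr_of[symmetric] diff_self)
  qed
  then show "h = g"
    by (simp add: fun_eq_iff flip: of_real_diff)
qed (use g in \<open>auto simp: periodic_def\<close>)

section \<open>The isometry between sequences and H^s\<close>

definition synth :: "real \<Rightarrow> hl2 \<Rightarrow> real \<Rightarrow> real" where
  "synth s b x = Re (trig (amp s b) x)"

text \<open>Up to the factor sqrt (2 pi) an isometry of \<open>hl2\<close> onto
  \<open>Hper s\<close>, by \<open>Hnorm_diff\<close>, \<open>Psi_Hper\<close> and
  \<open>Hper_cases\<close>.\<close>

definition Psi :: "real \<Rightarrow> hl2 \<Rightarrow> functional" where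
  "Psi s b = distr_of (synth s b)"

lemma amp_diff [simp]: "amp s (a - b) k = amp s a k - amp s b k"
  by (simp add: amp_def diff_divide_distrib)

lemma amp_sum: "amp s (\<Sum>i\<in>A. f i) k = (\<Sum>i\<in>A. amp s (f i) k)"
proof (induction A rule: infinite_finite_induct)
  case empty
  show ?case
    by (simp add: amp_def)
next
  case infinite
  then show ?case
    by (simp add: amp_def)
qed simp

context
  fixes s :: real
  assumes s: "1 \<le> s"
begin

text \<open>Reflecting k shows the series to be its own conjugate. So nothing is lost by the
  \<open>Re\<close> in \<open>synth\<close>, which is there because \<open>distr_of\<close> takes
  real functions.\<close>

lemma of_real_synth: "complex_of_real (synth s b x) = trig (amp s b) x"
proof -
  have "bij_betw uminus UNIV (UNIV :: int set)"
    by (rule bij_betwI[of _ _ _ uminus]) auto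
  from infsum_reindex_bij_betw[OF this, of "\<lambda>k. amp s b k * cis (of_int k * x)"]
  have "trig (amp s b) x = (\<Sum>\<^sub>\<infinity>k. amp s b (- k) * cis (of_int (- k) * x))"
    by (simp add: trig_def)
  also have "\<dots> = (\<Sum>\<^sub>\<infinity>k. cnj (amp s b k * cis (of_int k * x)))"
    by (intro infsum_cong) (simp add: amp_minus_index cis_cnj)
  also have "\<dots> = cnj (trig (amp s b) x)"
    unfolding trig_def by (rule infsum_cnj)
  finally have "Im (trig (amp s b) x) = 0"
    by (simp add: complex_eq_iff)
  then show ?thesis
    by (simp add: synth_def complex_eq_iff)
qed

lemma continuous_on_synth: "continuous_on A (synth s b)"
  unfolding synth_def by (intro continuous_intros continuous_on_trig amp_abs_summable s)

lemma periodic_synth: "periodic (synth s b)"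
  using periodic_trig[of "amp s b"] by (simp add: periodic_def synth_def)

lemma Psi_per_distr: "Psi s b \<in> per_distr"
  unfolding Psi_def by (rule distr_of_per_distr[OF continuous_on_synth])

lemma fourier_coeff_Psi: "fourier_coeff (Psi s b) k = amp s b k"
  unfolding Psi_def fourier_coeff_distr_of of_real_synth
  using fc_trig[OF amp_abs_summable[OF s], of b k] by simp

lemma Psi_eqI: "F \<in> per_distr \<Longrightarrow> (\<And>k. fourier_coeff F k = amp s b k) \<Longrightarrow> F = Psi s b"
  by (rule per_distr_eqI[OF _ Psi_per_distr]) (simp_all add: fourier_coeff_Psi)

lemma Hper_term_eq:
  "fourier_coeff F k = amp s b k \<Longrightarrow>
   (1 + \<bar>real_of_int k\<bar>\<^sup>2) powr s * (norm (fourier_coeff F k))\<^sup>2 = (norm (coef b k))\<^sup>2"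
  by (simp add: norm_coef_eq_amp[of b k s] power_mult_distrib wt_square)

lemma Psi_Hper: "Psi s b \<in> Hper s"
  unfolding Hper_def mem_Collect_eq Hper_term_eq[OF fourier_coeff_Psi]
  using Psi_per_distr real_distr_distr_of[of "synth s b"] coef_square_summable[of b]
  by (simp add: Psi_def)

lemma Hper_cases:
  assumes "F \<in> Hper s"
  obtains b where "F = Psi s b"
proof -
  have F: "F \<in> per_distr" "real_distr F"
    and sm: "(\<lambda>k::int. (1 + \<bar>real_of_int k\<bar>\<^sup>2) powr s * (norm (fourier_coeff F k))\<^sup>2) summable_on UNIV"
    using assms by (simp_all add: Hper_def)
  define f where "f k = of_real (wt s k) * fourier_coeff F k" for k
  \<comment> \<open>Reality of the distribution becomes Hermitian symmetry, as conjugation reverses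
    the frequency of the exponential.\<close>
  have "fourier_coeff F (- k) = cnj (fourier_coeff F k)" for k
    using F(2) per_test_cis_uminus[of k] unfolding real_distr_def
    by (auto simp: fourier_coeff_def cis_cnj dest!: bspec)
  then have "f (- k) = cnj (f k)" for k
    by (simp add: f_def)
  moreover have "(\<lambda>k. (norm (f k))\<^sup>2) summable_on UNIV"
    using sm by (simp add: f_def norm_mult power_mult_distrib wt_square)
  ultimately have "coef (Abs_hl2 f) = f"
    by (simp add: Abs_hl2_inverse)
  then have "F = Psi s (Abs_hl2 f)"
    by (intro Psi_eqI F) (simp add: amp_def f_def)
  then show ?thesis
    by (rule that)
qed

text \<open>Formulated for any functional with the right coefficients, so that it also covers
  Riemann sums, which are not given in the form \<open>Psi s b\<close>.\<close>

lemma Hnorm_eq: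
  assumes "\<And>k. fourier_coeff F k = amp s b k"
  shows "Hnorm s F = sqrt (2 * pi) * norm b"
proof -
  have "Hnorm s F = sqrt (2 * pi * (norm b)\<^sup>2)"
    unfolding Hnorm_def Hper_term_eq[OF assms] norm_hl2_square ..
  then show ?thesis
    by (simp add: real_sqrt_mult)
qed

lemma fourier_coeff_distr_diff: "fourier_coeff (distr_diff F G) k = fourier_coeff F k - fourier_coeff G k"
  by (simp add: fourier_coeff_def distr_diff_def diff_divide_distrib)

lemma Hnorm_diff: "Hnorm s (distr_diff (Psi s a) (Psi s b)) = sqrt (2 * pi) * norm (a - b)"
  by (rule Hnorm_eq) (simp add: fourier_coeff_distr_diff fourier_coeff_Psi)

lemma distr_diff_Psi: "distr_diff (Psi s a) (Psi s b) = Psi s (a - b)"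
proof -
  have "synth s (a - b) x = synth s a x - synth s b x" for x
  proof -
    have sm: "(\<lambda>k. amp s c k * cis (of_int k * x)) summable_on UNIV" for c
      by (rule abs_summable_summable[OF trig_abs_summable[OF amp_abs_summable[OF s]]])
    have "trig (amp s (a - b)) x + trig (amp s b) x = trig (amp s a) x"
      unfolding trig_def infsum_add[OF sm sm, symmetric] by (simp add: algebra_simps)
    then show ?thesis
      unfolding synth_def by (metis add_diff_cancel_right' minus_complex.simps(1))
  qed
  then have "synth s (a - b) = (\<lambda>x. synth s a x - synth s b x)"
    by blast
  moreover have "distr_diff (distr_of f) (distr_of g) = distr_of (\<lambda>x. f x - g x)"
    if "continuous_on UNIV f" "continuous_on UNIV g" for f g
    using integral_diff[OF distr_of_integrable[OF that(1)] distr_of_integrable[OF that(2)]]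
    by (auto simp: distr_diff_def distr_of_def fun_eq_iff left_diff_distrib)
  ultimately show ?thesis
    by (simp add: Psi_def continuous_on_synth)
qed

text \<open>The square becomes a convolution by \<open>trig_mult\<close>. The description in
  \<open>K_op\<close> then has the stated solution, and no other because coefficients determine a
  distribution.\<close>

lemma rBO_rhs_Psi: "rBO_rhs (Psi s b) = Psi s (rbo_field s b)"
proof -
  have "cont_rep (Psi s b) = synth s b"
    unfolding Psi_def by (rule cont_rep_distr_of[OF continuous_on_synth periodic_synth])
  then have sq: "fourier_coeff (distr_square (Psi s b)) n = conv (amp s b) (amp s b) n" for n
  proof -
    have "(\<lambda>x. complex_of_real ((synth s b x)\<^sup>2)) = trig (conv (amp s b) (amp s b))"
      using trig_mult(2)[OF amp_abs_summable[OF s], of b]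
      by (simp add: fun_eq_iff of_real_synth power2_eq_square)
    then show ?thesis
      using \<open>cont_rep _ = _\<close> trig_mult(1)[OF amp_abs_summable[OF s], of b]
      by (simp add: distr_square_def fourier_coeff_distr_of fc_trig)
  qed
  have coef: "- \<i> * of_int n / (1 + of_int \<bar>n\<bar>) * fourier_coeff (\<lambda>\<phi>. Psi s b \<phi> + distr_square (Psi s b) \<phi> / 2) n
      = amp s (rbo_field s b) n" for n
  proof -
    have "fourier_coeff (\<lambda>\<phi>. Psi s b \<phi> + distr_square (Psi s b) \<phi> / 2) n
        = fourier_coeff (Psi s b) n + fourier_coeff (distr_square (Psi s b)) n / 2"
      by (simp add: fourier_coeff_def add_divide_distrib)
    then have "fourier_coeff (\<lambda>\<phi>. Psi s b \<phi> + distr_square (Psi s b) \<phi> / 2) n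
        = amp s b n + conv (amp s b) (amp s b) n / 2"
      by (simp only: sq fourier_coeff_Psi)
    moreover have "amp s (linear_part b) n = rbo_symbol n * amp s b n"
      by (simp add: amp_def coef_linear_part)
    ultimately show ?thesis
      unfolding rbo_symbol_def[symmetric]
      by (simp add: rbo_field_def amp_bilin[OF s] scaleR_conv_of_real distrib_left)
  qed
  show ?thesis
    unfolding rBO_rhs_def K_op_def coef
  proof (rule the_equality)
    show "Psi s (rbo_field s b) \<in> per_distr \<and> (\<forall>n. fourier_coeff (Psi s (rbo_field s b)) n = amp s (rbo_field s b) n)"
      by (simp add: Psi_per_distr fourier_coeff_Psi)
  qed (use Psi_eqI in blast)
qed

text \<open>On coefficients \<open>Psi\<close> is linear, and it multiplies norms by sqrt (2 pi);
  the two gauge conditions therefore differ only in the tolerance e.\<close>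

lemma has_Hper_integral_Psi:
  "has_Hper_integral s (\<lambda>t. Psi s (g t)) (Psi s i) a b \<longleftrightarrow> (g has_integral i) {a..b}"
proof -
  have norm_eq: "Hnorm s (distr_diff (\<lambda>\<phi>. \<Sum>(x, k)\<in>D. measure lborel k *\<^sub>R Psi s (g x) \<phi>) (Psi s i))
      = sqrt (2 * pi) * norm ((\<Sum>(x, k)\<in>D. measure lborel k *\<^sub>R g x) - i)" for D :: "(real \<times> real set) set"
  proof (rule Hnorm_eq)
    fix n
    have "fourier_coeff (\<lambda>\<phi>. \<Sum>(x, k)\<in>D. measure lborel k *\<^sub>R Psi s (g x) \<phi>) n
        = (\<Sum>(x, k)\<in>D. measure lborel k *\<^sub>R fourier_coeff (Psi s (g x)) n)"
      by (simp add: fourier_coeff_def sum_divide_distrib case_prod_unfold scaleR_conv_of_real)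
    then show "fourier_coeff (distr_diff (\<lambda>\<phi>. \<Sum>(x, k)\<in>D. measure lborel k *\<^sub>R Psi s (g x) \<phi>) (Psi s i)) n
        = amp s ((\<Sum>(x, k)\<in>D. measure lborel k *\<^sub>R g x) - i) n"
      by (simp add: fourier_coeff_distr_diff fourier_coeff_Psi amp_sum case_prod_unfold)
  qed
  have "0 < sqrt (2 * pi)"
    by simp
  \<comment> \<open>The tolerance sits below the quantifiers over gauges and divisions, so these are
    abstracted into a predicate P of the test applied to the norm.\<close>
  have "(\<forall>e>0. P (\<lambda>x. sqrt (2 * pi) * x < e)) \<longleftrightarrow> (\<forall>e>0. P (\<lambda>x. x < e))" for P :: "(real \<Rightarrow> bool) \<Rightarrow> bool"
  proof (intro iffI allI impI)
    fix e :: real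
    {
      assume "\<forall>e>0. P (\<lambda>x. sqrt (2 * pi) * x < e)" "0 < e"
      then have "P (\<lambda>x. sqrt (2 * pi) * x < sqrt (2 * pi) * e)"
        using \<open>0 < sqrt (2 * pi)\<close> mult_pos_pos by blast
      then show "P (\<lambda>x. x < e)"
        by (simp only: mult_less_cancel_left_pos[OF \<open>0 < sqrt (2 * pi)\<close>])
    }
    {
      assume "\<forall>e>0. P (\<lambda>x. x < e)" "0 < e"
      then have "P (\<lambda>x. x < e / sqrt (2 * pi))"
        using \<open>0 < sqrt (2 * pi)\<close> divide_pos_pos by blast
      moreover have "x < e / sqrt (2 * pi) \<longleftrightarrow> sqrt (2 * pi) * x < e" for x
        using pos_less_divide_eq[OF \<open>0 < sqrt (2 * pi)\<close>] by (simp only: mult.commute)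
      ultimately show "P (\<lambda>x. sqrt (2 * pi) * x < e)"
        by (simp only:)
    }
  qed
  note scale = this[of "\<lambda>Q. \<exists>\<gamma>. gauge \<gamma> \<and> (\<forall>D. D tagged_division_of {a..b} \<and> \<gamma> fine D \<longrightarrow>
    Q (norm ((\<Sum>(x, k)\<in>D. measure lborel k *\<^sub>R g x) - i)))"]
  show ?thesis
    unfolding has_Hper_integral_def norm_eq has_integral_real scale by (simp add: Psi_Hper)
qed

lemma CHper_Psi: "CHper s T (\<lambda>t. Psi s (x t)) \<longleftrightarrow> continuous_on {-T..T} x"
proof -
  have "((\<lambda>\<tau>. sqrt (2 * pi) * norm (x \<tau> - x t)) \<longlongrightarrow> 0) F \<longleftrightarrow> (x \<longlongrightarrow> x t) F" for t F
    using tendsto_mult_left_iff[of "sqrt (2 * pi)" "\<lambda>\<tau>. norm (x \<tau> - x t)" 0 F]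
    by (simp add: tendsto_norm_zero_iff LIM_zero_iff)
  then show ?thesis
    unfolding CHper_def Hnorm_diff continuous_on_def by (simp add: Psi_Hper)
qed

section \<open>The integrated equation as a differential equation\<close>

definition coeff_solution :: "hl2 \<Rightarrow> (real \<Rightarrow> hl2) \<Rightarrow> bool" where
  "coeff_solution x0 x \<longleftrightarrow> (\<forall>T>0. continuous_on {-T..T} x) \<and>
     (\<forall>t\<ge>0. ((\<lambda>\<tau>. rbo_field s (x \<tau>)) has_integral (x t - x0)) {0..t}) \<and>
     (\<forall>t\<le>0. ((\<lambda>\<tau>. rbo_field s (x \<tau>)) has_integral (x0 - x t)) {t..0})"

lemma rBO_solution_Psi: "rBO_solution s (Psi s x0) (\<lambda>t. Psi s (x t)) \<longleftrightarrow> coeff_solution x0 x"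
  unfolding rBO_solution_def coeff_solution_def CHper_Psi rBO_rhs_Psi distr_diff_Psi has_Hper_integral_Psi ..

lemma rBO_solution_cases:
  assumes "rBO_solution s u0 u"
  obtains x where "u = (\<lambda>t. Psi s (x t))"
proof -
  have "u t \<in> Hper s" for t
  proof -
    have "CHper s (\<bar>t\<bar> + 1) u"
      using assms unfolding rBO_solution_def by (meson abs_ge_zero add_nonneg_pos zero_less_one)
    then show ?thesis
      unfolding CHper_def using abs_ge_self[of t] abs_ge_minus_self[of t] by (auto dest!: bspec[of _ _ t])
  qed
  then have "\<exists>x. u t = Psi s x" for t
    using Hper_cases by metis
  then obtain x where "\<And>t. u t = Psi s (x t)"
    by metis
  then show ?thesis
    by (intro that[of x] ext) simp
qed

lemma continuous_on_rbo_field: "continuous_on A x \<Longrightarrow> continuous_on A (\<lambda>t. rbo_field s (x t))"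
  unfolding rbo_field_def
  by (intro continuous_intros bounded_linear.continuous_on[OF bounded_linear_linear_part]
      bounded_bilinear.continuous_on[OF bounded_bilinear_bilin[OF s]])

abbreviation field_sgn :: "real \<Rightarrow> hl2 \<Rightarrow> hl2" where
  "field_sgn \<sigma> \<equiv> \<lambda>b. \<sigma> *\<^sub>R rbo_field s b"

text \<open>The integrand is continuous, so the fundamental theorem of calculus applies. The
  negative half-line is reflected, which reverses the sign of the field.\<close>

lemma coeff_solution_imp_ode:
  assumes "coeff_solution x0 x"
  shows "x 0 = x0" "ode_sol (field_sgn 1) T x" "ode_sol (field_sgn (- 1)) T (\<lambda>t. x (- t))"
proof -
  have fwd: "((\<lambda>\<tau>. rbo_field s (x \<tau>)) has_integral (x t - x0)) {0..t}"
    and bwd: "((\<lambda>\<tau>. rbo_field s (x (- \<tau>))) has_integral (x0 - x (- t))) {0..t}" if "0 \<le> t" for t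
    using assms that has_integral_reflect_real[of "\<lambda>\<tau>. rbo_field s (x \<tau>)" "x0 - x (- t)" 0 "- t"]
    unfolding coeff_solution_def by auto
  have cont: "continuous_on A x" for A
  proof -
    \<comment> \<open>Continuity on compact intervals passes to the line through open ones;
      \<open>Suc n\<close> keeps the radii positive.\<close>
    have "continuous_on (\<Union>n::nat. {- real (Suc n)<..<real (Suc n)}) x"
    proof (rule continuous_on_open_UN)
      fix n
      have "0 < real (Suc n)"
        by simp
      then have "continuous_on {- real (Suc n)..real (Suc n)} x"
        using assms unfolding coeff_solution_def by blast
      then show "continuous_on {- real (Suc n)<..<real (Suc n)} x"
        by (rule continuous_on_subset) auto
    qed auto
    moreover have "(\<Union>n::nat. {- real (Suc n)<..<real (Suc n)}) = UNIV"
    proof -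
      have "\<exists>n. t \<in> {- real (Suc n)<..<real (Suc n)}" for t
      proof -
        obtain n where "\<bar>t\<bar> < real n"
          using reals_Archimedean2 by blast
        then show ?thesis
          by (intro exI[of _ n]) auto
      qed
      then show ?thesis
        by blast
    qed
    ultimately show ?thesis
      by (auto intro: continuous_on_subset)
  qed
  show "x 0 = x0"
    using integral_unique[OF fwd[OF order_refl]] by simp
  show "ode_sol (field_sgn 1) T x"
    unfolding ode_sol_def
  proof
    fix t assume t: "t \<in> {0..T}"
    have "((\<lambda>t. x0 + integral {0..t} (\<lambda>\<tau>. rbo_field s (x \<tau>))) has_vector_derivative (0 + rbo_field s (x t))) (at t within {0..T})"
      by (intro has_vector_derivative_add has_vector_derivative_const integral_has_vector_derivative continuous_on_rbo_field cont t)
    then have "((\<lambda>t. x0 + integral {0..t} (\<lambda>\<tau>. rbo_field s (x \<tau>))) has_vector_derivative (field_sgn 1 (x t))) (at t within {0..T})"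
      by simp
    then show "(x has_vector_derivative (field_sgn 1 (x t))) (at t within {0..T})"
      by (rule has_vector_derivative_transform[OF t, rotated]) (simp add: integral_unique[OF fwd])
  qed
  show "ode_sol (field_sgn (- 1)) T (\<lambda>t. x (- t))"
    unfolding ode_sol_def
  proof
    fix t assume t: "t \<in> {0..T}"
    have c: "continuous_on A (\<lambda>t. x (- t))" for A
      by (rule continuous_on_compose2[OF cont[of UNIV]]) (auto intro!: continuous_intros)
    have "((\<lambda>t. x0 - integral {0..t} (\<lambda>\<tau>. rbo_field s (x (- \<tau>)))) has_vector_derivative (0 - rbo_field s (x (- t)))) (at t within {0..T})"
      by (intro has_vector_derivative_diff has_vector_derivative_const integral_has_vector_derivative continuous_on_rbo_field c t)
    then have "((\<lambda>t. x0 - integral {0..t} (\<lambda>\<tau>. rbo_field s (x (- \<tau>)))) has_vector_derivative (field_sgn (- 1) (x (- t)))) (at t within {0..T})"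
      by simp
    then show "((\<lambda>t. x (- t)) has_vector_derivative (field_sgn (- 1) (x (- t)))) (at t within {0..T})"
      by (rule has_vector_derivative_transform[OF t, rotated]) (simp add: integral_unique[OF bwd])
  qed
qed

text \<open>The forward solution and the reflected backward solution share their value at 0, which
  makes the pasted curve continuous there.\<close>

lemma ode_imp_coeff_solution:
  assumes p: "\<And>T. ode_sol (field_sgn 1) T p" and m: "\<And>T. ode_sol (field_sgn (- 1)) T m"
    and x0: "p 0 = x0" "m 0 = x0"
  shows "coeff_solution x0 (\<lambda>t. if 0 \<le> t then p t else m (- t))" (is "coeff_solution x0 ?x")
proof -
  have cont: "continuous_on {0..T} y" if "ode_sol f T y" for f T and y :: "real \<Rightarrow> hl2"
    using that unfolding ode_sol_def by (intro continuous_on_vector_derivative) blast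
  note cp = cont[OF p] and cm = cont[OF m]
  have c: "continuous_on ({0..T} \<union> {-T..0}) ?x" for T
  proof (rule continuous_on_If)
    show "continuous_on {-T..0} (\<lambda>t. m (- t))"
      by (rule continuous_on_compose2[OF cm[of T]]) (auto intro!: continuous_intros)
  qed (auto simp: x0 cp)
  have "{0..T} \<union> {-T..0} = {-T..T}" if "0 < T" for T :: real
    using that by auto
  then have "\<forall>T>0. continuous_on {-T..T} ?x"
    using c by metis
  moreover have "((\<lambda>\<tau>. rbo_field s (?x \<tau>)) has_integral (?x t - x0)) {0..t}" if "0 \<le> t" for t
  proof -
    have "((\<lambda>\<tau>. field_sgn 1 (p \<tau>)) has_integral (p t - p 0)) {0..t}"
      using p[of t] that unfolding ode_sol_def by (intro fundamental_theorem_of_calculus) auto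
    then have "((\<lambda>\<tau>. field_sgn 1 (p \<tau>)) has_integral (?x t - x0)) {0..t}"
      using that by (simp add: x0)
    then show ?thesis
      by (rule has_integral_eq[rotated]) auto
  qed
  moreover have "((\<lambda>\<tau>. rbo_field s (?x \<tau>)) has_integral (x0 - ?x t)) {t..0}" if "t \<le> 0" for t
  proof -
    have "((\<lambda>\<tau>. field_sgn (- 1) (m \<tau>)) has_integral (m (- t) - m 0)) {0..- t}"
      using m[of "- t"] that unfolding ode_sol_def by (intro fundamental_theorem_of_calculus) auto
    then have "((\<lambda>\<tau>. - field_sgn (- 1) (m \<tau>)) has_integral - (m (- t) - m 0)) {0..- t}"
      by (rule has_integral_neg)
    then have "((\<lambda>\<tau>. rbo_field s (m \<tau>)) has_integral (x0 - m (- t))) {- 0..- t}"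
      by (simp add: x0)
    then have "((\<lambda>\<tau>. rbo_field s (m (- \<tau>))) has_integral (x0 - m (- t))) {t..0}"
      using has_integral_reflect_real[of "\<lambda>\<tau>. rbo_field s (m \<tau>)" "x0 - m (- t)" "- t" 0] by simp
    \<comment> \<open>At t = 0 the curve is defined by p, which agrees with m there.\<close>
    moreover have "?x t = m (- t)"
      using that x0 by auto
    ultimately have "((\<lambda>\<tau>. rbo_field s (m (- \<tau>))) has_integral (x0 - ?x t)) {t..0}"
      by simp
    then show ?thesis
      by (rule has_integral_eq[rotated]) (auto simp: x0)
  qed
  ultimately show ?thesis
    unfolding coeff_solution_def by (intro conjI allI impI) blast+
qed

end

section \<open>Existence, uniqueness and continuous dependence\<close>

theorem mainTheorem2:
  fixes s :: real
  assumes "s \<ge> 3 / 2"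
  shows "rBO_globally_well_posed s"
proof -
  have s: "1 \<le> s"
    using assms by simp
  let ?f = "\<lambda>\<sigma> b. \<sigma> *\<^sub>R rbo_field s b"
  \<comment> \<open>The sign 1 governs positive times, the sign -1 the reflected negative
    ones.\<close>
  have lip: "lipschitz_on_balls (?f 1)" "lipschitz_on_balls (?f (- 1))"
    by (intro rbo_field_scaled_lipschitz s; simp)+
  have ap: "apriori_bounded (?f 1)" "apriori_bounded (?f (- 1))"
    by (intro rbo_field_apriori assms; simp)+
  have "\<exists>!u. rBO_solution s u0 u" if "u0 \<in> Hper s" for u0
  proof -
    obtain x0 where x0: "u0 = Psi s x0"
      using Hper_cases[OF s \<open>u0 \<in> Hper s\<close>] .
    obtain p where p: "p 0 = x0" "\<And>T. ode_sol (?f 1) T p"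
      using ode_global_exists[OF lip(1) ap(1)] by blast
    obtain m where m: "m 0 = x0" "\<And>T. ode_sol (?f (- 1)) T m"
      using ode_global_exists[OF lip(2) ap(2)] by blast
    show ?thesis
    proof (rule ex_ex1I)
      show "\<exists>u. rBO_solution s u0 u"
        using ode_imp_coeff_solution[OF s p(2) m(2) p(1) m(1)]
        unfolding x0 rBO_solution_Psi[OF s, symmetric] by blast
    next
      fix u v assume uv: "rBO_solution s u0 u" "rBO_solution s u0 v"
      obtain x where x: "u = (\<lambda>t. Psi s (x t))"
        using rBO_solution_cases[OF s uv(1)] .
      obtain y where y: "v = (\<lambda>t. Psi s (y t))"
        using rBO_solution_cases[OF s uv(2)] .
      have sol: "coeff_solution s x0 x" "coeff_solution s x0 y"
        using uv unfolding x0 x y rBO_solution_Psi[OF s] by simp_all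
      note X = coeff_solution_imp_ode[OF s sol(1)] and Y = coeff_solution_imp_ode[OF s sol(2)]
      have "x t = y t" for t
      proof (cases "0 \<le> t")
        case True
        then show ?thesis
          using ode_unique[OF lip(1) ap(1) X(2) Y(2), of t t] X(1) Y(1) by simp
      next
        case False
        then show ?thesis
          using ode_unique[OF lip(2) ap(2) X(3) Y(3), of "- t" "- t"] X(1) Y(1) by simp
      qed
      then show "u = v"
        by (simp add: x y)
    qed
  qed
  moreover have "\<exists>\<delta>>0. \<forall>v0\<in>Hper s. \<forall>v. rBO_solution s v0 v \<longrightarrow> Hnorm s (distr_diff v0 u0) < \<delta> \<longrightarrow>
      CHnorm s T (\<lambda>t. distr_diff (v t) (u t)) < \<epsilon>"
    if "0 < T" "u0 \<in> Hper s" "rBO_solution s u0 u" "0 < \<epsilon>" for T u0 u \<epsilon>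
  proof -
    obtain x0 where x0: "u0 = Psi s x0"
      using Hper_cases[OF s \<open>u0 \<in> Hper s\<close>] .
    obtain x where x: "u = (\<lambda>t. Psi s (x t))"
      using rBO_solution_cases[OF s \<open>rBO_solution s u0 u\<close>] .
    have "coeff_solution s x0 x"
      using \<open>rBO_solution s u0 u\<close> unfolding x0 x rBO_solution_Psi[OF s] .
    note X = coeff_solution_imp_ode[OF s this]
    \<comment> \<open>A ball containing all data at distance less than 1 from x0, so that L and M do
      not depend on the perturbed datum.\<close>
    define r where "r = norm x0 + 1"
    obtain L where L: "0 \<le> L" "\<And>x y t. ode_sol (?f 1) T x \<Longrightarrow> ode_sol (?f 1) T y \<Longrightarrow> norm (x 0) \<le> r \<Longrightarrow>
        norm (y 0) \<le> r \<Longrightarrow> t \<in> {0..T} \<Longrightarrow> norm (x t - y t) \<le> L * norm (x 0 - y 0)"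
      using ode_stability[OF lip(1) ap(1), of T r] by metis
    obtain M where M: "0 \<le> M" "\<And>x y t. ode_sol (?f (- 1)) T x \<Longrightarrow> ode_sol (?f (- 1)) T y \<Longrightarrow> norm (x 0) \<le> r \<Longrightarrow>
        norm (y 0) \<le> r \<Longrightarrow> t \<in> {0..T} \<Longrightarrow> norm (x t - y t) \<le> M * norm (x 0 - y 0)"
      using ode_stability[OF lip(2) ap(2), of T r] by metis
    \<comment> \<open>The first entry forces |y0 - x0| < 1. The second makes the supremum at most
      \<epsilon> / 2, hence strictly below \<epsilon>; the added 1 keeps the divisor
      positive.\<close>
    define \<delta> where "\<delta> = min (sqrt (2 * pi)) (\<epsilon> / (2 * (L + M + 1)))"
    have "0 < \<delta>"
      using L(1) M(1) \<open>0 < \<epsilon>\<close> by (simp add: \<delta>_def)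
    moreover have "CHnorm s T (\<lambda>t. distr_diff (v t) (u t)) < \<epsilon>"
      if "v0 \<in> Hper s" "rBO_solution s v0 v" "Hnorm s (distr_diff v0 u0) < \<delta>" for v0 v
    proof -
      obtain y0 where y0: "v0 = Psi s y0"
        using Hper_cases[OF s \<open>v0 \<in> Hper s\<close>] .
      obtain y where y: "v = (\<lambda>t. Psi s (y t))"
        using rBO_solution_cases[OF s \<open>rBO_solution s v0 v\<close>] .
      have "coeff_solution s y0 y"
        using \<open>rBO_solution s v0 v\<close> unfolding y0 y rBO_solution_Psi[OF s] .
      note Y = coeff_solution_imp_ode[OF s this]
      have close: "sqrt (2 * pi) * norm (y0 - x0) < \<delta>"
        using \<open>Hnorm s (distr_diff v0 u0) < \<delta>\<close> unfolding x0 y0 Hnorm_diff[OF s] .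
      then have "sqrt (2 * pi) * norm (y0 - x0) < sqrt (2 * pi) * 1"
        by (simp add: \<delta>_def)
      then have "norm (y0 - x0) < 1"
        by (rule mult_less_cancel_left_pos[THEN iffD1, rotated]) simp
      then have r: "norm y0 \<le> r" "norm x0 \<le> r"
        using norm_triangle_ineq2[of y0 x0] by (simp_all add: r_def)
      have diff: "norm (y t - x t) \<le> (L + M) * norm (y0 - x0)" if "t \<in> {-T..T}" for t
      proof (cases "0 \<le> t")
        case True
        then have "norm (y t - x t) \<le> L * norm (y0 - x0)"
          using L(2)[OF Y(2) X(2), of t] that r X(1) Y(1) by simp
        moreover have "0 \<le> M * norm (y0 - x0)"
          by (intro mult_nonneg_nonneg M(1) norm_ge_zero)
        ultimately show ?thesis
          unfolding distrib_right by linarith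
      next
        case False
        then have "norm (y t - x t) \<le> M * norm (y0 - x0)"
          using M(2)[OF Y(3) X(3), of "- t"] that r X(1) Y(1) by simp
        moreover have "0 \<le> L * norm (y0 - x0)"
          by (intro mult_nonneg_nonneg L(1) norm_ge_zero)
        ultimately show ?thesis
          unfolding distrib_right by linarith
      qed
      have "CHnorm s T (\<lambda>t. distr_diff (v t) (u t)) \<le> (L + M) * \<delta>"
        unfolding CHnorm_def
      proof (rule cSUP_least)
        show "{-T..T} \<noteq> {}"
          using \<open>0 < T\<close> by simp
        fix t assume t: "t \<in> {-T..T}"
        have "Hnorm s (distr_diff (v t) (u t)) = sqrt (2 * pi) * norm (y t - x t)"
          unfolding x y by (rule Hnorm_diff[OF s])
        also have "\<dots> \<le> sqrt (2 * pi) * ((L + M) * norm (y0 - x0))"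
          by (intro mult_left_mono diff t) simp
        also have "\<dots> = (L + M) * (sqrt (2 * pi) * norm (y0 - x0))"
          by simp
        also have "\<dots> \<le> (L + M) * \<delta>"
          using close L(1) M(1) by (intro mult_left_mono) auto
        finally show "Hnorm s (distr_diff (v t) (u t)) \<le> (L + M) * \<delta>" .
      qed
      also have "\<dots> \<le> (L + M + 1) * (\<epsilon> / (2 * (L + M + 1)))"
        using L(1) M(1) \<open>0 < \<delta>\<close> by (intro mult_mono) (auto simp: \<delta>_def)
      also have "\<dots> = \<epsilon> / 2"
      proof -
        have "c * (\<epsilon> / (2 * c)) = \<epsilon> / 2" if "0 < c" for c
          using that by simp
        then show ?thesis
          using L(1) M(1) by (simp only: add_nonneg_pos add_nonneg_nonneg zero_less_one)
      qed
      finally show ?thesis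
        using \<open>0 < \<epsilon>\<close> by simp
    qed
    ultimately show ?thesis
      by blast
  qed
  ultimately show ?thesis
    unfolding rBO_globally_well_posed_def by blast
qed

end
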